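(* Let $n=2$, let $\Omega\subset\mathbb{R}^2$ be a connected bounded open set with Lipschitz boundary, $a\in L^\infty(\Omega)$ with $0<m\le a\le M$, and $F=\nabla f$, $\tilde F=\nabla\tilde f$ with $f,\tilde f\in C^1(\Omega)\cap C(\overline\Omega)$. Suppose $u$ and $\tilde u$ are admissible for $(a,F,H)$ and $(a,\tilde F,H)$ respectively (with constants $\sigma_0,\sigma_1,m,M$), with $u|_{\partial\Omega}=\tilde u|_{\partial\Omega}=0$ and coefficients $\sigma,\tilde\sigma$. Suppose $F,\tilde F\in C^2(\overline\Omega)$, $H\in C^1(\overline\Omega)$, $\sigma,\tilde\sigma\in C^2(\overline\Omega)$ and $$\|F\|_{C^2(\Omega)},\|\tilde F\|_{C^2(\Omega)},\|H\|_{C^1(\Omega)}\le k_2,\qquad\|\sigma\|_{C^2(\Omega)},\|\tilde\sigma\|_{C^2(\Omega)}\le\sigma_2$$ for some $k_2,\sigma_2>0$. Let $v=u+f$, and suppose $\sup_{t\in\mathbb{R}}\int_{\{v=t\}\cap\Omega}dl=K<\infty$. If the level sets of $v$ are well-structured with constant $\tilde K$, then $$\|\nabla u-\nabla\tilde u\|_{L^1(\Omega)}\le C\,\|F-\tilde F\|_{L^1(\Omega)}^{1/4}$$ for some constant $C=C(\Omega,m,M,k_2,K,\tilde K,\sigma_0,\sigma_1,\sigma_2)$ independent of $\tilde u$ and $\tilde\sigma$.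
   Context: Admissibility: fix $\sigma_0,\sigma_1>0$. For data $(a,F,H)$, $u\in C^1(\overline\Omega)$ is admissible if $u$ minimizes $\int_\Omega(a|Dw+F|+Hw)\,dx$ over $w\in H_0^1(\Omega)$ and there is $\sigma\in C(\Omega)$ with $0<\sigma_0\le\sigma\le\sigma_1$ such that $J=\sigma(\nabla u+F)$ and $m\le|J|\le M$. Here $J$ is the flux field of the problem (a solution of the dual problem of maximizing $\int_\Omega F\cdot b\,dx$ over $b\in L^2(\Omega;\mathbb{R}^n)$ with $|b|\le a$ a.e. and $\int_\Omega(\nabla w\cdot b+Hw)\,dx=0$ for all $w\in H^1_0(\Omega)$); thus $\nabla\cdot J=H$ weakly, $|J|=a$ and $\sigma=a/|\nabla u+F|$. Well-structured level sets ($n=2$): the level sets of $v$ are well-structured if, with a constant $\tilde K$, for a.e. $x\in\Omega$, every $h\in S^{1}$ and all sufficiently small $t\neq0$: if $\gamma$ is the arc-length parametrization of the level curve of $v$ through $x$, with $\gamma(0)\in\partial\Omega$ and $\gamma(s_0)=x$, then the level curve of $v$ through $x+th$ has a $C^1$ parametrization $\gamma_t$ with $\gamma_t(0)\in\partial\Omega$, $\gamma_t(s_0)=x+th$, such that $|\gamma_t'(s)-\gamma'(s)|\le\tilde K|t|$ for $s\in[0,s_0]$, and the limit $B_{x,h}(s)=\lim_{t\to0}\frac{\gamma_t(s)-\gamma(s)}{t}$ exists, with $B_{x,h}$ bounded uniformly in $x,h,s$. (In particular level curves of $v$ reach $\partial\Omega$.) *)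

theory Defs
  imports "HOL-Analysis.Analysis"
begin

section \<open>Classical differentiability classes\<close>

definition partial :: "'n::finite \<Rightarrow> (real^'n \<Rightarrow> 'b::real_normed_vector) \<Rightarrow> real^'n \<Rightarrow> 'b" where
  "partial i f x = frechet_derivative f (at x) (axis i 1)"

definition grad :: "(real^'n::finite \<Rightarrow> real) \<Rightarrow> real^'n \<Rightarrow> real^'n" where
  "grad f x = (\<chi> i. partial i f x)"

text \<open>Iterated partial derivatives are indexed by lists of coordinates:
  \<open>foldr partial [i, j] f\<close> is the derivative of \<open>partial j f\<close> in direction \<open>i\<close>.
  The set \<open>U\<close> is meant to be open.\<close>

definition Ck_on :: "nat \<Rightarrow> (real^'n::finite) set \<Rightarrow> (real^'n \<Rightarrow> 'b::real_normed_vector) \<Rightarrow> bool" where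
  "Ck_on k U f \<longleftrightarrow>
     (\<forall>is. length is < k \<longrightarrow> foldr partial is f differentiable_on U) \<and>
     (\<forall>is. length is \<le> k \<longrightarrow> continuous_on U (foldr partial is f))"

text \<open>Up to the boundary: all derivatives of order at most \<open>k\<close> extend continuously from
  \<open>\<Omega>\<close> to its closure, and \<open>f\<close> itself carries its continuous boundary values. (The values of
  \<open>partial\<close> at boundary points are meaningless, hence the explicit extension \<open>g\<close>.)\<close>

definition Ck_closure :: "nat \<Rightarrow> (real^'n::finite) set \<Rightarrow> (real^'n \<Rightarrow> 'b::real_normed_vector) \<Rightarrow> bool" where
  "Ck_closure k \<Omega> f \<longleftrightarrow>
     Ck_on k \<Omega> f \<and> continuous_on (closure \<Omega>) f \<and>
     (\<forall>is. length is \<le> k \<longrightarrow>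
        (\<exists>g. continuous_on (closure \<Omega>) g \<and> (\<forall>x\<in>\<Omega>. g x = foldr partial is f x)))"

definition Ck_norm :: "nat \<Rightarrow> (real^'n::finite) set \<Rightarrow> (real^'n \<Rightarrow> 'b::real_normed_vector) \<Rightarrow> real" where
  "Ck_norm k \<Omega> f = (SUP (is, x) \<in> {is. length is \<le> k} \<times> \<Omega>. norm (foldr partial is f x))"


section \<open>Domains with Lipschitz boundary\<close>

text \<open>Near each boundary point, in suitable orthonormal coordinates \<open>(e1, e2)\<close>, the set is
  the strict epigraph of a Lipschitz function.\<close>

definition lipschitz_boundary :: "(real^2) set \<Rightarrow> bool" where
  "lipschitz_boundary \<Omega> \<longleftrightarrow>
     (\<forall>p\<in>frontier \<Omega>. \<exists>r>0. \<exists>e1 e2 L. \<exists>g::real \<Rightarrow> real.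
        norm e1 = 1 \<and> norm e2 = 1 \<and> e1 \<bullet> e2 = 0 \<and> L-lipschitz_on UNIV g \<and>
        \<Omega> \<inter> ball p r = {x \<in> ball p r. x \<bullet> e2 > g (x \<bullet> e1)})"


section \<open>The Sobolev space \<open>H\<^sub>0\<^sup>1(\<Omega>)\<close>\<close>

definition L2_on :: "(real^'n::finite) set \<Rightarrow> (real^'n \<Rightarrow> 'b::euclidean_space) \<Rightarrow> bool" where
  "L2_on \<Omega> f \<longleftrightarrow>
     set_borel_measurable lebesgue \<Omega> f \<and> set_integrable lebesgue \<Omega> (\<lambda>x. (norm (f x))\<^sup>2)"

definition test_function :: "(real^'n::finite) set \<Rightarrow> (real^'n \<Rightarrow> real) \<Rightarrow> bool" where
  "test_function \<Omega> \<phi> \<longleftrightarrow>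
     (\<forall>k. Ck_on k UNIV \<phi>) \<and>
     compact (closure {x. \<phi> x \<noteq> 0}) \<and> closure {x. \<phi> x \<noteq> 0} \<subseteq> \<Omega>"

definition is_weak_gradient :: "(real^'n::finite) set \<Rightarrow> (real^'n \<Rightarrow> real) \<Rightarrow> (real^'n \<Rightarrow> real^'n) \<Rightarrow> bool" where
  "is_weak_gradient \<Omega> w G \<longleftrightarrow>
     (\<forall>\<phi> i. test_function \<Omega> \<phi> \<longrightarrow>
        (LINT x:\<Omega>|lebesgue. w x * partial i \<phi> x) = - (LINT x:\<Omega>|lebesgue. (G x $ i) * \<phi> x))"

definition H1 :: "(real^'n::finite) set \<Rightarrow> (real^'n \<Rightarrow> real) set" where
  "H1 \<Omega> = {w. L2_on \<Omega> w \<and> (\<exists>G. L2_on \<Omega> G \<and> is_weak_gradient \<Omega> w G)}"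

text \<open>A representative of the weak gradient, which is unique up to null sets.\<close>

definition wgrad :: "(real^'n::finite) set \<Rightarrow> (real^'n \<Rightarrow> real) \<Rightarrow> real^'n \<Rightarrow> real^'n" where
  "wgrad \<Omega> w = (SOME G. L2_on \<Omega> G \<and> is_weak_gradient \<Omega> w G)"

definition H10 :: "(real^'n::finite) set \<Rightarrow> (real^'n \<Rightarrow> real) set" where
  "H10 \<Omega> = {w \<in> H1 \<Omega>. \<exists>\<phi> :: nat \<Rightarrow> real^'n \<Rightarrow> real. (\<forall>n. test_function \<Omega> (\<phi> n)) \<and>
     (\<lambda>n. LINT x:\<Omega>|lebesgue. (\<phi> n x - w x)\<^sup>2 + (norm (grad (\<phi> n) x - wgrad \<Omega> w x))\<^sup>2)
       \<longlonglongrightarrow> 0}"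


section \<open>The minimization problem, its dual, and admissibility\<close>

definition energy ::
  "(real^2) set \<Rightarrow> (real^2 \<Rightarrow> real) \<Rightarrow> (real^2 \<Rightarrow> real^2) \<Rightarrow> (real^2 \<Rightarrow> real) \<Rightarrow> (real^2 \<Rightarrow> real) \<Rightarrow> real" where
  "energy \<Omega> a F H w =
     (LINT x:\<Omega>|lebesgue. a x * norm (wgrad \<Omega> w x + F x) + H x * w x)"

definition dual_feasible ::
  "(real^2) set \<Rightarrow> (real^2 \<Rightarrow> real) \<Rightarrow> (real^2 \<Rightarrow> real) \<Rightarrow> (real^2 \<Rightarrow> real^2) \<Rightarrow> bool" where
  "dual_feasible \<Omega> a H b \<longleftrightarrow>
     L2_on \<Omega> b \<and> (AE x in lebesgue. x \<in> \<Omega> \<longrightarrow> norm (b x) \<le> a x) \<and>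
     (\<forall>w\<in>H10 \<Omega>. (LINT x:\<Omega>|lebesgue. wgrad \<Omega> w x \<bullet> b x + H x * w x) = 0)"

definition dual_solution ::
  "(real^2) set \<Rightarrow> (real^2 \<Rightarrow> real) \<Rightarrow> (real^2 \<Rightarrow> real^2) \<Rightarrow> (real^2 \<Rightarrow> real) \<Rightarrow> (real^2 \<Rightarrow> real^2) \<Rightarrow> bool" where
  "dual_solution \<Omega> a F H J \<longleftrightarrow>
     is_arg_max (\<lambda>b. LINT x:\<Omega>|lebesgue. F x \<bullet> b x) (dual_feasible \<Omega> a H) J"

text \<open>\<open>u\<close> is admissible for the data \<open>(a, F, H)\<close>, with coefficient \<open>\<sigma>\<close> and flux field
  \<open>J = \<sigma> (\<nabla>u + F)\<close>. That \<open>J\<close> has weak divergence \<open>H\<close> is part of dual feasibility;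
  \<open>|J| = a\<close> is a consequence of optimality and not assumed.\<close>

definition admissible ::
  "real \<Rightarrow> real \<Rightarrow> real \<Rightarrow> real \<Rightarrow> (real^2) set \<Rightarrow> (real^2 \<Rightarrow> real) \<Rightarrow> (real^2 \<Rightarrow> real^2) \<Rightarrow> (real^2 \<Rightarrow> real)
    \<Rightarrow> (real^2 \<Rightarrow> real) \<Rightarrow> (real^2 \<Rightarrow> real) \<Rightarrow> bool" where
  "admissible \<sigma>\<^sub>0 \<sigma>\<^sub>1 m M \<Omega> a F H u \<sigma> \<longleftrightarrow>
     Ck_closure 1 \<Omega> u \<and>
     is_arg_min (energy \<Omega> a F H) (\<lambda>w. w \<in> H10 \<Omega>) u \<and>
     continuous_on \<Omega> \<sigma> \<and> (\<forall>x\<in>\<Omega>. \<sigma>\<^sub>0 \<le> \<sigma> x \<and> \<sigma> x \<le> \<sigma>\<^sub>1) \<and>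
     (let J = (\<lambda>x. \<sigma> x *\<^sub>R (grad u x + F x)) in
        dual_solution \<Omega> a F H J \<and> (\<forall>x\<in>\<Omega>. m \<le> norm (J x) \<and> norm (J x) \<le> M))"


section \<open>Length and structure of level sets\<close>

text \<open>One-dimensional Hausdorff measure, i.e. length for curves; with the usual
  normalization no constant appears in dimension one. Boundedness of the covering sets is
  required because \<open>diameter\<close> is only meaningful for bounded sets.\<close>

definition hausdorff1_pre :: "real \<Rightarrow> (real^2) set \<Rightarrow> ennreal" where
  "hausdorff1_pre \<delta> A =
     (INF E \<in> {E :: nat \<Rightarrow> (real^2) set.
                 A \<subseteq> (\<Union>i. E i) \<and> (\<forall>i. bounded (E i) \<and> diameter (E i) \<le> \<delta>)}.
        \<Sum>i. ennreal (diameter (E i)))"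

definition hausdorff1 :: "(real^2) set \<Rightarrow> ennreal" where
  "hausdorff1 A = (SUP \<delta>\<in>{0<..}. hausdorff1_pre \<delta> A)"

text \<open>A \<open>C\<^sup>1\<close> parametrization \<open>g\<close>, with derivative \<open>g'\<close>, on \<open>[0, s\<^sub>0]\<close> of the piece of the
  level curve of \<open>v\<close> through \<open>y\<close> that runs inside \<open>\<Omega>\<close> from the boundary to \<open>y\<close>.\<close>

definition level_path ::
  "(real^2) set \<Rightarrow> (real^2 \<Rightarrow> real) \<Rightarrow> real^2 \<Rightarrow> real \<Rightarrow> (real \<Rightarrow> real^2) \<Rightarrow> (real \<Rightarrow> real^2) \<Rightarrow> bool" where
  "level_path \<Omega> v y s\<^sub>0 g g' \<longleftrightarrow>
     (\<forall>s\<in>{0..s\<^sub>0}. (g has_vector_derivative g' s) (at s within {0..s\<^sub>0})) \<and>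
     continuous_on {0..s\<^sub>0} g' \<and>
     g 0 \<in> frontier \<Omega> \<and> g s\<^sub>0 = y \<and> g ` {0<..s\<^sub>0} \<subseteq> \<Omega> \<and>
     (\<forall>s\<in>{0..s\<^sub>0}. v (g s) = v y)"

text \<open>The range of small \<open>t\<close> may depend on \<open>x\<close> and \<open>h\<close>; the bound \<open>\<beta>\<close> on the limits \<open>B\<close>
  does not.\<close>

definition well_structured :: "(real^2) set \<Rightarrow> (real^2 \<Rightarrow> real) \<Rightarrow> real \<Rightarrow> bool" where
  "well_structured \<Omega> v Kt \<longleftrightarrow>
     (\<exists>\<beta>. AE x in lebesgue. x \<in> \<Omega> \<longrightarrow>
        (\<exists>s\<^sub>0>0. \<exists>\<gamma> \<gamma>'. level_path \<Omega> v x s\<^sub>0 \<gamma> \<gamma>' \<and> (\<forall>s\<in>{0..s\<^sub>0}. norm (\<gamma>' s) = 1) \<and>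
          (\<forall>h. norm h = 1 \<longrightarrow>
            (\<exists>\<gamma>t \<gamma>t' B.
               (\<forall>\<^sub>F t in at 0. level_path \<Omega> v (x + t *\<^sub>R h) s\<^sub>0 (\<gamma>t t) (\<gamma>t' t) \<and>
                  (\<forall>s\<in>{0..s\<^sub>0}. norm (\<gamma>t' t s - \<gamma>' s) \<le> Kt * \<bar>t\<bar>)) \<and>
               (\<forall>s\<in>{0..s\<^sub>0}. ((\<lambda>t. (\<gamma>t t s - \<gamma> s) /\<^sub>R t) \<longlongrightarrow> B s) (at 0) \<and>
                  norm (B s) \<le> \<beta>)))))"

end

theory Submission
  imports Defs
begin

text \<open>
  Write \<open>v = u + f\<close>, \<open>J = \<sigma> \<nabla>v\<close> and \<open>w = u - ut\<close>, with \<open>\<epsilon> = \<parallel>F - Ft\<parallel>\<close> in \<open>L\<^sup>1\<close>. Minimality of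
  \<open>u\<close> makes \<open>a \<nabla>v / |\<nabla>v|\<close> dual feasible, so optimality of \<open>J\<close> forces \<open>|J| = a\<close>, hence
  \<open>|J| = |Jt|\<close>. The weak equations tested with \<open>w\<close> then give \<open>\<parallel>J - Jt\<parallel>\<^sup>2 \<le> C \<epsilon>\<close> in \<open>L\<^sup>2\<close>. As \<open>J\<close> is
  normal to the level curves of \<open>v\<close>, the derivative of \<open>w\<close> along them is bounded by
  \<open>|J - Jt| + |F - Ft|\<close>; since \<open>w\<close> vanishes at the boundary, where the level curves start, and
  these have length at most \<open>K\<close>, a coarea argument yields \<open>\<parallel>w\<parallel> \<le> C \<epsilon>\<^sup>1\<^sup>/\<^sup>2\<close> in \<open>L\<^sup>1\<close>. Finally the weak
  equations tested with \<open>w / \<sigma>\<close> and \<open>w / \<sigma>t\<close> show that \<open>\<nabla>v\<close> and \<open>\<nabla>vt\<close> have bounded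
  divergence, so that \<open>\<parallel>\<nabla>w\<parallel>\<^sup>2 \<le> C (\<parallel>w\<parallel> + \<epsilon>)\<close> with the norms of \<open>L\<^sup>2\<close>, \<open>L\<^sup>1\<close> and \<open>L\<^sup>1\<close>. No elliptic
  regularity is needed.
\<close>

section \<open>Level sets in the plane\<close>

text \<open>The exponent 1/4 is made of two square roots. The flux estimate controls the square of
  \<open>J - Jt\<close>, so the L1 norm of \<open>J - Jt\<close>, and with it that of
  \<open>w\<close>, is of order \<epsilon>^(1/2); the last step controls a square again, that of the
  gradient of \<open>w\<close>. Terms linear in \<epsilon> are absorbed because \<open>F\<close> and
  \<open>Ft\<close> are bounded, which makes \<epsilon> at most a constant times \<epsilon>^(1/2).
  The lower bound m/\<sigma>1 on the length of the gradient of \<open>v\<close> serves twice: the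
  energy can be differentiated at \<open>u\<close>, and every level set of \<open>v\<close> is
  locally a curve that is nearly straight at a uniform scale. The delicate point is that the length
  bound concerns level sets, while the boundary condition is transported by curves inside them. A
  grid links the two: a cell met by the curve is counted once, however the curve runs through it,
  and the points whose level set meets a given cell lie in a thin tube, whose area is controlled by
  length.\<close>

definition perp :: "real^2 \<Rightarrow> real^2" where
  "perp x = vector [- x $ 2, x $ 1]"

lemma perp_nth [simp]: "perp x $ 1 = - x $ 2" "perp x $ 2 = x $ 1"
  by (simp_all add: perp_def)

lemma inner_real2: "x \<bullet> y = x $ 1 * y $ 1 + x $ 2 * y $ (2::2)" for x y :: "real^2"
  by (simp add: inner_vec_def sum_2)

lemma norm_perp [simp]: "norm (perp x) = norm x"
  by (simp add: norm_eq_sqrt_inner inner_real2)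

lemma inner_perp_self [simp]: "x \<bullet> perp x = 0" "perp x \<bullet> x = 0"
  by (simp_all add: inner_real2)

lemma perp_diff: "perp (x - y) = perp x - perp y"
  by (simp add: vec_eq_iff forall_2)

lemma perp_scaleR: "perp (c *\<^sub>R x) = c *\<^sub>R perp x"
  by (simp add: vec_eq_iff forall_2)

lemma bounded_linear_perp: "bounded_linear perp"
  by (rule bounded_linear_intro[where K=1]) (auto simp: vec_eq_iff forall_2)

lemma continuous_on_perp [continuous_intros]: "continuous_on S f \<Longrightarrow> continuous_on S (\<lambda>x. perp (f x))"
  by (rule bounded_linear.continuous_on[OF bounded_linear_perp])

text \<open>In the plane, a vector orthogonal to \<open>b\<close> is parallel to
  \<open>perp b\<close>; the proof expands in the frame \<open>b\<close>, \<open>perp b\<close>. It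
  is applied with \<open>b\<close> a gradient of \<open>v\<close>, \<open>a\<close> a gradient of
  \<open>w\<close> and \<open>d\<close> the difference of two points with the same value of
  \<open>v\<close>, and turns an increment of \<open>w\<close> into a tangential derivative.\<close>

lemma inner_perp_orthogonal:
  assumes "b \<bullet> d = 0"
  shows "\<bar>a \<bullet> d\<bar> * norm b = \<bar>a \<bullet> perp b\<bar> * norm d"
proof (rule power2_eq_imp_eq)
  have "(a \<bullet> d) * (b \<bullet> b) = (a \<bullet> b) * (d \<bullet> b) + (a \<bullet> perp b) * (d \<bullet> perp b)"
    by (simp add: inner_real2 algebra_simps)
  then have 1: "(a \<bullet> d) * (b \<bullet> b) = (a \<bullet> perp b) * (d \<bullet> perp b)"
    using assms by (simp add: inner_commute)
  have 2: "(d \<bullet> perp b)\<^sup>2 = (d \<bullet> d) * (b \<bullet> b)"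
  proof -
    have "(d \<bullet> perp b)\<^sup>2 + (b \<bullet> d)\<^sup>2 = (d \<bullet> d) * (b \<bullet> b)"
      by (simp add: inner_real2 power2_eq_square algebra_simps)
    then show ?thesis using assms by simp
  qed
  show "(\<bar>a \<bullet> d\<bar> * norm b)\<^sup>2 = (\<bar>a \<bullet> perp b\<bar> * norm d)\<^sup>2"
  proof (cases "b = 0")
    case False
    then have "b \<bullet> b \<noteq> 0" by simp
    have "((a \<bullet> d)\<^sup>2 * (b \<bullet> b)) * (b \<bullet> b) = ((a \<bullet> perp b)\<^sup>2 * (d \<bullet> d)) * (b \<bullet> b)"
      using 1 2 by (metis (no_types, opaque_lifting) mult.assoc power2_eq_square power_mult_distrib)
    then have "(a \<bullet> d)\<^sup>2 * (b \<bullet> b) = (a \<bullet> perp b)\<^sup>2 * (d \<bullet> d)"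
      using \<open>b \<bullet> b \<noteq> 0\<close> by simp
    then show ?thesis by (simp add: power_mult_distrib power2_norm_eq_inner)
  next
    case True
    then have "perp b = 0" by (simp add: vec_eq_iff forall_2)
    with True show ?thesis by simp
  qed
qed auto

lemma has_real_derivative_along_line:
  fixes v :: "'a::real_inner \<Rightarrow> real"
  assumes "(v has_derivative (\<lambda>h. D \<bullet> h)) (at (q + s *\<^sub>R e))"
  shows "((\<lambda>s. v (q + s *\<^sub>R e)) has_real_derivative D \<bullet> e) (at s)"
proof -
  have "((\<lambda>s. q + s *\<^sub>R e) has_derivative (\<lambda>h. h *\<^sub>R e)) (at s)"
    by (auto intro!: derivative_eq_intros)
  from has_derivative_compose[OF this assms] show ?thesis
    unfolding has_field_derivative_def by (auto simp: mult.commute[of _ "D \<bullet> e"] mult_commute_abs)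
qed

text \<open>Along \<open>e\<close> the function grows at rate at least \<open>c\<close>, since
  subtracting \<open>c * s\<close> leaves a nondecreasing function of \<open>s\<close>. Hence its
  values on the segment cover everything within \<open>c * T\<close> of \<open>v q\<close>.\<close>

lemma level_value_on_segment:
  fixes v :: "'a::real_inner \<Rightarrow> real"
  assumes deriv: "\<And>s. \<bar>s\<bar> \<le> T \<Longrightarrow> (v has_derivative (\<lambda>h. Dv (q + s *\<^sub>R e) \<bullet> h)) (at (q + s *\<^sub>R e))"
    and pos: "\<And>s. \<bar>s\<bar> \<le> T \<Longrightarrow> c \<le> Dv (q + s *\<^sub>R e) \<bullet> e"
    and t: "\<bar>t - v q\<bar> \<le> c * T" and "0 \<le> T"
  shows "\<exists>s. \<bar>s\<bar> \<le> T \<and> v (q + s *\<^sub>R e) = t"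
proof -
  define \<phi> where "\<phi> s = v (q + s *\<^sub>R e)" for s
  have d: "(\<phi> has_real_derivative Dv (q + s *\<^sub>R e) \<bullet> e) (at s)" if "\<bar>s\<bar> \<le> T" for s
    unfolding \<phi>_def by (rule has_real_derivative_along_line[OF deriv[OF that]])
  have mono: "\<phi> a - c * a \<le> \<phi> b - c * b" if "a \<le> b" "\<bar>a\<bar> \<le> T" "\<bar>b\<bar> \<le> T" for a b
  proof (rule DERIV_nonneg_imp_nondecreasing[OF \<open>a \<le> b\<close>])
    fix x assume x: "a \<le> x" "x \<le> b"
    then have "\<bar>x\<bar> \<le> T" using that by auto
    then show "\<exists>y. ((\<lambda>a. \<phi> a - c * a) has_real_derivative y) (at x) \<and> 0 \<le> y"
      using pos by (intro exI[of _ "Dv (q + x *\<^sub>R e) \<bullet> e - c"] conjI) (auto intro!: derivative_eq_intros d)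
  qed
  have "\<phi> (-T) \<le> t" "t \<le> \<phi> T"
    using mono[of "-T" 0] mono[of 0 T] t \<open>0 \<le> T\<close> by (auto simp: \<phi>_def)
  moreover have "continuous_on {-T..T} \<phi>"
    by (intro continuous_at_imp_continuous_on ballI DERIV_isCont[OF d]) auto
  ultimately obtain s where "-T \<le> s" "s \<le> T" "\<phi> s = t"
    using IVT'[of \<phi> "-T" t T] \<open>0 \<le> T\<close> by auto
  then show ?thesis by (intro exI[of _ s]) (auto simp: \<phi>_def)
qed

lemma mvt_inner:
  fixes v :: "'a::real_inner \<Rightarrow> real"
  assumes deriv: "\<And>y. y \<in> S \<Longrightarrow> (v has_derivative (\<lambda>h. Dv y \<bullet> h)) (at y)"
    and "convex S" "p \<in> S" "q \<in> S"
  shows "\<exists>\<xi>\<in>S. v q - v p = Dv \<xi> \<bullet> (q - p)"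
proof -
  have seg: "p + s *\<^sub>R (q - p) \<in> S" if "0 \<le> s" "s \<le> 1" for s
  proof -
    have "p + s *\<^sub>R (q - p) = (1 - s) *\<^sub>R p + s *\<^sub>R q" by (simp add: algebra_simps)
    then show ?thesis using convexD_alt[OF \<open>convex S\<close> assms(3,4) that] by simp
  qed
  have d: "((\<lambda>s. v (p + s *\<^sub>R (q - p))) has_real_derivative Dv (p + s *\<^sub>R (q - p)) \<bullet> (q - p)) (at s)"
    if "0 \<le> s" "s \<le> 1" for s
    by (rule has_real_derivative_along_line[OF deriv[OF seg[OF that]]])
  obtain z where z: "0 < z" "z < 1"
    "v (p + 1 *\<^sub>R (q - p)) - v (p + 0 *\<^sub>R (q - p)) = (1 - 0) * (Dv (p + z *\<^sub>R (q - p)) \<bullet> (q - p))"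
    using MVT2[of 0 1 "\<lambda>s. v (p + s *\<^sub>R (q - p))" "\<lambda>s. Dv (p + s *\<^sub>R (q - p)) \<bullet> (q - p)"] d by auto
  then show ?thesis using seg[of z] by (intro bexI[of _ "p + z *\<^sub>R (q - p)"]) auto
qed

section \<open>Length of a level curve and area of a tube around it\<close>

text \<open>Near each \<open>p\<close> the set \<open>A\<close> projects onto an interval of length
  \<open>R/4\<close>, and projection does not increase distances, so covering this piece costs a
  total diameter of at least \<open>R/8\<close>. Covering sets of diameter at most
  \<open>R/8\<close> cannot serve two points of \<open>P\<close>: that would put them within R/4 +
  R/8 + R/4 < R of each other.\<close>

lemma hausdorff1_ge_separated:
  fixes A P :: "(real^2) set" and e :: "real^2 \<Rightarrow> real^2"
  assumes "finite P" "0 < R"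
    and sep: "\<And>p q. p \<in> P \<Longrightarrow> q \<in> P \<Longrightarrow> p \<noteq> q \<Longrightarrow> R \<le> dist p q"
    and e: "\<And>p. p \<in> P \<Longrightarrow> norm (e p) = 1"
    and proj: "\<And>p s. p \<in> P \<Longrightarrow> \<bar>s\<bar> \<le> R/8 \<Longrightarrow> \<exists>z\<in>A \<inter> cball p (R/4). (z - p) \<bullet> e p = s"
  shows "ennreal (real (card P) * (R/8)) \<le> hausdorff1 A"
proof -
  have main: "ennreal (real (card P) * (R/8)) \<le> (\<Sum>i. ennreal (diameter (E i)))"
    if cov: "A \<subseteq> (\<Union>i. E i)" and bd: "\<And>i. bounded (E i)" and dm: "\<And>i. diameter (E i) \<le> R/8"
    for E :: "nat \<Rightarrow> (real^2) set"
  proof -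
    define I where "I p = {i. E i \<inter> cball p (R/4) \<noteq> {}}" for p
    have disj: "p = q" if "p \<in> P" "q \<in> P" "i \<in> I p" "i \<in> I q" for p q i
    proof (rule ccontr)
      assume "p \<noteq> q"
      from that obtain y z where y: "y \<in> E i" "dist p y \<le> R/4" and z: "z \<in> E i" "dist q z \<le> R/4"
        by (auto simp: I_def)
      have "dist y z \<le> R/8" using diameter_bounded_bound[OF bd y(1) z(1)] dm[of i] by simp
      then have "dist p q \<le> R/4 + R/8 + R/4"
        using y z dist_triangle[of p q y] dist_triangle[of y q z] by (simp add: dist_commute)
      then show False using sep[OF that(1,2) \<open>p \<noteq> q\<close>] \<open>0 < R\<close> by simp
    qed
    have one: "ennreal (R/8) \<le> (\<Sum>i. ennreal (diameter (E i)) * indicator (I p) i)" if p: "p \<in> P" for p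
    proof -
      \<comment> \<open>The projection of \<open>E i\<close> lies in the interval about the image of
        any one of its points with radius the diameter. Such an interval is twice as long as the
        diameter, which is why \<open>R/8\<close> comes out and not \<open>R/4\<close>.\<close>
      define B where "B i = (if i \<in> I p then cball ((SOME z. z \<in> E i) \<bullet> e p - p \<bullet> e p) (diameter (E i)) else {})" for i
      have "{-(R/8)..R/8} \<subseteq> (\<Union>i. B i)"
      proof
        fix s assume "s \<in> {-(R/8)..R/8}"
        then have "\<bar>s\<bar> \<le> R/8" by auto
        then obtain z where z: "z \<in> A" "z \<in> cball p (R/4)" "(z - p) \<bullet> e p = s"
          using proj[OF p] by blast
        then obtain i where i: "z \<in> E i" using cov by blast
        then have "i \<in> I p" using z by (auto simp: I_def)
        define y where "y = (SOME z. z \<in> E i)"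
        have "y \<in> E i" unfolding y_def using i by (rule someI)
        have "dist (y \<bullet> e p - p \<bullet> e p) s = \<bar>(y - z) \<bullet> e p\<bar>"
          using z(3) by (auto simp: dist_real_def inner_diff_left)
        also have "\<dots> \<le> norm (y - z) * norm (e p)" by (rule Cauchy_Schwarz_ineq2)
        also have "\<dots> \<le> diameter (E i)"
          using e[OF p] diameter_bounded_bound[OF bd \<open>y \<in> E i\<close> i] by (simp add: dist_norm)
        finally have "s \<in> B i" using \<open>i \<in> I p\<close> by (simp add: B_def y_def)
        then show "s \<in> (\<Union>i. B i)" by blast
      qed
      then have "emeasure lborel {-(R/8)..R/8} \<le> emeasure lborel (\<Union>i. B i)"
        by (intro emeasure_mono) (auto simp: B_def)
      also have "\<dots> \<le> (\<Sum>i. emeasure lborel (B i))"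
        by (intro emeasure_subadditive_countably) (auto simp: B_def)
      also have "\<dots> = (\<Sum>i. 2 * (ennreal (diameter (E i)) * indicator (I p) i))"
      proof (intro suminf_cong)
        fix i
        show "emeasure lborel (B i) = 2 * (ennreal (diameter (E i)) * indicator (I p) i)"
          using diameter_ge_0[OF bd[of i]]
          by (auto simp: B_def cball_eq_atLeastAtMost ennreal_mult' indicator_def)
      qed
      also have "\<dots> = 2 * (\<Sum>i. ennreal (diameter (E i)) * indicator (I p) i)"
        by simp
      finally have "2 * ennreal (R/8) \<le> 2 * (\<Sum>i. ennreal (diameter (E i)) * indicator (I p) i)"
        using ennreal_mult'[of 2 "R/8"] \<open>0 < R\<close> by simp
      then show ?thesis by (subst (asm) ennreal_mult_le_mult_iff) auto
    qed
    have "ennreal (real (card P) * (R/8)) = (\<Sum>p\<in>P. ennreal (R/8))"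
      using ennreal_mult[of "real (card P)" "R/8"] \<open>0 < R\<close> by (simp add: ennreal_of_nat_eq_real_of_nat)
    also have "\<dots> \<le> (\<Sum>p\<in>P. \<Sum>i. ennreal (diameter (E i)) * indicator (I p) i)"
      by (intro sum_mono one)
    also have "\<dots> = (\<Sum>i. \<Sum>p\<in>P. ennreal (diameter (E i)) * indicator (I p) i)"
      by (rule suminf_sum[symmetric]) auto
    \<comment> \<open>By \<open>disj\<close>, each index \<open>i\<close> lies in at most one of the
      sets \<open>I p\<close>.\<close>
    also have "\<dots> \<le> (\<Sum>i. ennreal (diameter (E i)))"
    proof (intro suminf_le allI)
      fix i
      have "(\<Sum>p\<in>P. indicator (I p) i :: ennreal) \<le> 1"
      proof (cases "\<exists>p\<in>P. i \<in> I p")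
        case True
        then obtain p where "p \<in> P" "i \<in> I p" by blast
        then have "(\<Sum>q\<in>P. indicator (I q) i :: ennreal) = (\<Sum>q\<in>P. if q = p then 1 else 0)"
          using disj by (intro sum.cong) (auto simp: indicator_def)
        also have "\<dots> = 1" using \<open>finite P\<close> \<open>p \<in> P\<close> by simp
        finally show ?thesis by simp
      qed (auto simp: indicator_def)
      then show "(\<Sum>p\<in>P. ennreal (diameter (E i)) * indicator (I p) i) \<le> ennreal (diameter (E i))"
        unfolding sum_distrib_left[symmetric] using mult_left_mono by fastforce
    qed auto
    finally show ?thesis .
  qed
  have "ennreal (real (card P) * (R/8)) \<le> hausdorff1_pre (R/8) A"
    unfolding hausdorff1_pre_def using main by (intro INF_greatest) auto
  also have "\<dots> \<le> hausdorff1 A"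
    unfolding hausdorff1_def using \<open>0 < R\<close> by (intro SUP_upper) auto
  finally show ?thesis .
qed

text \<open>This is the coarea inequality that bounds the area of \<open>{|v - t| \<le> cR/2}\<close> by \<open>R\<close> times the
  length of the level curve: around each point of a maximal \<open>R\<close>-separated subset of the curve there is
  a disjoint piece of length at least \<open>R/4\<close>, so that set has at most \<open>8K/R\<close> points.\<close>

lemma tube_measure_le:
  fixes v :: "real^2 \<Rightarrow> real"
  assumes deriv: "\<And>y. y \<in> \<Omega> \<Longrightarrow> (v has_derivative (\<lambda>h. Dv y \<bullet> h)) (at y)"
    and c: "0 < c" "\<And>y. y \<in> \<Omega> \<Longrightarrow> c \<le> norm (Dv y)"
    and osc: "\<And>x y. x \<in> \<Omega> \<Longrightarrow> y \<in> \<Omega> \<Longrightarrow> dist x y \<le> r \<Longrightarrow> norm (Dv x - Dv y) \<le> c/4"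
    and inside: "\<And>x. x \<in> S \<Longrightarrow> cball x r \<subseteq> \<Omega>"
    and R: "0 < R" "2 * R \<le> r"
    and t: "\<And>x. x \<in> S \<Longrightarrow> \<bar>v x - t\<bar> \<le> c / 2 * R"
    and K: "hausdorff1 {x \<in> \<Omega>. v x = t} \<le> ennreal K" "0 \<le> K"
    and S: "S \<in> sets lebesgue"
  shows "measure lebesgue S \<le> 128 * K * R"
proof -
  define e where "e p = Dv p /\<^sub>R norm (Dv p)" for p
  have Dv0: "norm (Dv p) > 0" if "p \<in> \<Omega>" for p using c that by force
  have norm_e: "norm (e p) = 1" if "p \<in> \<Omega>" for p
    using Dv0[OF that] by (simp add: e_def)
  have Dve: "c / 2 \<le> Dv y \<bullet> e p" if "p \<in> \<Omega>" "y \<in> \<Omega>" "dist y p \<le> r" for y p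
  proof -
    have "Dv y \<bullet> e p = Dv p \<bullet> e p + (Dv y - Dv p) \<bullet> e p"
      by (simp add: inner_diff_left)
    moreover have "Dv p \<bullet> e p = norm (Dv p)"
      using Dv0[OF that(1)] by (simp add: e_def power2_norm_eq_inner[symmetric] power2_eq_square)
    moreover have "\<bar>(Dv y - Dv p) \<bullet> e p\<bar> \<le> c / 4"
      using Cauchy_Schwarz_ineq2[of "Dv y - Dv p" "e p"] norm_e[OF that(1)] osc[OF that(2,1,3)] by simp
    ultimately show ?thesis using c(2)[OF that(1)] \<open>0 < c\<close> by linarith
  qed
  \<comment> \<open>The points of the level curve that lie near \<open>S\<close>. They stay at
    distance more than \<open>R/4\<close> from the complement of \<Omega>, since R + R/4 < 2R \<le>
    r.\<close>
  define Y where "Y = {y \<in> \<Omega>. v y = t \<and> (\<exists>x\<in>S. dist x y \<le> R)}"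
  have Y_inside: "cball y (R/4) \<subseteq> \<Omega>" if "y \<in> Y" for y
  proof -
    from that obtain x where x: "x \<in> S" "dist x y \<le> R" by (auto simp: Y_def)
    have "cball y (R/4) \<subseteq> cball x r"
    proof
      fix z assume "z \<in> cball y (R/4)"
      then show "z \<in> cball x r" using x R dist_triangle[of x z y] by simp
    qed
    then show ?thesis using inside[OF x(1)] by blast
  qed
  have card_le: "real (card P) * (R/8) \<le> K"
    if P: "finite P" "P \<subseteq> Y" and sep: "\<And>p q. p \<in> P \<Longrightarrow> q \<in> P \<Longrightarrow> p \<noteq> q \<Longrightarrow> R \<le> dist p q" for P
  proof -
    have "ennreal (real (card P) * (R/8)) \<le> hausdorff1 {x \<in> \<Omega>. v x = t}"
    proof (rule hausdorff1_ge_separated[where e = "\<lambda>p. perp (e p)"])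
      fix p s assume p: "p \<in> P" and s: "\<bar>s\<bar> \<le> R/8"
      have pY: "p \<in> Y" "p \<in> \<Omega>" "v p = t" using p P by (auto simp: Y_def)
      \<comment> \<open>A tangential step of length at most \<open>R/8\<close> changes
        \<open>v\<close> only through the oscillation of the gradient, by at most (R/8)(c/4) =
        (c/2)(R/16). A normal correction of length at most \<open>R/16\<close> therefore returns to
        the level set; it does not alter the tangential coordinate \<open>s\<close> and stays in the
        ball of radius \<open>R/4\<close>.\<close>
      define q where "q = p + s *\<^sub>R perp (e p)"
      have qp: "dist p q \<le> R/8" using s norm_e[OF pY(2)] by (simp add: q_def dist_norm)
      have sub: "cball p (R/4) \<subseteq> \<Omega>" using Y_inside pY by blast
      obtain \<xi> where \<xi>: "\<xi> \<in> cball p (R/4)" "v q - v p = Dv \<xi> \<bullet> (q - p)"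
        using mvt_inner[of "cball p (R/4)" v Dv p q] deriv sub qp R by (auto simp: subset_iff)
      have "Dv \<xi> \<bullet> (q - p) = s * ((Dv \<xi> - Dv p) \<bullet> perp (e p))"
      proof -
        have "Dv p \<bullet> perp (e p) = 0" by (simp add: e_def perp_scaleR)
        then show ?thesis by (simp add: q_def inner_diff_left)
      qed
      also have "\<bar>\<dots>\<bar> \<le> (R/8) * (c/4)"
      proof -
        have "\<xi> \<in> \<Omega>" "dist \<xi> p \<le> r" using \<xi>(1) sub R by (auto simp: dist_commute)
        then have "\<bar>(Dv \<xi> - Dv p) \<bullet> perp (e p)\<bar> \<le> c/4"
          using Cauchy_Schwarz_ineq2[of "Dv \<xi> - Dv p" "perp (e p)"] norm_e[OF pY(2)]
            osc[of \<xi> p] pY(2) by simp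
        then show ?thesis using s unfolding abs_mult by (intro mult_mono) auto
      qed
      finally have vq: "\<bar>t - v q\<bar> \<le> c / 2 * (R/16)" 
        unfolding \<xi>(2)[symmetric] pY(3) abs_minus_commute[of t] by (simp add: mult.commute)
      have near: "q + s' *\<^sub>R e p \<in> cball p (R/4)" if "\<bar>s'\<bar> \<le> R/16" for s'
        using dist_triangle[of p "q + s' *\<^sub>R e p" q] that qp norm_e[OF pY(2)]
        by (simp add: dist_norm)
      obtain s' where s': "\<bar>s'\<bar> \<le> R/16" "v (q + s' *\<^sub>R e p) = t"
      proof -
        have "\<exists>s'. \<bar>s'\<bar> \<le> R/16 \<and> v (q + s' *\<^sub>R e p) = t"
        proof (rule level_value_on_segment[where c="c/2"])
          fix s' assume "\<bar>s'\<bar> \<le> R/16"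
          from near[OF this] sub R
          have "q + s' *\<^sub>R e p \<in> \<Omega>" "dist (q + s' *\<^sub>R e p) p \<le> r" by (auto simp: dist_commute)
          then show "(v has_derivative (\<bullet>) (Dv (q + s' *\<^sub>R e p))) (at (q + s' *\<^sub>R e p))"
            "c / 2 \<le> Dv (q + s' *\<^sub>R e p) \<bullet> e p"
            using deriv Dve pY by auto
        qed (use R vq in auto)
        then show ?thesis using that by blast
      qed
      have "e p \<bullet> perp (e p) = 0" "perp (e p) \<bullet> perp (e p) = 1"
        using norm_e[OF pY(2)] norm_perp[of "e p"] unfolding norm_eq_1[symmetric] by auto
      then have "(q + s' *\<^sub>R e p - p) \<bullet> perp (e p) = s"
        by (simp add: q_def inner_add_left)
      moreover have "q + s' *\<^sub>R e p \<in> {x \<in> \<Omega>. v x = t} \<inter> cball p (R/4)"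
        using near[OF s'(1)] sub s'(2) by auto
      ultimately show "\<exists>z\<in>{x \<in> \<Omega>. v x = t} \<inter> cball p (R/4). (z - p) \<bullet> perp (e p) = s" by blast
    next
      show "norm (perp (e p)) = 1" if "p \<in> P" for p
        using norm_e[of p] that P by (auto simp: Y_def)
    qed (use P sep R in auto)
    also note K(1)
    finally show ?thesis using K(2) by (subst (asm) ennreal_le_iff) auto
  qed
  define good where "good P \<longleftrightarrow> finite P \<and> P \<subseteq> Y \<and> (\<forall>p\<in>P. \<forall>q\<in>P. p \<noteq> q \<longrightarrow> R \<le> dist p q)" for P
  have "\<exists>P. good P \<and> (\<forall>Q. good Q \<longrightarrow> card Q \<le> card P)"
  proof (rule ex_has_greatest_nat[where b = "nat \<lfloor>K * 8 / R\<rfloor> + 1" and f = card])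
    show "good {}" by (auto simp: good_def)
    show "\<forall>P. good P \<longrightarrow> card P < nat \<lfloor>K * 8 / R\<rfloor> + 1"
    proof (intro allI impI)
      fix P assume "good P"
      then have "real (card P) * (R/8) \<le> K" by (intro card_le) (auto simp: good_def)
      then have "real (card P) \<le> K * 8 / R" using R by (simp add: field_simps)
      then show "card P < nat \<lfloor>K * 8 / R\<rfloor> + 1" by linarith
    qed
  qed
  then obtain P where P: "good P" and max: "\<And>Q. good Q \<Longrightarrow> card Q \<le> card P" by blast
  have PK: "real (card P) * (R/8) \<le> K" using P by (intro card_le) (auto simp: good_def)
  \<comment> \<open>From \<open>x\<close> a normal step of length at most \<open>R\<close> reaches
    the level set, and by maximality of \<open>P\<close> the point reached is within
    \<open>R\<close> of some point of \<open>P\<close>.\<close>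
  have cover: "S \<subseteq> (\<Union>p\<in>P. cball p (2 * R))"
  proof
    fix x assume x: "x \<in> S"
    have xO: "x \<in> \<Omega>" using inside[OF x] R by auto
    have near: "x + s *\<^sub>R e x \<in> cball x R" if "\<bar>s\<bar> \<le> R" for s
      using that norm_e[OF xO] by (simp add: dist_norm)
    have "\<exists>s. \<bar>s\<bar> \<le> R \<and> v (x + s *\<^sub>R e x) = t"
    proof (rule level_value_on_segment[where c="c/2"])
      fix s assume "\<bar>s\<bar> \<le> R"
      from near[OF this] inside[OF x] R
      have "x + s *\<^sub>R e x \<in> \<Omega>" "dist (x + s *\<^sub>R e x) x \<le> r" by (auto simp: dist_commute)
      then show "(v has_derivative (\<bullet>) (Dv (x + s *\<^sub>R e x))) (at (x + s *\<^sub>R e x))"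
        "c / 2 \<le> Dv (x + s *\<^sub>R e x) \<bullet> e x"
        using deriv Dve xO by auto
    qed (use R t[OF x] in \<open>auto simp: abs_minus_commute\<close>)
    then obtain s where s: "\<bar>s\<bar> \<le> R" "v (x + s *\<^sub>R e x) = t" by blast
    define y where "y = x + s *\<^sub>R e x"
    have y: "dist x y \<le> R" using near[OF s(1)] by (simp add: y_def)
    then have "y \<in> \<Omega>" using inside[OF x] R by auto
    then have yY: "y \<in> Y" using s y x by (auto simp: Y_def y_def)
    have "\<exists>p\<in>P. dist p y < R"
    proof (rule ccontr)
      assume neg: "\<not> ?thesis"
      then have "y \<notin> P" using R by force
      moreover have "good (insert y P)"
        using P yY neg by (auto simp: good_def dist_commute not_less)
      ultimately show False using max[of "insert y P"] P by (auto simp: good_def)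
    qed
    then obtain p where "p \<in> P" "dist p y < R" by blast
    then show "x \<in> (\<Union>p\<in>P. cball p (2 * R))"
      using y dist_triangle[of p x y] by (intro UN_I[of p]) (auto simp: dist_commute)
  qed
  have fin: "finite P" using P by (simp add: good_def)
  have "measure lebesgue S \<le> measure lebesgue (\<Union>p\<in>P. cball p (2 * R))"
    using cover S fin by (intro measure_mono_fmeasurable fmeasurable.finite_UN) auto
  also have "\<dots> \<le> (\<Sum>p\<in>P. measure lebesgue (cball p (2 * R)))"
    using fin by (intro measure_UNION_le) auto
  \<comment> \<open>A disc of radius \<open>2 * R\<close> has area at most 16 R^2, and there are at
    most 8K/R discs; hence the factor 128.\<close>
  also have "\<dots> \<le> (\<Sum>p\<in>P. 16 * R\<^sup>2)"
  proof (intro sum_mono)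
    fix p :: "real^2"
    have "measure lebesgue (cball p (2 * R)) = pi * (2 * R)\<^sup>2"
      using content_cball[of "2 * R" p] R by (simp add: unit_ball_vol_2)
    also have "\<dots> \<le> 4 * (2 * R)\<^sup>2" using pi_less_4 by (intro mult_right_mono) auto
    finally show "measure lebesgue (cball p (2 * R)) \<le> 16 * R\<^sup>2" by (simp add: power_mult_distrib)
  qed
  also have "\<dots> = (real (card P) * (R/8)) * (128 * R)" by (simp add: power2_eq_square)
  also have "\<dots> \<le> K * (128 * R)" using PK R by (intro mult_right_mono) auto
  finally show ?thesis by simp
qed

section \<open>A grid of square cells\<close>

text \<open>Integer coordinates of the half-open square of side \<delta> that contains
  \<open>x\<close>. Half-open squares partition the plane exactly, so a sum of indicators over
  distinct keys has at most one nonzero term at each point.\<close>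

definition cell_key :: "real \<Rightarrow> real^2 \<Rightarrow> int \<times> int" where
  "cell_key \<delta> x = (\<lfloor>x $ 1 / \<delta>\<rfloor>, \<lfloor>x $ 2 / \<delta>\<rfloor>)"

definition cell :: "real \<Rightarrow> int \<times> int \<Rightarrow> (real^2) set" where
  "cell \<delta> k = {x. cell_key \<delta> x = k}"

lemma cell_eq:
  assumes "0 < \<delta>"
  shows "cell \<delta> (i, j) = {x. \<delta> * i \<le> x $ 1 \<and> x $ 1 < \<delta> * i + \<delta> \<and> \<delta> * j \<le> x $ 2 \<and> x $ 2 < \<delta> * j + \<delta>}"
  using assms by (auto simp: cell_def cell_key_def floor_eq_iff field_simps)

lemma cell_fmeasurable:
  assumes "0 < \<delta>"
  shows "cell \<delta> k \<in> fmeasurable lebesgue"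
proof (cases k)
  case (Pair i j)
  have "{x::real^2. \<delta> * i \<le> x $ 1 \<and> x $ 1 < \<delta> * i + \<delta> \<and> \<delta> * j \<le> x $ 2 \<and> x $ 2 < \<delta> * j + \<delta>} \<in> sets lborel"
    by measurable
  then have s: "cell \<delta> k \<in> sets lebesgue"
    using cell_eq[OF assms, of i j] Pair by simp
  have "cell \<delta> k \<subseteq> cbox (vector [\<delta> * i, \<delta> * j]) (vector [\<delta> * i + \<delta>, \<delta> * j + \<delta>])"
    using cell_eq[OF assms, of i j] Pair by (auto simp: mem_box_cart forall_2)
  then have "bounded (cell \<delta> k)" using bounded_subset bounded_cbox by blast
  then show ?thesis using s by (intro bounded_set_imp_lmeasurable)
qed

lemma cell_measure_ge:
  assumes "0 < \<delta>"
  shows "\<delta>\<^sup>2 \<le> measure lebesgue (cell \<delta> k)"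
proof (cases k)
  case (Pair i j)
  let ?a = "vector [\<delta> * i, \<delta> * j] :: real^2" and ?b = "vector [\<delta> * i + \<delta>, \<delta> * j + \<delta>] :: real^2"
  have "box ?a ?b \<subseteq> cell \<delta> k"
    unfolding Pair cell_eq[OF assms] by (auto simp: mem_box_cart forall_2)
  then have "measure lebesgue (box ?a ?b) \<le> measure lebesgue (cell \<delta> k)"
    using cell_fmeasurable[OF assms] by (intro measure_mono_fmeasurable) (simp_all add: borel_open open_box)
  moreover have "measure lebesgue (box ?a ?b) = \<delta>\<^sup>2"
  proof -
    have "measure lebesgue (box ?a ?b) = measure lborel (cbox ?a ?b)"
      by (simp only: measure_completion sets_lborel borel_open open_box measure_lborel_box_eq measure_lborel_cbox_eq)
    also have "\<dots> = \<delta>\<^sup>2"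
    proof -
      have "cbox ?a ?b \<noteq> {}"
        unfolding interval_ne_empty_cart using assms by (simp add: forall_2)
      then show ?thesis
        unfolding content_cbox_if_cart by (simp add: UNIV_2 power2_eq_square)
    qed
    finally show ?thesis .
  qed
  ultimately show ?thesis by simp
qed

lemma cell_dist_le:
  assumes "0 < \<delta>" "x \<in> cell \<delta> k" "y \<in> cell \<delta> k"
  shows "dist x y \<le> 2 * \<delta>"
proof (cases k)
  case (Pair i j)
  have "dist x y \<le> (\<Sum>i\<in>UNIV. \<bar>(x - y) $ i\<bar>)"
    unfolding dist_norm by (rule norm_le_l1_cart)
  also have "\<dots> \<le> 2 * \<delta>"
    using assms(2,3) cell_eq[OF assms(1), of i j] Pair by (auto simp: sum_2)
  finally show ?thesis .
qed

lemma convex_cell: "0 < \<delta> \<Longrightarrow> convex (cell \<delta> k)"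
proof (cases k)
  case (Pair i j)
  assume "0 < \<delta>"
  have eq: "cell \<delta> k = ({x. axis 1 1 \<bullet> x \<ge> \<delta> * i} \<inter> {x. axis 1 1 \<bullet> x < \<delta> * i + \<delta>})
    \<inter> ({x. axis 2 1 \<bullet> x \<ge> \<delta> * j} \<inter> {x. axis 2 1 \<bullet> x < \<delta> * j + \<delta>})"
    using cell_eq[OF \<open>0 < \<delta>\<close>, of i j] Pair by (auto simp: inner_axis inner_commute)
  show ?thesis unfolding eq
    by (intro convex_Int convex_halfspace_ge convex_halfspace_lt)
qed

lemma cell_disjoint: "x \<in> cell \<delta> k \<longleftrightarrow> k = cell_key \<delta> x"
  by (auto simp: cell_def)

lemma finite_cell_keys:
  assumes "bounded S" "0 < \<delta>"
  shows "finite (cell_key \<delta> ` S)"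
proof -
  from assms(1) obtain B where B: "\<And>x. x \<in> S \<Longrightarrow> norm x \<le> B" by (auto simp: bounded_iff)
  have "cell_key \<delta> ` S \<subseteq> {\<lfloor>-B/\<delta>\<rfloor>..\<lfloor>B/\<delta>\<rfloor>} \<times> {\<lfloor>-B/\<delta>\<rfloor>..\<lfloor>B/\<delta>\<rfloor>}"
  proof
    fix k assume "k \<in> cell_key \<delta> ` S"
    then obtain x where x: "x \<in> S" "k = cell_key \<delta> x" by blast
    have "-B / \<delta> \<le> x $ i / \<delta> \<and> x $ i / \<delta> \<le> B / \<delta>" for i
      using component_le_norm_cart[of x i] B[OF x(1)] assms(2)
      by (intro conjI divide_right_mono) linarith+
    then show "k \<in> {\<lfloor>-B/\<delta>\<rfloor>..\<lfloor>B/\<delta>\<rfloor>} \<times> {\<lfloor>-B/\<delta>\<rfloor>..\<lfloor>B/\<delta>\<rfloor>}"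
      unfolding x(2) cell_key_def mem_Times_iff fst_conv snd_conv atLeastAtMost_iff
      by (intro conjI floor_mono) blast+
  qed
  then show ?thesis by (rule finite_subset) auto
qed

text \<open>Stands in for a limit: it removes an error proportional to an arbitrary \<open>e\<close>
  once an estimate holds for every positive \<open>e\<close> with the same \<open>B\<close>.\<close>

lemma nonpos_if_le_all_multiples:
  fixes X B :: real
  assumes "\<And>e. 0 < e \<Longrightarrow> X \<le> e * B"
  shows "X \<le> 0"
proof (rule ccontr)
  assume "\<not> X \<le> 0"
  define B' where "B' = \<bar>B\<bar> + 1"
  have B': "0 < B'" "B \<le> B'" by (auto simp: B'_def)
  have "X \<le> X / (2 * B') * B" using \<open>\<not> X \<le> 0\<close> B' by (intro assms divide_pos_pos) auto
  also have "\<dots> \<le> X / (2 * B') * B'" using \<open>\<not> X \<le> 0\<close> B' by (intro mult_left_mono) auto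
  also have "\<dots> = X / 2" using B' by simp
  finally show False using \<open>\<not> X \<le> 0\<close> by simp
qed

section \<open>From the tangential derivative of \<open>w\<close> to its L1 norm\<close>

text \<open>The form in which well-structuredness enters the estimate: the curve is used through the
  intermediate value theorem, and length is measured on the level set by
  \<open>hausdorff1\<close>.\<close>

definition level_reaches_frontier :: "(real^2) set \<Rightarrow> (real^2 \<Rightarrow> real) \<Rightarrow> real^2 \<Rightarrow> bool" where
  "level_reaches_frontier \<Omega> v x \<longleftrightarrow>
    (\<exists>(s\<^sub>0::real) \<gamma>. 0 \<le> s\<^sub>0 \<and> continuous_on {0..s\<^sub>0} \<gamma> \<and> \<gamma> 0 \<in> frontier \<Omega> \<and>
       \<gamma> s\<^sub>0 = x \<and> \<gamma> ` {0<..s\<^sub>0} \<subseteq> \<Omega> \<and> (\<forall>s\<in>{0..s\<^sub>0}. v (\<gamma> s) = v x))"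

text \<open>Discrete substitute for integrating \<open>\<bar>\<nabla>w \<bullet> \<tau>\<bar>\<close> along the level curve from the boundary to \<open>x\<close>: by
  the intermediate value theorem the values of \<open>\<bar>w\<bar>\<close> on the part of the curve in a fine grid fill the
  interval \<open>[e, \<bar>w x\<bar>]\<close>, and on a grid cell the oscillation of \<open>w\<close> along a level set is at most the
  side length times \<open>\<bar>\<nabla>w \<bullet> \<tau>\<bar>\<close>.\<close>

lemma level_L1_estimate:
  fixes v w :: "real^2 \<Rightarrow> real"
  assumes "open \<Omega>" "bounded \<Omega>"
    and dv: "\<And>x. x \<in> \<Omega> \<Longrightarrow> (v has_derivative (\<lambda>h. Dv x \<bullet> h)) (at x)"
    and dw: "\<And>x. x \<in> \<Omega> \<Longrightarrow> (w has_derivative (\<lambda>h. Dw x \<bullet> h)) (at x)"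
    and ucv: "uniformly_continuous_on \<Omega> Dv" and ucw: "uniformly_continuous_on \<Omega> Dw"
    and c: "0 < c" "\<And>x. x \<in> \<Omega> \<Longrightarrow> c \<le> norm (Dv x)"
    and V: "\<And>x. x \<in> \<Omega> \<Longrightarrow> norm (Dv x) \<le> V"
    and Lw: "\<And>x. x \<in> \<Omega> \<Longrightarrow> norm (Dw x) \<le> Lw"
    and w: "continuous_on (closure \<Omega>) w" "\<And>x. x \<in> frontier \<Omega> \<Longrightarrow> w x = 0"
    and K: "0 \<le> K" "\<And>t. hausdorff1 {x \<in> \<Omega>. v x = t} \<le> ennreal K"
    and path: "AE x in lebesgue_on \<Omega>. level_reaches_frontier \<Omega> v x"
  shows "(LINT x|lebesgue_on \<Omega>. \<bar>w x\<bar>)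
    \<le> 2048 * K * V / c\<^sup>2 * (LINT x|lebesgue_on \<Omega>. \<bar>Dw x \<bullet> perp (Dv x)\<bar>)"
proof (cases "\<Omega> = {}")
  case True
  then show ?thesis by simp
next
  case False
  then obtain x0 where "x0 \<in> \<Omega>" by blast
  have V0: "c \<le> V" "0 < V" using c V[OF \<open>x0 \<in> \<Omega>\<close>] c(2)[OF \<open>x0 \<in> \<Omega>\<close>] by linarith+
  have Lw_nonneg: "0 \<le> Lw" using Lw[OF \<open>x0 \<in> \<Omega>\<close>] norm_ge_zero order_trans by blast
  define N where "N = lebesgue_on \<Omega>"
  have O_lm: "\<Omega> \<in> lmeasurable" using \<open>open \<Omega>\<close> \<open>bounded \<Omega>\<close> by (intro bounded_set_imp_lmeasurable) auto
  interpret N: finite_measure N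
    unfolding N_def using O_lm by (simp add: finite_measure_lebesgue_on)
  have spN: "space N = \<Omega>" by (simp add: N_def)
  have measN: "continuous_on \<Omega> h \<Longrightarrow> h \<in> borel_measurable N" for h :: "real^2 \<Rightarrow> real"
    unfolding N_def using O_lm by (intro continuous_imp_measurable_on_sets_lebesgue) auto
  have mN: "measure N S = measure lebesgue S" if "S \<subseteq> \<Omega>" for S
    unfolding N_def using that O_lm by (intro measure_restrict_space) auto
  have indN: "integrable N (\<lambda>x. a * indicator T x)" "(LINT x|N. a * indicator T x) = a * measure N T"
    if "T \<in> sets N" for a :: real and T
  proof -
    have "emeasure N T < \<infinity>" by (metis N.emeasure_finite infinity_ennreal_def top.not_eq_extremum)
    then show "integrable N (\<lambda>x. a * indicator T x)"
      using that by (intro integrable_mult_right integrable_real_indicator)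
    show "(LINT x|N. a * indicator T x) = a * measure N T"
      using that sets.sets_into_space[OF that] by (simp add: Int_absorb2)
  qed
  have sumN: "integrable N (\<lambda>x. \<Sum>k\<in>J. a k * indicator (T k) x)"
      "(LINT x|N. (\<Sum>k\<in>J. a k * indicator (T k) x)) = (\<Sum>k\<in>J. a k * measure N (T k))"
    if "\<And>k. k \<in> J \<Longrightarrow> T k \<in> sets N" for a :: "int \<times> int \<Rightarrow> real" and T J
  proof -
    show "integrable N (\<lambda>x. \<Sum>k\<in>J. a k * indicator (T k) x)"
      by (rule Bochner_Integration.integrable_sum, rule indN(1), rule that)
    have "(LINT x|N. (\<Sum>k\<in>J. a k * indicator (T k) x)) = (\<Sum>k\<in>J. LINT x|N. a k * indicator (T k) x)"
      by (rule Bochner_Integration.integral_sum, rule indN(1), rule that)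
    also have "\<dots> = (\<Sum>k\<in>J. a k * measure N (T k))"
      by (rule sum.cong[OF refl], rule indN(2), rule that)
    finally show "(LINT x|N. (\<Sum>k\<in>J. a k * indicator (T k) x)) = (\<Sum>k\<in>J. a k * measure N (T k))" .
  qed
  define A where "A = measure lebesgue \<Omega>"
  define g where "g x = \<bar>Dw x \<bullet> perp (Dv x)\<bar>" for x
  have cont_g: "continuous_on \<Omega> g"
    unfolding g_def using ucv ucw by (intro continuous_intros uniformly_continuous_imp_continuous)
  have g_le: "g x \<le> Lw * V" if "x \<in> \<Omega>" for x
  proof -
    have "g x \<le> norm (Dw x) * norm (perp (Dv x))" unfolding g_def by (rule Cauchy_Schwarz_ineq2)
    also have "\<dots> \<le> Lw * V" using Lw[OF that] V[OF that] Lw_nonneg by (simp add: mult_mono)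
    finally show ?thesis .
  qed
  have int_g: "integrable N g"
    using g_le measN[OF cont_g] by (intro N.integrable_const_bound[where B="Lw * V"] AE_I2) (auto simp: spN g_def)
  have clw: "compact (closure \<Omega>)" using \<open>bounded \<Omega>\<close> by (simp add: compact_closure)
  have contw: "continuous_on \<Omega> w" using w(1) closure_subset continuous_on_subset by blast
  have int_w: "integrable N (\<lambda>x. \<bar>w x\<bar>)"
  proof -
    have "bounded (w ` closure \<Omega>)" using clw w(1) by (intro compact_imp_bounded compact_continuous_image)
    then obtain B where "\<And>x. x \<in> closure \<Omega> \<Longrightarrow> \<bar>w x\<bar> \<le> B" by (auto simp: bounded_iff)
    then show ?thesis using closure_subset[of \<Omega>] measN[OF contw]
      by (intro N.integrable_const_bound[where B=B] AE_I2) (auto simp: spN)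
  qed
  \<comment> \<open>The factor 2048 is 2 * 2 * 128 * 4. An interval has twice its radius
    \<open>D k\<close> as length, the diameter bound of a cell is \<open>2 * \<delta>\<close>, the
    area of a tube is at most \<open>128 * K * R\<close>, and \<open>R\<close> equals
    \<open>4 * V * \<delta> / c\<close>.\<close>
  define C where "C = 2048 * K * V / c\<^sup>2"
  have C0: "0 \<le> C" using K(1) V0 by (simp add: C_def)
  have main: "(LINT x|N. \<bar>w x\<bar>) \<le> e * A + C * ((LINT x|N. g x) + 2 * e * A)" if "0 < e" for e
  proof -
    \<comment> \<open>As \<open>w\<close> vanishes on the frontier, this set is compact in \<Omega>
      and keeps a positive distance from the frontier, which gives room for the balls required by
      \<open>tube_measure_le\<close>. Off this set \<open>\<bar>w\<bar>\<close> is below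
      \<open>e\<close>, at a total cost of at most \<open>e * A\<close>.\<close>
    define W where "W = {x \<in> closure \<Omega>. e \<le> \<bar>w x\<bar>}"
    have W_sub: "W \<subseteq> \<Omega>"
    proof
      fix x assume "x \<in> W"
      then have "x \<in> closure \<Omega>" "w x \<noteq> 0" using \<open>0 < e\<close> by (auto simp: W_def)
      then show "x \<in> \<Omega>" using w(2)[of x] interior_open[OF \<open>open \<Omega>\<close>] by (auto simp: frontier_def)
    qed
    have W_eq: "W = closure \<Omega> \<inter> (\<lambda>x. \<bar>w x\<bar>) -` {e..}" by (auto simp: W_def)
    have clW: "closed W"
      unfolding W_eq using w(1) by (intro continuous_closed_preimage continuous_intros) auto
    then have "compact W" using clw compact_Int_closed[OF clw clW] by (simp add: W_def Int_def conj_ac)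
    obtain \<rho> where \<rho>: "0 < \<rho>" "(\<Union>x\<in>W. cball x \<rho>) \<subseteq> \<Omega>"
      using compact_subset_open_imp_cball_epsilon_subset[OF \<open>compact W\<close> \<open>open \<Omega>\<close> W_sub] by blast
    \<comment> \<open>The bound \<open>c/4\<close> is the oscillation allowed in
      \<open>tube_measure_le\<close>; the other one keeps the oscillation of the product of
      gradients below \<open>e\<close>.\<close>
    define e1 where "e1 = min (c/4) (e / (V + Lw))"
    have e1: "0 < e1" "e1 \<le> c/4" "e1 * (V + Lw) \<le> e"
      using V0 Lw_nonneg c \<open>0 < e\<close> by (auto simp: e1_def min_def divide_simps)
    obtain r1 where r1: "0 < r1" "\<And>x y. x \<in> \<Omega> \<Longrightarrow> y \<in> \<Omega> \<Longrightarrow> dist y x < r1 \<Longrightarrow> dist (Dv y) (Dv x) < e1"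
      using ucv \<open>0 < e1\<close> unfolding uniformly_continuous_on_def by metis
    obtain r2 where r2: "0 < r2" "\<And>x y. x \<in> \<Omega> \<Longrightarrow> y \<in> \<Omega> \<Longrightarrow> dist y x < r2 \<Longrightarrow> dist (Dw y) (Dw x) < e1"
      using ucw \<open>0 < e1\<close> unfolding uniformly_continuous_on_def by metis
    define r where "r = min \<rho> (min (r1/2) (r2/2))"
    have r: "0 < r" "r \<le> \<rho>" using \<rho> r1 r2 by (auto simp: r_def)
    have oscv: "norm (Dv x - Dv y) \<le> e1" and oscw: "norm (Dw x - Dw y) \<le> e1"
      if "x \<in> \<Omega>" "y \<in> \<Omega>" "dist x y \<le> r" for x y
    proof -
      have "dist x y < r1" "dist x y < r2" using that(3) r1(1) r2(1) by (auto simp: r_def)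
      then show "norm (Dv x - Dv y) \<le> e1" "norm (Dw x - Dw y) \<le> e1"
        using r1(2)[OF that(2,1)] r2(2)[OF that(2,1)] by (auto simp: dist_norm)
    qed
    \<comment> \<open>Two separate points \<xi> and \<zeta> are allowed because the mean value
      theorem yields different intermediate points for \<open>w\<close> and for
      \<open>v\<close>.\<close>
    have cross_osc: "\<bar>Dw \<xi> \<bullet> perp (Dv \<zeta>) - Dw z \<bullet> perp (Dv z)\<bar> \<le> e"
      if O: "\<xi> \<in> \<Omega>" "\<zeta> \<in> \<Omega>" "z \<in> \<Omega>" and r: "dist \<xi> z \<le> r" "dist \<zeta> z \<le> r" for \<xi> \<zeta> z
    proof -
      have "Dw \<xi> \<bullet> perp (Dv \<zeta>) - Dw z \<bullet> perp (Dv z)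
          = (Dw \<xi> - Dw z) \<bullet> perp (Dv \<zeta>) + Dw z \<bullet> perp (Dv \<zeta> - Dv z)"
        by (simp add: perp_diff inner_diff_left inner_diff_right)
      moreover have "\<bar>(Dw \<xi> - Dw z) \<bullet> perp (Dv \<zeta>)\<bar> \<le> e1 * V"
        using order_trans[OF Cauchy_Schwarz_ineq2 mult_mono, of "Dw \<xi> - Dw z" e1 "perp (Dv \<zeta>)" V]
          oscw[OF O(1,3) r(1)] V[OF O(2)] e1 by simp
      moreover have "\<bar>Dw z \<bullet> perp (Dv \<zeta> - Dv z)\<bar> \<le> Lw * e1"
        using order_trans[OF Cauchy_Schwarz_ineq2 mult_mono, of "Dw z" Lw "perp (Dv \<zeta> - Dv z)" e1]
          oscv[OF O(2,3) r(2)] Lw[OF O(3)] Lw_nonneg by simp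
      ultimately have "\<bar>Dw \<xi> \<bullet> perp (Dv \<zeta>) - Dw z \<bullet> perp (Dv z)\<bar> \<le> e1 * (V + Lw)"
        unfolding distrib_left by (simp add: mult.commute[of Lw])
      then show ?thesis using e1 by simp
    qed
    define R where "R = r/2"
    \<comment> \<open>Chosen so that \<open>v\<close> varies on a cell by at most
      \<open>V * (2 * \<delta>) = c / 2 * R\<close>, exactly the half-height of a tube of parameter
      \<open>R\<close>.\<close>
    define \<delta> where "\<delta> = R * c / (4 * V)"
    have R0: "0 < R" "0 < \<delta>" using r c V0 by (auto simp: R_def \<delta>_def)
    have R\<delta>: "R = 4 * V * \<delta> / c" using c V0 by (simp add: \<delta>_def)
    have "c * R \<le> V * R" using V0 R0 by (intro mult_right_mono) auto
    then have "\<delta> \<le> R / 4" using V0 by (simp add: \<delta>_def field_simps)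
    then have \<delta>r: "2 * \<delta> \<le> r" using r by (simp add: R_def)
    define I where "I = cell_key \<delta> ` W"
    have finI: "finite I"
      unfolding I_def using \<open>compact W\<close> R0 by (intro finite_cell_keys compact_imp_bounded)
    define z where "z k = (SOME x. x \<in> W \<and> cell_key \<delta> x = k)" for k
    have z: "z k \<in> W" "z k \<in> cell \<delta> k" if "k \<in> I" for k
    proof -
      have "\<exists>x. x \<in> W \<and> cell_key \<delta> x = k" using that by (auto simp: I_def)
      from someI_ex[OF this] show "z k \<in> W" "z k \<in> cell \<delta> k" by (auto simp: z_def cell_def)
    qed
    have zO: "z k \<in> \<Omega>" if "k \<in> I" for k using z[OF that] W_sub by blast
    have cell_r: "dist x y \<le> r" if "x \<in> cell \<delta> k" "y \<in> cell \<delta> k" for x y k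
      using cell_dist_le[OF R0(2) that] \<delta>r by simp
    have cell_sub: "cell \<delta> k \<subseteq> \<Omega>" if "k \<in> I" for k
    proof
      fix x assume "x \<in> cell \<delta> k"
      then have "x \<in> cball (z k) \<rho>" using cell_r[OF z(2)[OF that]] r by force
      then show "x \<in> \<Omega>" using \<rho> z(1)[OF that] by blast
    qed
    \<comment> \<open>Bound for the variation of \<open>w\<close> between two points of cell
      \<open>k\<close> on the same level set of \<open>v\<close>: tangential derivative over
      \<open>c\<close>, times the diameter bound of the cell.\<close>
    define D where "D k = (g (z k) + e) / c * (2 * \<delta>)" for k
    have D0: "0 \<le> D k" for k using c R0 \<open>0 < e\<close> by (simp add: D_def g_def)
    have w_osc: "\<bar>w q - w p\<bar> \<le> D k"
      if k: "k \<in> I" and pq: "p \<in> cell \<delta> k" "q \<in> cell \<delta> k" "v p = v q" for k p q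
    proof -
      note sub = cell_sub[OF k]
      obtain \<xi> where \<xi>: "\<xi> \<in> cell \<delta> k" "w q - w p = Dw \<xi> \<bullet> (q - p)"
        using mvt_inner[of "cell \<delta> k" w Dw p q] dw sub pq convex_cell[OF R0(2)] by blast
      obtain \<zeta> where \<zeta>: "\<zeta> \<in> cell \<delta> k" "v q - v p = Dv \<zeta> \<bullet> (q - p)"
        using mvt_inner[of "cell \<delta> k" v Dv p q] dv sub pq convex_cell[OF R0(2)] by blast
      have in_O: "\<xi> \<in> \<Omega>" "\<zeta> \<in> \<Omega>" using \<xi> \<zeta> sub by auto
      have 1: "\<bar>Dw \<xi> \<bullet> perp (Dv \<zeta>)\<bar> \<le> g (z k) + e"
        using cross_osc[OF in_O zO[OF k] cell_r[OF \<xi>(1) z(2)[OF k]] cell_r[OF \<zeta>(1) z(2)[OF k]]]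
        unfolding g_def by linarith
      have "\<bar>w q - w p\<bar> * c \<le> \<bar>Dw \<xi> \<bullet> (q - p)\<bar> * norm (Dv \<zeta>)"
        unfolding \<xi>(2) using c(2)[OF in_O(2)] by (intro mult_left_mono) auto
      also have "\<dots> = \<bar>Dw \<xi> \<bullet> perp (Dv \<zeta>)\<bar> * norm (q - p)"
        using \<zeta>(2) pq(3) by (intro inner_perp_orthogonal) auto
      also have "\<dots> \<le> (g (z k) + e) * (2 * \<delta>)"
        using 1 cell_dist_le[OF R0(2) pq(2,1)] \<open>0 < e\<close>
        by (intro mult_mono) (auto simp: dist_norm g_def)
      finally show ?thesis using c by (simp add: D_def field_simps)
    qed
    have v_osc: "\<bar>v x - v (z k)\<bar> \<le> c / 2 * R" if k: "k \<in> I" and x: "x \<in> cell \<delta> k" for k x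
    proof -
      obtain \<zeta> where \<zeta>: "\<zeta> \<in> cell \<delta> k" "v x - v (z k) = Dv \<zeta> \<bullet> (x - z k)"
        using mvt_inner[of "cell \<delta> k" v Dv "z k" x] dv cell_sub[OF k] x z[OF k] convex_cell[OF R0(2)] by blast
      have "\<bar>Dv \<zeta> \<bullet> (x - z k)\<bar> \<le> norm (Dv \<zeta>) * norm (x - z k)" by (rule Cauchy_Schwarz_ineq2)
      also have "\<dots> \<le> V * (2 * \<delta>)"
        using V[of \<zeta>] \<zeta> cell_sub[OF k] cell_dist_le[OF R0(2) x z(2)[OF k]] V0
        by (intro mult_mono) (auto simp: dist_norm)
      also have "\<dots> = c / 2 * R" using c by (simp add: R\<delta>)
      finally show ?thesis using \<zeta> by simp
    qed
    \<comment> \<open>If the level set of a point \<open>x\<close> of \<open>W\<close> meets cell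
      \<open>k\<close>, then \<open>x\<close> lies here by \<open>v_osc\<close>. Membership in this
      tube replaces the condition that the curve of \<open>x\<close> visits the cell, and the tube
      has small area.\<close>
    define S where "S k = {x \<in> W. \<bar>v x - v (z k)\<bar> \<le> c / 2 * R}" for k
    have closedS: "closed (S k)" for k
    proof -
      have "continuous_on W v"
        using dv W_sub by (intro continuous_at_imp_continuous_on) (auto dest!: has_derivative_continuous)
      then have "closed (W \<inter> (\<lambda>x. \<bar>v x - v (z k)\<bar>) -` {..c / 2 * R})"
        using clW by (intro continuous_closed_preimage continuous_intros) auto
      moreover have "S k = W \<inter> (\<lambda>x. \<bar>v x - v (z k)\<bar>) -` {..c / 2 * R}" by (auto simp: S_def)
      ultimately show ?thesis by simp
    qed
    have S_sets: "S k \<in> sets N" for k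
      unfolding N_def using closedS[of k] W_sub
      by (subst sets_restrict_space_iff) (auto simp: S_def O_lm fmeasurableD)
    have S_measure: "measure N (S k) \<le> 128 * K * R" if k: "k \<in> I" for k
    proof -
      have "measure lebesgue (S k) \<le> 128 * K * R"
      proof (rule tube_measure_le[OF dv c, where r = r and t = "v (z k)"])
        show "norm (Dv x - Dv y) \<le> c / 4" if "x \<in> \<Omega>" "y \<in> \<Omega>" "dist x y \<le> r" for x y
          using oscv[OF that] e1 by simp
        show "cball x r \<subseteq> \<Omega>" if "x \<in> S k" for x
          using that r \<rho> subset_cball[OF r(2), of x] by (auto simp: S_def)
      qed (use R0 K closedS in \<open>auto simp: S_def R_def\<close>)
      moreover have "S k \<subseteq> \<Omega>" using W_sub by (auto simp: S_def)
      ultimately show ?thesis by (simp add: mN)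
    qed
    have pointwise: "\<bar>w x\<bar> \<le> e + (\<Sum>k\<in>I. 2 * D k * indicator (S k) x)"
      if x: "x \<in> \<Omega>" and \<gamma>: "0 \<le> s0" "continuous_on {0..s0} \<gamma>" "\<gamma> 0 \<in> frontier \<Omega>"
        "\<gamma> s0 = x" "\<gamma> ` {0<..s0} \<subseteq> \<Omega>" "\<And>s. s \<in> {0..s0} \<Longrightarrow> v (\<gamma> s) = v x" for x and s0 :: real and \<gamma>
    proof (cases "e \<le> \<bar>w x\<bar>")
      case False
      then show ?thesis using D0 by (intro add_increasing2 sum_nonneg) auto
    next
      case True
      have xW: "x \<in> W" using True x closure_subset by (auto simp: W_def)
      have \<gamma>cl: "\<gamma> s \<in> closure \<Omega>" if "s \<in> {0..s0}" for s
      proof (cases "s = 0")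
        case True then show ?thesis using \<gamma>(3) by (auto simp: frontier_def)
      next
        case False then show ?thesis using \<gamma>(5) that closure_subset by force
      qed
      have cont: "continuous_on {0..s0} (\<lambda>s. \<bar>w (\<gamma> s)\<bar>)"
        using \<gamma>cl by (intro continuous_intros continuous_on_compose2[OF w(1) \<gamma>(2)]) auto
      define I' where "I' = {k \<in> I. x \<in> S k}"
      \<comment> \<open>The representative depends on the cell and on the level but not on the
        parameter of the curve, so repeated visits to a cell yield the same interval of values of
        \<open>\<bar>w\<bar>\<close>.\<close>
      define p where "p k = (SOME p. p \<in> cell \<delta> k \<and> v p = v x)" for k
      have "{e..\<bar>w x\<bar>} \<subseteq> (\<Union>k\<in>I'. cball \<bar>w (p k)\<bar> (D k))"
      proof
        fix y assume y: "y \<in> {e..\<bar>w x\<bar>}"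
        obtain s where s: "0 \<le> s" "s \<le> s0" "\<bar>w (\<gamma> s)\<bar> = y"
          using IVT'[of "\<lambda>s. \<bar>w (\<gamma> s)\<bar>" 0 y s0] cont \<gamma> y w(2)[OF \<gamma>(3)] \<open>0 < e\<close> by auto
        have "\<gamma> s \<in> W" using s y \<gamma>cl by (auto simp: W_def)
        define k where "k = cell_key \<delta> (\<gamma> s)"
        have k: "k \<in> I" "\<gamma> s \<in> cell \<delta> k" using \<open>\<gamma> s \<in> W\<close> by (auto simp: k_def I_def cell_def)
        have vs: "v (\<gamma> s) = v x" using \<gamma>(6) s by auto
        have "p k \<in> cell \<delta> k \<and> v (p k) = v x"
          unfolding p_def by (rule someI[of _ "\<gamma> s"]) (use k vs in auto)
        then have "\<bar>w (p k) - w (\<gamma> s)\<bar> \<le> D k" using w_osc[OF k(1) k(2)] vs by auto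
        then have "y \<in> cball \<bar>w (p k)\<bar> (D k)" using s(3) by (auto simp: dist_real_def)
        moreover have "k \<in> I'"
          using k v_osc[OF k] vs xW by (auto simp: I'_def S_def)
        ultimately show "y \<in> (\<Union>k\<in>I'. cball \<bar>w (p k)\<bar> (D k))" by blast
      qed
      then have "measure lebesgue {e..\<bar>w x\<bar>} \<le> measure lebesgue (\<Union>k\<in>I'. cball \<bar>w (p k)\<bar> (D k))"
        using finI by (intro measure_mono_fmeasurable fmeasurable.finite_UN) (auto simp: I'_def)
      also have "\<dots> \<le> (\<Sum>k\<in>I'. measure lebesgue (cball \<bar>w (p k)\<bar> (D k)))"
        using finI by (intro measure_UNION_le) (auto simp: I'_def)
      also have "\<dots> = (\<Sum>k\<in>I'. 2 * D k)"
        using D0 by (intro sum.cong) (auto simp: cball_eq_atLeastAtMost)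
      also have "\<dots> = (\<Sum>k\<in>I. 2 * D k * indicator (S k) x)"
        unfolding I'_def by (subst sum.inter_filter[OF finI]) (auto simp: indicator_def intro!: sum.cong)
      finally show ?thesis using True by simp
    qed
    have AEw: "AE x in N. \<bar>w x\<bar> \<le> e + (\<Sum>k\<in>I. 2 * D k * indicator (S k) x)"
      using path AE_space[of N] unfolding N_def[symmetric]
    proof eventually_elim
      case (elim x)
      then show ?case using pointwise[of x] unfolding spN level_reaches_frontier_def by blast
    qed
    have int_S: "integrable N (\<lambda>x. \<Sum>k\<in>I. 2 * D k * indicator (S k) x)"
      by (rule sumN(1)) (rule S_sets)
    have mNO: "measure N (space N) = A" using mN[of \<Omega>] by (simp add: spN A_def)
    have "(LINT x|N. \<bar>w x\<bar>) \<le> (LINT x|N. e + (\<Sum>k\<in>I. 2 * D k * indicator (S k) x))"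
      using int_w int_S AEw by (intro integral_mono_AE) auto
    also have "\<dots> = e * A + (\<Sum>k\<in>I. 2 * D k * measure N (S k))"
      using int_S mNO sumN(2)[of I S "\<lambda>k. 2 * D k"] S_sets
      by (subst Bochner_Integration.integral_add) simp_all
    also have "\<dots> \<le> e * A + (\<Sum>k\<in>I. 2 * D k * (128 * K * R))"
      using S_measure D0 by (intro add_left_mono sum_mono mult_left_mono) auto
    also have "(\<Sum>k\<in>I. 2 * D k * (128 * K * R)) = C * (\<Sum>k\<in>I. (g (z k) + e) * \<delta>\<^sup>2)"
      unfolding sum_distrib_left
      by (intro sum.cong refl) (simp add: D_def C_def R\<delta> power2_eq_square)
    \<comment> \<open>A Riemann sum compared with the integral of \<open>g\<close>. Of the two
      errors \<open>e\<close>, one is already in the summand and the other is the oscillation of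
      \<open>g\<close> on a cell.\<close>
    also have "(\<Sum>k\<in>I. (g (z k) + e) * \<delta>\<^sup>2) \<le> (LINT x|N. g x) + 2 * e * A"
    proof -
      have cell_sets: "cell \<delta> k \<in> sets N" if "k \<in> I" for k
        unfolding N_def using cell_fmeasurable[OF R0(2)] cell_sub[OF that] O_lm
        by (subst sets_restrict_space_iff) (auto simp: fmeasurableD)
      have "(\<Sum>k\<in>I. (g (z k) + e) * \<delta>\<^sup>2) \<le> (\<Sum>k\<in>I. (g (z k) + e) * measure N (cell \<delta> k))"
        using cell_measure_ge[OF R0(2)] cell_sub \<open>0 < e\<close>
        by (intro sum_mono mult_left_mono) (auto simp: mN g_def)
      also have "\<dots> = (LINT x|N. (\<Sum>k\<in>I. (g (z k) + e) * indicator (cell \<delta> k) x))"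
        by (rule sumN(2)[symmetric]) (rule cell_sets)
      also have "\<dots> \<le> (LINT x|N. g x + 2 * e)"
      proof (rule integral_mono)
        show "integrable N (\<lambda>x. \<Sum>k\<in>I. (g (z k) + e) * indicator (cell \<delta> k) x)"
          by (rule sumN(1)) (rule cell_sets)
        show "integrable N (\<lambda>x. g x + 2 * e)" using int_g by auto
        fix x assume "x \<in> space N"
        then have "x \<in> \<Omega>" by (simp add: spN)
        have "(\<Sum>k\<in>I. (g (z k) + e) * indicator (cell \<delta> k) x)
            = (\<Sum>k\<in>I. if k = cell_key \<delta> x then g (z k) + e else 0)"
          by (intro sum.cong) (auto simp: indicator_def cell_disjoint)
        also have "\<dots> \<le> g x + 2 * e"
        proof (cases "cell_key \<delta> x \<in> I")
          case True
          let ?k = "cell_key \<delta> x"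
          have xk: "dist x (z ?k) \<le> r" by (rule cell_r[OF _ z(2)[OF True]]) (simp add: cell_def)
          have "g (z ?k) \<le> g x + e"
            using cross_osc[OF \<open>x \<in> \<Omega>\<close> \<open>x \<in> \<Omega>\<close> zO[OF True] xk xk] unfolding g_def by linarith
          then show ?thesis using True finI by simp
        next
          case False
          then show ?thesis using finI \<open>0 < e\<close> by (simp add: g_def)
        qed
        finally show "(\<Sum>k\<in>I. (g (z k) + e) * indicator (cell \<delta> k) x) \<le> g x + 2 * e" .
      qed
      also have "\<dots> = (LINT x|N. g x) + 2 * e * A"
        using int_g mNO by simp
      finally show ?thesis .
    qed
    finally show ?thesis using C0 by (simp add: mult_left_mono)
  qed
  define X where "X = (LINT x|N. \<bar>w x\<bar>) - C * (LINT x|N. g x)"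
  define B where "B = A * (1 + 2 * C)"
  have XB: "X \<le> e * B" if "0 < e" for e
    using main[OF that] by (simp add: X_def B_def algebra_simps)
  have "X \<le> 0" using XB by (rule nonpos_if_le_all_multiples)
  then show ?thesis by (simp add: X_def C_def N_def g_def)
qed

section \<open>Test functions\<close>

lemma has_derivative_partial_sum:
  assumes "f differentiable (at x)"
  shows "(f has_derivative (\<lambda>h. \<Sum>i\<in>UNIV. h $ i *\<^sub>R partial i f x)) (at x)"
proof -
  let ?L = "frechet_derivative f (at x)"
  have d: "(f has_derivative ?L) (at x)" using assms frechet_derivative_works by blast
  then interpret L: linear ?L using has_derivative_linear by blast
  have "?L h = (\<Sum>i\<in>UNIV. h $ i *\<^sub>R partial i f x)" for h
  proof -
    have "?L h = ?L (\<Sum>i\<in>UNIV. h $ i *\<^sub>R axis i 1)"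
      using basis_expansion[of h] by (simp add: scalar_mult_eq_scaleR)
    also have "\<dots> = (\<Sum>i\<in>UNIV. h $ i *\<^sub>R ?L (axis i 1))"
      by (simp add: L.sum L.scaleR)
    finally show ?thesis by (simp add: partial_def)
  qed
  then have "?L = (\<lambda>h. \<Sum>i\<in>UNIV. h $ i *\<^sub>R partial i f x)" by (rule ext)
  with d show ?thesis by simp
qed

lemma has_derivative_grad:
  assumes "f differentiable (at x)"
  shows "(f has_derivative (\<lambda>h. grad f x \<bullet> h)) (at x)"
  using has_derivative_partial_sum[OF assms]
  by (simp add: grad_def inner_vec_def mult.commute)

lemma partial_eq:
  assumes "(f has_derivative f') (at x)"
  shows "partial i f x = f' (axis i 1)"
  unfolding partial_def frechet_derivative_at[OF assms, symmetric] by simp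

lemma grad_nth [simp]: "grad f x $ i = partial i f x"
  by (simp add: grad_def)

lemma partial_cong_open:
  assumes "open U" "x \<in> U" "\<And>y. y \<in> U \<Longrightarrow> f y = g y"
  shows "partial i f x = partial i g x"
proof -
  have "(f has_derivative D) (at x) \<longleftrightarrow> (g has_derivative D) (at x)" for D
    using has_derivative_transform_within_open[OF _ assms(1,2), of f D UNIV g]
      has_derivative_transform_within_open[OF _ assms(1,2), of g D UNIV f] assms(3) by force
  then show ?thesis by (simp add: partial_def frechet_derivative_def)
qed

section \<open>A smooth bump function\<close>

text \<open>The classical flat function exp(-1/t). The division by a power of \<open>t\<close> makes
  the family stable under differentiation: the derivative of member \<open>k\<close> combines
  members \<open>k + 2\<close> and \<open>k + 1\<close>.\<close>

definition flat_exp :: "nat \<Rightarrow> real \<Rightarrow> real" where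
  "flat_exp k t = (if 0 < t then exp (- 1 / t) / t ^ k else 0)"

text \<open>The exponential series of 1/t dominates its single term of index \<open>k + 2\<close>.
  The resulting quadratic bound makes the difference quotient at 0 tend to 0.\<close>

lemma flat_exp_le: "\<bar>flat_exp k t\<bar> \<le> fact (k + 2) * t\<^sup>2"
proof (cases "0 < t")
  case True
  have "(1/t) ^ (k + 2) / fact (k + 2) \<le> exp (1/t)"
  proof -
    have s: "(\<lambda>n. (1/t) ^ n / fact n) sums exp (1/t)"
      using exp_converges[of "1/t"] by (simp add: divide_inverse mult.commute)
    have "(\<Sum>n\<in>{k+2}. (1/t) ^ n / fact n) \<le> (\<Sum>n. (1/t) ^ n / fact n)"
      using s True by (intro sum_le_suminf) (auto simp: sums_iff)
    then show ?thesis using s by (simp add: sums_iff)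
  qed
  then have "exp (- 1/t) * ((1/t) ^ (k + 2) / fact (k + 2)) \<le> exp (- 1/t) * exp (1/t)"
    by (intro mult_left_mono) auto
  also have "\<dots> = 1" by (simp add: exp_add[symmetric])
  finally have "exp (- 1/t) / (t ^ k * t\<^sup>2) \<le> fact (k + 2)"
    using True by (simp add: power_divide power_add divide_simps ac_simps power2_eq_square del: fact_Suc)
  then have "exp (- 1/t) / t ^ k \<le> fact (k + 2) * t\<^sup>2"
    using True by (simp add: divide_simps ac_simps del: fact_Suc)
  then show ?thesis using True by (simp add: flat_exp_def)
qed (auto simp: flat_exp_def)

lemma flat_exp_deriv:
  "(flat_exp k has_real_derivative flat_exp (k + 2) t - k * flat_exp (k + 1) t) (at t)"
proof -
  consider "0 < t" | "t < 0" | "t = 0" by linarith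
  then show ?thesis
  proof cases
    case 1
    have "((\<lambda>t. exp (- 1 / t) / t ^ k) has_real_derivative
        (exp (- 1 / t) * (1 / t\<^sup>2) * t ^ k - exp (- 1 / t) * (real k * t ^ (k - 1))) / (t ^ k * t ^ k)) (at t)"
      using 1 by (auto intro!: derivative_eq_intros simp: power2_eq_square)
    moreover have "(exp (- 1 / t) * (1 / t\<^sup>2) * t ^ k - exp (- 1 / t) * (real k * t ^ (k - 1))) / (t ^ k * t ^ k)
        = flat_exp (k + 2) t - k * flat_exp (k + 1) t"
      using 1 by (cases k) (simp_all add: flat_exp_def field_simps power2_eq_square)
    ultimately have "((\<lambda>t. exp (- 1 / t) / t ^ k) has_real_derivative flat_exp (k + 2) t - k * flat_exp (k + 1) t) (at t)"
      by (simp only:)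
    then show ?thesis
      by (rule has_field_derivative_transform_within_open[where S="{0<..}"]) (use 1 in \<open>auto simp: flat_exp_def\<close>)
  next
    case 2
    have "((\<lambda>t. 0) has_real_derivative flat_exp (k + 2) t - k * flat_exp (k + 1) t) (at t)"
      using 2 by (auto simp: flat_exp_def)
    then show ?thesis
      by (rule has_field_derivative_transform_within_open[where S="{..<0}"]) (use 2 in \<open>auto simp: flat_exp_def\<close>)
  next
    case 3
    have "((\<lambda>h. flat_exp k h / h) \<longlongrightarrow> 0) (at 0)"
    proof (rule Lim_null_comparison)
      show "\<forall>\<^sub>F h in at 0. norm (flat_exp k h / h) \<le> fact (k + 2) * \<bar>h\<bar>"
        unfolding eventually_at_filter
      proof (intro always_eventually allI impI)
        fix h :: real assume "h \<noteq> 0"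
        then show "norm (flat_exp k h / h) \<le> fact (k + 2) * \<bar>h\<bar>"
          using flat_exp_le[of k h] by (simp add: divide_simps power2_eq_square abs_mult[symmetric] del: fact_Suc)
      qed
      show "((\<lambda>h. fact (k + 2) * \<bar>h\<bar>) \<longlongrightarrow> (0::real)) (at 0)"
        by (rule tendsto_eq_intros | simp)+
    qed
    then show ?thesis unfolding 3 DERIV_def by (simp add: flat_exp_def)
  qed
qed

text \<open>A syntactic class that contains the bump functions and is closed under partial
  derivatives. Smoothness of all orders then follows by induction on the list of coordinates,
  without a formula for higher derivatives.\<close>

inductive smooth_fam :: "(real^'n::finite \<Rightarrow> real) \<Rightarrow> bool" where
  const: "smooth_fam (\<lambda>x. c)"
| coord: "smooth_fam (\<lambda>x. x $ i)"
| bump: "smooth_fam (\<lambda>x. flat_exp k (r - x \<bullet> x))"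
| add: "smooth_fam f \<Longrightarrow> smooth_fam g \<Longrightarrow> smooth_fam (\<lambda>x. f x + g x)"
| mult: "smooth_fam f \<Longrightarrow> smooth_fam g \<Longrightarrow> smooth_fam (\<lambda>x. f x * g x)"

lemma smooth_fam_step:
  assumes "smooth_fam f"
  shows "f differentiable (at x)" and "smooth_fam (partial i f)"
proof -
  have "(\<forall>x. f differentiable (at x)) \<and> (\<forall>i. smooth_fam (partial i f))"
    using assms
  proof induction
    case (const c)
    have "((\<lambda>x::real^'a. c) has_derivative (\<lambda>h. 0)) (at x)" for x by simp
    from partial_eq[OF this] have "partial i (\<lambda>x::real^'a. c) = (\<lambda>x. 0)" for i by auto
    then show ?case by (auto intro: smooth_fam.const)
  next
    case (coord j)
    have "((\<lambda>x::real^'a. x $ j) has_derivative (\<lambda>h. h $ j)) (at x)" for x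
      by (auto intro!: derivative_eq_intros bounded_linear_imp_has_derivative bounded_linear_vec_nth)
    from partial_eq[OF this] this have "partial i (\<lambda>x::real^'a. x $ j) = (\<lambda>x. axis i 1 $ j)"
      "(\<lambda>x::real^'a. x $ j) differentiable (at x)" for i x
      by (auto simp: differentiable_def)
    then show ?case by (auto intro: smooth_fam.const)
  next
    case (bump k r)
    have d: "((\<lambda>x::real^'a. flat_exp k (r - x \<bullet> x)) has_derivative
       (\<lambda>h. (flat_exp (k + 2) (r - x \<bullet> x) - k * flat_exp (k + 1) (r - x \<bullet> x)) * (- 2 * (x \<bullet> h)))) (at x)" for x
    proof -
      have "((\<lambda>x::real^'a. r - x \<bullet> x) has_derivative (\<lambda>h. - 2 * (x \<bullet> h))) (at x)"
        by (auto intro!: derivative_eq_intros simp: inner_commute)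
      from has_derivative_compose[OF this flat_exp_deriv[unfolded has_field_derivative_def]]
      show ?thesis .
    qed
    have eq: "partial i (\<lambda>x::real^'a. flat_exp k (r - x \<bullet> x)) =
       (\<lambda>x. (flat_exp (k + 2) (r - x \<bullet> x) + (- real k) * flat_exp (k + 1) (r - x \<bullet> x)) * ((- 2) * (x $ i)))" for i
      using partial_eq[OF d] by (auto simp: inner_axis)
    then have "smooth_fam (partial i (\<lambda>x::real^'a. flat_exp k (r - x \<bullet> x)))" for i
      unfolding eq by (intro smooth_fam.mult smooth_fam.add smooth_fam.bump smooth_fam.const smooth_fam.coord)
    then show ?case using d by (auto simp: differentiable_def)
  next
    case (add f g)
    have "partial i (\<lambda>x. f x + g x) = (\<lambda>x. partial i f x + partial i g x)" for i
    proof
      fix x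
      have "((\<lambda>x. f x + g x) has_derivative (\<lambda>h. grad f x \<bullet> h + grad g x \<bullet> h)) (at x)"
        using add by (intro has_derivative_add has_derivative_grad) auto
      from partial_eq[OF this] show "partial i (\<lambda>x. f x + g x) x = partial i f x + partial i g x"
        by (simp add: inner_axis)
    qed
    then show ?case using add by (auto intro: smooth_fam.intros)
  next
    case (mult f g)
    have eq: "partial i (\<lambda>x. f x * g x) = (\<lambda>x. f x * partial i g x + partial i f x * g x)" for i
    proof
      fix x
      have "((\<lambda>x. f x * g x) has_derivative (\<lambda>h. f x * (grad g x \<bullet> h) + (grad f x \<bullet> h) * g x)) (at x)"
        using mult by (intro has_derivative_mult has_derivative_grad) auto
      from partial_eq[OF this] show "partial i (\<lambda>x. f x * g x) x = f x * partial i g x + partial i f x * g x"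
        by (simp add: inner_axis)
    qed
    then have "smooth_fam (partial i (\<lambda>x. f x * g x))" for i
      unfolding eq using mult by (intro smooth_fam.mult smooth_fam.add) auto
    then show ?case using mult by auto
  qed
  then show "f differentiable (at x)" "smooth_fam (partial i f)" by auto
qed

definition smooth :: "(real^'n::finite \<Rightarrow> real) \<Rightarrow> bool" where
  "smooth f \<longleftrightarrow> (\<forall>is x. foldr partial is f differentiable (at x))"

lemma smooth_iff: "smooth f \<longleftrightarrow> (\<forall>k. Ck_on k UNIV f)"
proof
  assume "smooth f"
  then show "\<forall>k. Ck_on k UNIV f"
    by (auto simp: smooth_def Ck_on_def differentiable_on_def
        intro!: continuous_at_imp_continuous_on differentiable_imp_continuous_within)
next
  assume a: "\<forall>k. Ck_on k UNIV f"
  show "smooth f" unfolding smooth_def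
  proof (intro allI)
    fix "is" x
    \<comment> \<open>\<open>Ck_on k\<close> gives differentiability only of the derivatives of
      order below \<open>k\<close>, hence one order more than the length of the list.\<close>
    show "foldr partial is f differentiable (at x)"
      using a[rule_format, of "Suc (length is)"] by (auto simp: Ck_on_def differentiable_on_def)
  qed
qed

lemma smooth_fam_smooth: "smooth_fam f \<Longrightarrow> smooth f"
proof -
  assume f: "smooth_fam f"
  have "smooth_fam (foldr partial is f)" for "is"
    by (induction "is") (auto intro: f smooth_fam_step)
  then show ?thesis by (auto simp: smooth_def intro: smooth_fam_step)
qed

lemma smooth_partial: "smooth f \<Longrightarrow> smooth (partial i f)"
  unfolding smooth_def
proof (intro allI)
  fix "is" x assume "\<forall>is x. foldr partial is f differentiable (at x)"
  \<comment> \<open>\<open>foldr\<close> applies the last entry of the list first, so the inner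
    derivative is appended at the end.\<close>
  from this[rule_format, of "is @ [i]" x]
  show "foldr partial is (partial i f) differentiable (at x)" by simp
qed

lemma smooth_differentiable: "smooth f \<Longrightarrow> f differentiable (at x)"
  unfolding smooth_def by (metis foldr_Nil id_apply)

lemma smooth_continuous: "smooth f \<Longrightarrow> continuous_on S f"
  by (intro continuous_at_imp_continuous_on ballI differentiable_imp_continuous_within smooth_differentiable)

lemma smooth_continuous_grad: "smooth f \<Longrightarrow> continuous_on S (grad f)"
  unfolding grad_def by (intro continuous_intros smooth_continuous smooth_partial)

section \<open>Convolution, integration by parts and mollifiers\<close>

text \<open>The convolution of \<psi> and \<open>g\<close> when the box contains the support of
  \<psi>. Integrating over a fixed compact box makes the Leibniz rule for parameter integrals
  applicable.\<close>

definition conv :: "real^'n::finite \<Rightarrow> real^'n \<Rightarrow> (real^'n \<Rightarrow> real) \<Rightarrow> (real^'n \<Rightarrow> real) \<Rightarrow> real^'n \<Rightarrow> real" where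
  "conv a b \<psi> g x = integral (cbox a b) (\<lambda>y. \<psi> y * g (x - y))"

lemma conv_step:
  fixes \<psi> g :: "real^'n::finite \<Rightarrow> real"
  assumes \<psi>: "continuous_on (cbox a b) \<psi>" and g: "smooth g"
  shows "conv a b \<psi> g differentiable (at x)"
    and "partial i (conv a b \<psi> g) x = conv a b \<psi> (partial i g) x"
proof -
  define fx where "fx x y = \<psi> y *\<^sub>R blinfun_inner_right (grad g (x - y))" for x y
  have cont_fx: "continuous_on (UNIV \<times> cbox a b) (\<lambda>(x, y). fx x y)"
    unfolding fx_def case_prod_beta
    by (intro continuous_intros continuous_on_compose2[OF \<psi>] continuous_on_compose2[OF smooth_continuous_grad[OF g, of UNIV]]
        bounded_linear.continuous_on[OF bounded_linear_blinfun_inner_right]) auto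
  have "((\<lambda>x. integral (cbox a b) (\<lambda>y. \<psi> y * g (x - y))) has_derivative
      blinfun_apply (integral (cbox a b) (fx x))) (at x within UNIV)"
  proof (rule leibniz_rule[OF _ _ cont_fx])
    fix x y :: "real^'n"
    have "((\<lambda>x. x - y) has_derivative (\<lambda>h. h)) (at x)" by (auto intro!: derivative_eq_intros)
    from has_derivative_compose[OF this has_derivative_grad[OF smooth_differentiable[OF g, of "x - y"]]]
    have "((\<lambda>x. g (x - y)) has_derivative (\<lambda>h. grad g (x - y) \<bullet> h)) (at x)" .
    from has_derivative_mult_right[OF this, of "\<psi> y"]
    show "((\<lambda>x. \<psi> y * g (x - y)) has_derivative blinfun_apply (fx x y)) (at x within UNIV)"
      by (simp add: fx_def scaleR_blinfun.rep_eq)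
  next
    fix x show "(\<lambda>y. \<psi> y * g (x - y)) integrable_on cbox a b"
      by (intro integrable_continuous continuous_intros \<psi> continuous_on_compose2[OF smooth_continuous[OF g, of UNIV]]) auto
  qed auto
  then have d: "(conv a b \<psi> g has_derivative blinfun_apply (integral (cbox a b) (fx x))) (at x)"
    by (simp add: conv_def[abs_def])
  then show "conv a b \<psi> g differentiable (at x)" by (auto simp: differentiable_def)
  have "continuous_on (cbox a b) (fx x)"
  proof -
    have "continuous_on (cbox a b) (\<lambda>y. (x, y))" by (intro continuous_intros)
    from continuous_on_compose2[OF cont_fx this] show ?thesis by force
  qed
  then have "fx x integrable_on cbox a b" by (rule integrable_continuous)
  then have "blinfun_apply (integral (cbox a b) (fx x)) (axis i 1) = integral (cbox a b) (\<lambda>y. fx x y (axis i 1))"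
    by (rule blinfun_apply_integral)
  then show "partial i (conv a b \<psi> g) x = conv a b \<psi> (partial i g) x"
    unfolding partial_eq[OF d] conv_def by (simp add: fx_def blinfun.scaleR_left inner_axis)
qed

lemma conv_smooth:
  assumes \<psi>: "continuous_on (cbox a b) \<psi>" and g: "smooth g"
  shows "smooth (conv a b \<psi> g)"
proof -
  have "foldr partial is (conv a b \<psi> g) = conv a b \<psi> (foldr partial is g) \<and> smooth (foldr partial is g)" for "is"
    by (induction "is") (auto simp: g conv_step(2)[OF \<psi>] smooth_partial intro!: ext)
  then show ?thesis unfolding smooth_def[of "conv a b \<psi> g"] using conv_step(1)[OF \<psi>] by auto
qed

lemma integrable_lborel_supported:
  fixes f :: "'a::euclidean_space \<Rightarrow> real"
  assumes "compact S" "continuous_on S f" "\<And>x. x \<notin> S \<Longrightarrow> f x = 0"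
  shows "integrable lborel f"
proof -
  have "(\<lambda>x. indicator S x *\<^sub>R f x) = f" by (rule ext) (use assms(3) in \<open>auto simp: indicator_def\<close>)
  then show ?thesis using borel_integrable_compact[OF assms(1,2)] by simp
qed

lemma lborel_integral_translate:
  fixes f :: "'a::euclidean_space \<Rightarrow> real"
  assumes "f \<in> borel_measurable borel"
  shows "(LINT x|lborel. f (c + x)) = (LINT x|lborel. f x)"
proof -
  have "(LINT x|lborel. f x) = (LINT x|distr lborel borel ((+) c). f x)"
    by (simp add: lborel_distr_plus)
  also have "\<dots> = (LINT x|lborel. f (c + x))"
    using assms by (subst integral_distr) auto
  finally show ?thesis by simp
qed

lemma differentiable_imp_continuous_UNIV:
  "(\<And>x. f differentiable (at x)) \<Longrightarrow> continuous_on UNIV f"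
  by (auto intro!: continuous_at_imp_continuous_on differentiable_imp_continuous_within)

lemma partial_zero_outside:
  assumes "closed S" "\<And>x. x \<notin> S \<Longrightarrow> f x = (0::real)" "x \<notin> S"
  shows "partial i f x = 0"
proof -
  have "partial i f x = partial i (\<lambda>x. 0) x"
    by (rule partial_cong_open[of "- S"]) (use assms in auto)
  also have "\<dots> = 0"
    using partial_eq[of "\<lambda>x. 0::real" "\<lambda>h. 0" x i] by simp
  finally show ?thesis .
qed

text \<open>\<Omega> and the complement of \<open>S\<close> are open and cover the space, and
  \<open>g\<close> is continuous on each of them.\<close>

lemma continuous_on_UNIV_supported:
  fixes g :: "'a::topological_space \<Rightarrow> 'b::{topological_space, zero}"
  assumes "open \<Omega>" "closed S" "S \<subseteq> \<Omega>" "continuous_on \<Omega> g" "\<And>x. x \<notin> S \<Longrightarrow> g x = 0"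
  shows "continuous_on UNIV g"
proof -
  have "continuous_on (- S) g" using assms(5) by (subst continuous_on_cong[of "- S" _ _ "\<lambda>x. 0"]) auto
  then have "continuous_on (\<Omega> \<union> - S) g" using assms by (intro continuous_on_open_Un) auto
  moreover have "\<Omega> \<union> - S = UNIV" using assms(3) by auto
  ultimately show ?thesis by simp
qed

lemma differentiable_supported:
  assumes "closed S" "\<And>x. x \<in> S \<Longrightarrow> f differentiable (at x)" "\<And>x. x \<notin> S \<Longrightarrow> f x = 0"
  shows "f differentiable (at x)"
proof (cases "x \<in> S")
  case False
  have "(f has_derivative (\<lambda>h. 0)) (at x)"
    by (rule has_derivative_transform_within_open[of "\<lambda>x. 0" _ _ _ "- S"]) (use False assms in auto)
  then show ?thesis by (auto simp: differentiable_def)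
qed (rule assms(2))

lemma bounded_supported:
  fixes f :: "real^'n::finite \<Rightarrow> real"
  assumes "compact S" "continuous_on S f" "\<And>x. x \<notin> S \<Longrightarrow> f x = 0"
  obtains B where "0 \<le> B" "\<And>x. \<bar>f x\<bar> \<le> B"
proof -
  have "bounded (f ` S)" using assms by (intro compact_imp_bounded compact_continuous_image)
  then obtain B where B: "\<And>x. x \<in> S \<Longrightarrow> \<bar>f x\<bar> \<le> B" by (auto simp: bounded_iff)
  show ?thesis
  proof
    show "0 \<le> max B 0" by simp
    show "\<bar>f x\<bar> \<le> max B 0" for x using B[of x] assms(3)[of x] by (cases "x \<in> S") auto
  qed
qed

text \<open>Integration by parts on the whole space. The difference quotients of \<open>f\<close>
  have integral 0 by translation invariance, and they converge dominatedly to the partial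
  derivative: they are bounded by \<open>B\<close> and, for steps of length at most 1, vanish
  outside the unit neighbourhood of \<open>S\<close>.\<close>

lemma integral_partial_zero:
  fixes f :: "real^'n::finite \<Rightarrow> real"
  assumes diff: "\<And>x. f differentiable (at x)" and cont: "continuous_on UNIV (partial i f)"
    and S: "compact S" "\<And>x. x \<notin> S \<Longrightarrow> f x = 0"
  shows "(LINT x|lborel. partial i f x) = 0"
proof -
  define e :: "real^'n" where "e = axis i 1"
  have norm_e: "norm e = 1" by (simp add: e_def)
  have contf: "continuous_on UNIV f" using diff by (rule differentiable_imp_continuous_UNIV)
  have p0: "partial i f x = 0" if "x \<notin> S" for x
    using S that by (intro partial_zero_outside[of S]) (auto intro: compact_imp_closed)
  obtain B where B: "0 \<le> B" "\<And>x. \<bar>partial i f x\<bar> \<le> B"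
    using bounded_supported[of S "partial i f"] S(1) continuous_on_subset[OF cont] p0 by auto
  have dline: "((\<lambda>s. f (x + s *\<^sub>R e)) has_real_derivative partial i f (x + s *\<^sub>R e)) (at s)" for x s
  proof -
    have "(f has_derivative (\<lambda>h. grad f (x + s *\<^sub>R e) \<bullet> h)) (at (x + s *\<^sub>R e))"
      by (rule has_derivative_grad[OF diff])
    from has_real_derivative_along_line[OF this] show ?thesis by (simp add: e_def inner_axis)
  qed
  define h where "h n = inverse (real (Suc n))" for n
  have h: "0 < h n" "h n \<le> 1" for n by (auto simp: h_def inverse_le_1_iff)
  define q where "q n x = (f (x + h n *\<^sub>R e) - f x) / h n" for n x
  define S' where "S' = {x + y | x y. x \<in> S \<and> y \<in> cball 0 1}"
  have S': "compact S'" unfolding S'_def using S(1) by (intro compact_sums) auto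
  have mf: "f \<in> borel_measurable borel" using contf by (rule borel_measurable_continuous_onI)
  have intf: "integrable lborel f"
    using S continuous_on_subset[OF contf] by (intro integrable_lborel_supported[of S]) auto
  have q_bound: "\<bar>q n x\<bar> \<le> B * indicator S' x" for n x
  proof (cases "x \<in> S'")
    case True
    obtain z where "f (x + h n *\<^sub>R e) - f (x + 0 *\<^sub>R e) = (h n - 0) * partial i f (x + z *\<^sub>R e)"
      using MVT2[of 0 "h n" "\<lambda>s. f (x + s *\<^sub>R e)" "\<lambda>s. partial i f (x + s *\<^sub>R e)"] h[of n] dline by blast
    then have "q n x = partial i f (x + z *\<^sub>R e)" using h(1)[of n] by (simp add: q_def)
    then show ?thesis using B True by simp
  next
    case False
    have "x \<notin> S"
    proof
      assume "x \<in> S"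
      then have "x + 0 \<in> S'" unfolding S'_def by force
      then show False using False by simp
    qed
    moreover have "x + h n *\<^sub>R e \<notin> S"
    proof
      assume "x + h n *\<^sub>R e \<in> S"
      then have "(x + h n *\<^sub>R e) + (- (h n *\<^sub>R e)) \<in> S'"
        unfolding S'_def mem_Collect_eq using h[of n] norm_e
        by (intro exI[of _ "x + h n *\<^sub>R e"] exI[of _ "- (h n *\<^sub>R e)"]) simp
      then show False using False by simp
    qed
    ultimately show ?thesis using S(2) False by (simp add: q_def)
  qed
  have int0: "(LINT x|lborel. q n x) = 0" for n
  proof -
    have c: "continuous_on UNIV (\<lambda>x. f (x + h n *\<^sub>R e))"
      by (intro continuous_on_compose2[OF contf] continuous_intros) auto
    have "integrable lborel (\<lambda>x. f (x + h n *\<^sub>R e))"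
      using integrable_distr[of "(+) (h n *\<^sub>R e)" lborel borel f] intf
      by (simp add: lborel_distr_plus add.commute)
    then have "(LINT x|lborel. q n x) = ((LINT x|lborel. f (x + h n *\<^sub>R e)) - (LINT x|lborel. f x)) / h n"
      using intf by (simp add: q_def)
    then show ?thesis using lborel_integral_translate[OF mf, of "h n *\<^sub>R e"] by (simp add: add.commute)
  qed
  have lim: "(\<lambda>n. LINT x|lborel. q n x) \<longlonglongrightarrow> (LINT x|lborel. partial i f x)"
  proof (rule integral_dominated_convergence[where w = "\<lambda>x. B * indicator S' x"])
    show "partial i f \<in> borel_measurable lborel"
      using borel_measurable_continuous_onI[OF cont] by simp
    show "q n \<in> borel_measurable lborel" for n
      unfolding q_def using mf by measurable
    show "integrable lborel (\<lambda>x. B * indicator S' x)"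
      using S' emeasure_bounded_finite[of S'] by (intro integrable_mult_right integrable_real_indicator) (auto simp: compact_imp_bounded compact_imp_closed)
    show "AE x in lborel. (\<lambda>n. q n x) \<longlonglongrightarrow> partial i f x"
    proof (rule AE_I2)
      fix x
      have "((\<lambda>t. (f (x + (0 + t) *\<^sub>R e) - f (x + 0 *\<^sub>R e)) / t) \<longlongrightarrow> partial i f (x + 0 *\<^sub>R e)) (at 0)"
        using dline[of x 0] unfolding DERIV_def .
      moreover have "filterlim h (at 0) sequentially"
        unfolding filterlim_at h_def using LIMSEQ_inverse_real_of_nat by auto
      ultimately have "(\<lambda>n. (f (x + (0 + h n) *\<^sub>R e) - f (x + 0 *\<^sub>R e)) / h n) \<longlonglongrightarrow> partial i f (x + 0 *\<^sub>R e)"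
        by (rule filterlim_compose)
      then show "(\<lambda>n. q n x) \<longlonglongrightarrow> partial i f x" by (simp add: q_def)
    qed
    show "AE x in lborel. norm (q n x) \<le> B * indicator S' x" for n
      using q_bound by auto
  qed
  from LIMSEQ_unique[OF lim] int0 show ?thesis by simp
qed

lemma conv_eq_lborel:
  fixes \<psi> g :: "real^'n::finite \<Rightarrow> real"
  assumes \<psi>: "continuous_on UNIV \<psi>" "\<And>x. x \<notin> cbox a b \<Longrightarrow> \<psi> x = 0" and g: "continuous_on UNIV g"
  shows "conv a b \<psi> g x = (LINT y|lborel. \<psi> y * g (x - y))"
    and "integrable lborel (\<lambda>y. \<psi> y * g (x - y))"
proof -
  let ?F = "\<lambda>y. \<psi> y * g (x - y)"
  have c: "continuous_on (cbox a b) ?F"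
    by (intro continuous_intros continuous_on_subset[OF \<psi>(1)] continuous_on_compose2[OF g]) auto
  show "integrable lborel ?F"
    using \<psi>(2) by (intro integrable_lborel_supported[OF compact_cbox c]) auto
  have eq: "(\<lambda>y. indicator (cbox a b) y *\<^sub>R ?F y) = ?F"
    by (rule ext) (use \<psi>(2) in \<open>auto simp: indicator_def\<close>)
  have "set_integrable lborel (cbox a b) ?F"
    unfolding set_integrable_def by (rule borel_integrable_compact[OF compact_cbox c])
  from set_borel_integral_eq_integral(2)[OF this]
  show "conv a b \<psi> g x = (LINT y|lborel. ?F y)"
    unfolding conv_def set_lebesgue_integral_def eq by simp
qed

text \<open>The rotationally symmetric bump exp(-1/(\<delta>^2 - |x|^2)), extended by 0 and divided
  by its integral. The integral is positive because the bump is positive on an open ball, which is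
  not a null set.\<close>

lemma mollifier_exists:
  assumes "0 < \<delta>"
  shows "\<exists>g :: real^'n::finite \<Rightarrow> real. smooth g \<and> (\<forall>x. 0 \<le> g x) \<and> (\<forall>x. \<delta> \<le> norm x \<longrightarrow> g x = 0) \<and>
    (\<forall>x. g (- x) = g x) \<and> (LINT x|lborel. g x) = 1"
proof -
  define g0 :: "real^'n \<Rightarrow> real" where "g0 x = flat_exp 0 (\<delta>\<^sup>2 - x \<bullet> x)" for x
  have fam: "smooth_fam g0" unfolding g0_def by (rule smooth_fam.bump)
  have cont: "continuous_on S g0" for S using fam by (intro smooth_continuous smooth_fam_smooth)
  have pos: "0 < g0 x" if "norm x < \<delta>" for x
    using power_strict_mono[OF that norm_ge_zero, of 2] by (simp add: g0_def flat_exp_def power2_norm_eq_inner[symmetric])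
  have nonneg: "0 \<le> g0 x" for x by (simp add: g0_def flat_exp_def)
  have zero: "g0 x = 0" if "\<delta> \<le> norm x" for x
    using that assms by (auto simp: g0_def flat_exp_def power2_norm_eq_inner[symmetric] not_less)
  have int: "integrable lborel g0"
    using zero by (intro integrable_lborel_supported[OF compact_cball[of 0 \<delta>] cont]) auto
  define c where "c = (LINT x|lborel. g0 x)"
  have "c \<noteq> 0"
  proof
    assume "c = 0"
    then have "AE x in lborel. g0 x = 0"
      using integral_nonneg_eq_0_iff_AE[OF int] nonneg by (simp add: c_def)
    then have "AE x in lborel. (x::real^'n) \<notin> ball 0 \<delta>" by (rule eventually_mono) (auto dest: pos)
    then have "ball 0 \<delta> \<in> null_sets (lborel :: (real^'n) measure)"
      by (subst AE_iff_null_sets) auto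
    then have "ball 0 \<delta> \<in> null_sets (lebesgue :: (real^'n) measure)"
      by (rule null_sets_completionI)
    then show False
      using assms open_not_negligible[of "ball (0 :: real^'n) \<delta>"] by (auto simp: negligible_iff_null_sets)
  qed
  moreover have "0 \<le> c" unfolding c_def using nonneg by (intro Bochner_Integration.integral_nonneg) auto
  ultimately have "0 < c" by simp
  show ?thesis
  proof (intro exI conjI allI impI)
    show "smooth (\<lambda>x. (1 / c) * g0 x)"
      by (intro smooth_fam_smooth smooth_fam.mult smooth_fam.const fam)
    show "(LINT x|lborel. (1 / c) * g0 x) = 1" using \<open>0 < c\<close> by (simp add: c_def)
  qed (use \<open>0 < c\<close> nonneg zero in \<open>auto simp: g0_def\<close>)
qed

text \<open>The convolution is a weighted average of the values of \<psi> at distance less than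
  \<delta> from \<open>x\<close>, with weights of total mass 1. The symmetry of \<open>g\<close>
  turns the reflected kernel into a translate, whose integral is known.\<close>

lemma conv_close:
  fixes \<psi> g :: "real^'n::finite \<Rightarrow> real"
  assumes \<psi>: "continuous_on UNIV \<psi>" "\<And>x. x \<notin> cbox a b \<Longrightarrow> \<psi> x = 0"
    and g: "continuous_on UNIV g" "\<And>x. 0 \<le> g x" "\<And>x. \<delta> \<le> norm x \<Longrightarrow> g x = 0"
      "\<And>x. g (- x) = g x" "(LINT x|lborel. g x) = 1"
    and close: "\<And>x y. dist x y < \<delta> \<Longrightarrow> \<bar>\<psi> x - \<psi> y\<bar> \<le> e"
  shows "\<bar>conv a b \<psi> g x - \<psi> x\<bar> \<le> e"
proof -
  have mg: "g \<in> borel_measurable borel" using g(1) by (rule borel_measurable_continuous_onI)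
  have intg: "integrable lborel g"
    using g by (intro integrable_lborel_supported[of "cball 0 \<delta>"]) (auto intro: continuous_on_subset)
  have "integrable lborel (\<lambda>y. g (- x + y))"
    using integrable_distr[of "(+) (- x)" lborel borel g] intg by (simp add: lborel_distr_plus)
  moreover have gx: "g (- x + y) = g (x - y)" for y using g(4)[of "x - y"] by simp
  ultimately have ig: "integrable lborel (\<lambda>y. g (x - y))" by simp
  have g1: "(LINT y|lborel. g (x - y)) = 1"
    using lborel_integral_translate[OF mg, of "- x"] g(5) gx by simp
  have "conv a b \<psi> g x - \<psi> x = (LINT y|lborel. \<psi> y * g (x - y)) - (LINT y|lborel. \<psi> x * g (x - y))"
    using g1 conv_eq_lborel(1)[OF \<psi> g(1)] by simp
  also have "\<dots> = (LINT y|lborel. \<psi> y * g (x - y) - \<psi> x * g (x - y))"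
    using conv_eq_lborel(2)[OF \<psi> g(1)] ig by (intro Bochner_Integration.integral_diff[symmetric]) auto
  also have "\<bar>\<dots>\<bar> \<le> (LINT y|lborel. \<bar>\<psi> y * g (x - y) - \<psi> x * g (x - y)\<bar>)"
    by (rule integral_abs_bound)
  also have "\<dots> \<le> (LINT y|lborel. e * g (x - y))"
  proof (rule integral_mono)
    show "integrable lborel (\<lambda>y. \<bar>\<psi> y * g (x - y) - \<psi> x * g (x - y)\<bar>)"
      using conv_eq_lborel(2)[OF \<psi> g(1)] ig by (intro integrable_abs Bochner_Integration.integrable_diff) auto
    show "integrable lborel (\<lambda>y. e * g (x - y))" using ig by auto
    fix y
    show "\<bar>\<psi> y * g (x - y) - \<psi> x * g (x - y)\<bar> \<le> e * g (x - y)"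
    proof (cases "norm (x - y) < \<delta>")
      case True
      then have "\<bar>\<psi> y - \<psi> x\<bar> \<le> e" using close[of y x] by (simp add: dist_norm norm_minus_commute)
      moreover have "\<psi> y * g (x - y) - \<psi> x * g (x - y) = (\<psi> y - \<psi> x) * g (x - y)" by (simp add: algebra_simps)
      ultimately show ?thesis using g(2)[of "x - y"] by (simp add: abs_mult mult_right_mono)
    next
      case False
      then show ?thesis using g(3)[of "x - y"] by simp
    qed
  qed
  also have "\<dots> = e" using g1 by simp
  finally show ?thesis .
qed

text \<open>Heine-Cantor on the unit neighbourhood of \<open>S\<close>: two points closer than 1
  either both lie in it or are both outside \<open>S\<close>, where \<psi> vanishes.\<close>

lemma uniformly_continuous_supported:
  fixes \<psi> :: "real^'n::finite \<Rightarrow> real"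
  assumes "continuous_on UNIV \<psi>" "compact S" "\<And>x. x \<notin> S \<Longrightarrow> \<psi> x = 0" "0 < e"
  shows "\<exists>\<delta>>0. \<forall>x y. dist x y < \<delta> \<longrightarrow> \<bar>\<psi> x - \<psi> y\<bar> \<le> e"
proof -
  define S' where "S' = {x + y | x y. x \<in> S \<and> y \<in> cball 0 1}"
  have S': "compact S'" unfolding S'_def using assms(2) by (intro compact_sums) auto
  have SS': "x \<in> S'" if "y \<in> S" "dist x y < 1" for x y
  proof -
    have "y + (x - y) \<in> S'"
      unfolding S'_def mem_Collect_eq by (rule exI[of _ y], rule exI[of _ "x - y"]) (use that in \<open>simp add: dist_norm norm_minus_commute\<close>)
    then show ?thesis by simp
  qed
  have "uniformly_continuous_on S' \<psi>"
    using assms(1) S' by (intro compact_uniformly_continuous) (auto intro: continuous_on_subset)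
  then obtain d where d: "0 < d" "\<And>x y. x \<in> S' \<Longrightarrow> y \<in> S' \<Longrightarrow> dist y x < d \<Longrightarrow> dist (\<psi> y) (\<psi> x) < e"
    using \<open>0 < e\<close> unfolding uniformly_continuous_on_def by metis
  have "\<bar>\<psi> x - \<psi> y\<bar> \<le> e" if xy: "dist x y < min d 1" for x y
  proof (cases "x \<in> S \<or> y \<in> S")
    case True
    then have "x \<in> S'" "y \<in> S'"
      using SS'[of x y] SS'[of x x] SS'[of y x] SS'[of y y] xy by (auto simp: dist_commute)
    then show ?thesis using d(2)[of y x] xy by (auto simp: dist_real_def)
  next
    case False
    then show ?thesis using assms by simp
  qed
  then show ?thesis using d(1) by (intro exI[of _ "min d 1"]) auto
qed

text \<open>Mollification: derivatives fall on either factor of a convolution, so smoothness comes from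
  the kernel and convergence of the derivatives from \<open>\<psi>\<close>.\<close>

lemma test_function_approx:
  fixes \<psi> :: "real^'n::finite \<Rightarrow> real"
  assumes "open \<Omega>" and S: "compact S" "S \<subseteq> \<Omega>" "\<And>x. x \<notin> S \<Longrightarrow> \<psi> x = 0"
    and \<psi>: "continuous_on UNIV \<psi>" and e: "0 < e"
  shows "\<exists>\<phi>. test_function \<Omega> \<phi> \<and> (\<forall>x. \<bar>\<phi> x - \<psi> x\<bar> \<le> e) \<and>
    ((\<forall>x. \<psi> differentiable (at x)) \<and> (\<forall>i. continuous_on UNIV (partial i \<psi>)) \<longrightarrow>
      (\<forall>i x. \<bar>partial i \<phi> x - partial i \<psi> x\<bar> \<le> e))"
proof -
  obtain a b where ab: "S \<subseteq> cbox a b"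
    using bounded_subset_cbox_symmetric[OF compact_imp_bounded[OF S(1)]] by blast
  obtain \<rho> where \<rho>: "0 < \<rho>" "(\<Union>x\<in>S. cball x \<rho>) \<subseteq> \<Omega>"
    using compact_subset_open_imp_cball_epsilon_subset[OF S(1) assms(1) S(2)] by blast
  have p0: "partial i \<psi> x = 0" if "x \<notin> S" for i x
    using S that by (intro partial_zero_outside[of S]) (auto intro: compact_imp_closed)
  obtain d where d: "0 < d" "\<And>x y. dist x y < d \<Longrightarrow> \<bar>\<psi> x - \<psi> y\<bar> \<le> e"
    using uniformly_continuous_supported[OF \<psi> S(1,3) e] by blast
  \<comment> \<open>Continuity of the partial derivative is a premise inside the property of
    \<open>d\<close>, so a modulus can be chosen in either case. One mollification then serves both
    halves of the conclusion.\<close>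
  have "\<exists>d>0. \<forall>x y. dist x y < d \<longrightarrow> continuous_on UNIV (partial i \<psi>) \<longrightarrow> \<bar>partial i \<psi> x - partial i \<psi> y\<bar> \<le> e" for i
    using uniformly_continuous_supported[of "partial i \<psi>", OF _ S(1) p0 e] zero_less_one by blast
  then obtain d' where d': "\<And>i. 0 < d' i"
    "\<And>i x y. dist x y < d' i \<Longrightarrow> continuous_on UNIV (partial i \<psi>) \<Longrightarrow> \<bar>partial i \<psi> x - partial i \<psi> y\<bar> \<le> e"
    by metis
  define \<delta> where "\<delta> = Min (insert \<rho> (insert d (range d')))"
  have \<delta>: "0 < \<delta>" "\<delta> \<le> \<rho>" "\<delta> \<le> d" "\<And>i. \<delta> \<le> d' i"
  proof -
    have "\<delta> \<in> insert \<rho> (insert d (range d'))" unfolding \<delta>_def by (rule Min_in) auto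
    then show "0 < \<delta>" using \<rho> d(1) d'(1) by auto
    have "\<delta> \<le> z" if "z \<in> insert \<rho> (insert d (range d'))" for z
      unfolding \<delta>_def using that by (intro Min_le) auto
    then show "\<delta> \<le> \<rho>" "\<delta> \<le> d" "\<And>i. \<delta> \<le> d' i" by blast+
  qed
  obtain g :: "real^'n \<Rightarrow> real" where g: "smooth g" "\<And>x. 0 \<le> g x" "\<And>x. \<delta> \<le> norm x \<Longrightarrow> g x = 0"
      "\<And>x. g (- x) = g x" "(LINT x|lborel. g x) = 1"
    using mollifier_exists[OF \<delta>(1), where 'n='n] by blast
  have cg: "continuous_on UNIV g" using g(1) by (rule smooth_continuous)
  have cpg: "continuous_on UNIV (partial i g)" for i using g(1) by (intro smooth_continuous smooth_partial)
  have \<psi>0: "x \<notin> cbox a b \<Longrightarrow> \<psi> x = 0" for x using ab S(3) by blast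
  define \<phi> where "\<phi> = conv a b \<psi> g"
  have smooth: "smooth \<phi>"
    unfolding \<phi>_def using g(1) \<psi> by (intro conv_smooth) (auto intro: continuous_on_subset)
  \<comment> \<open>The closed \<delta>-neighbourhood of \<open>S\<close>, which contains the
    support of the convolution and lies in \<Omega> since \<delta> is at most \<rho>.\<close>
  define S' where "S' = {x + y | x y. x \<in> S \<and> y \<in> cball 0 \<delta>}"
  have S': "compact S'" unfolding S'_def using S(1) by (intro compact_sums) auto
  have "S' \<subseteq> \<Omega>"
  proof
    fix z assume "z \<in> S'"
    then obtain x y where "z = x + y" "x \<in> S" "norm y \<le> \<delta>" by (auto simp: S'_def)
    then have "z \<in> cball x \<rho>" using \<delta>(2) by (simp add: dist_norm)
    then show "z \<in> \<Omega>" using \<rho>(2) \<open>x \<in> S\<close> by blast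
  qed
  have supp: "{x. \<phi> x \<noteq> 0} \<subseteq> S'"
  proof
    fix x assume "x \<in> {x. \<phi> x \<noteq> 0}"
    then have "\<exists>y. \<psi> y * g (x - y) \<noteq> 0"
      unfolding \<phi>_def conv_def by (metis (mono_tags, lifting) integral_0 mem_Collect_eq integral_cong)
    then obtain y where "\<psi> y \<noteq> 0" "g (x - y) \<noteq> 0" by auto
    then have "y \<in> S" "norm (x - y) < \<delta>" using S(3) g(3) not_le by blast+
    then have "y + (x - y) \<in> S'"
      unfolding S'_def mem_Collect_eq by (intro exI[of _ y] exI[of _ "x - y"]) simp
    then show "x \<in> S'" by simp
  qed
  have cl: "closure {x. \<phi> x \<noteq> 0} \<subseteq> S'"
    using supp S' by (intro closure_minimal) (auto intro: compact_imp_closed)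
  have "compact (closure {x. \<phi> x \<noteq> 0})"
    using cl S' by (meson closed_closure compact_imp_bounded bounded_subset compact_eq_bounded_closed)
  then have test: "test_function \<Omega> \<phi>"
    using cl \<open>S' \<subseteq> \<Omega>\<close> smooth by (auto simp: test_function_def smooth_iff)
  have close: "\<bar>\<phi> x - \<psi> x\<bar> \<le> e" for x
    unfolding \<phi>_def using d(2) \<delta>(3) by (intro conv_close[OF \<psi> \<psi>0 cg g(2-5)]) auto
  have close_partial: "\<bar>partial i \<phi> x - partial i \<psi> x\<bar> \<le> e"
    if diff: "\<forall>x. \<psi> differentiable (at x)" and cp: "\<forall>i. continuous_on UNIV (partial i \<psi>)" for i x
  proof -
    \<comment> \<open>Integrating the derivative of this product in \<open>y\<close> to zero moves
      the derivative from the kernel to \<psi>; the sign changes twice, by parts and through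
      \<open>x - y\<close>.\<close>
    let ?f = "\<lambda>y. \<psi> y * g (x - y)"
    have df: "(?f has_derivative (\<lambda>h. \<psi> y * (grad g (x - y) \<bullet> (- h)) + (grad \<psi> y \<bullet> h) * g (x - y))) (at y)" for y
    proof (rule has_derivative_mult)
      show "(\<psi> has_derivative (\<bullet>) (grad \<psi> y)) (at y)" using diff by (intro has_derivative_grad) auto
      have "((\<lambda>y. x - y) has_derivative (\<lambda>h. - h)) (at y)" by (auto intro!: derivative_eq_intros)
      from has_derivative_compose[OF this has_derivative_grad[OF smooth_differentiable[OF g(1)]]]
      show "((\<lambda>y. g (x - y)) has_derivative (\<lambda>h. grad g (x - y) \<bullet> (- h))) (at y)" .
    qed
    have pf: "partial i ?f = (\<lambda>y. partial i \<psi> y * g (x - y) - \<psi> y * partial i g (x - y))"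
      using partial_eq[OF df] by (auto simp: inner_axis inner_diff_right)
    have "(LINT y|lborel. partial i ?f y) = 0"
    proof (rule integral_partial_zero[OF _ _ S(1)])
      show "?f differentiable at y" for y using df by (auto simp: differentiable_def)
      show "continuous_on UNIV (partial i ?f)"
        unfolding pf by (intro continuous_intros cp[rule_format] \<psi> continuous_on_compose2[OF cg] continuous_on_compose2[OF cpg]) auto
      show "\<psi> y * g (x - y) = 0" if "y \<notin> S" for y using S(3) that by simp
    qed
    moreover have p\<psi>0: "y \<notin> cbox a b \<Longrightarrow> partial i \<psi> y = 0" for y using p0 ab by blast
    moreover have "conv a b (partial i \<psi>) g x = (LINT y|lborel. partial i \<psi> y * g (x - y))"
      "integrable lborel (\<lambda>y. partial i \<psi> y * g (x - y))"
      using cp p\<psi>0 cg by (auto intro!: conv_eq_lborel)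
    moreover have "conv a b \<psi> (partial i g) x = (LINT y|lborel. \<psi> y * partial i g (x - y))"
      "integrable lborel (\<lambda>y. \<psi> y * partial i g (x - y))"
      using \<psi> \<psi>0 cpg by (auto intro!: conv_eq_lborel)
    ultimately have "conv a b (partial i \<psi>) g x = conv a b \<psi> (partial i g) x"
      unfolding pf by simp
    moreover have "partial i \<phi> x = conv a b \<psi> (partial i g) x"
      unfolding \<phi>_def using \<psi> g(1) by (intro conv_step) (auto intro: continuous_on_subset)
    moreover have "\<bar>conv a b (partial i \<psi>) g x - partial i \<psi> x\<bar> \<le> e"
      using d'(2) \<delta>(4)[of i] cp by (intro conv_close[OF cp[rule_format] p\<psi>0 cg g(2-5)]) auto
    ultimately show ?thesis by simp
  qed
  show ?thesis using test close close_partial by blast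
qed

section \<open>Sobolev functions on a bounded domain\<close>

locale bounded_domain =
  fixes \<Omega> :: "(real^'n::finite) set"
  assumes open_\<Omega>: "open \<Omega>" and bounded_\<Omega>: "bounded \<Omega>"
begin

abbreviation "N \<equiv> lebesgue_on \<Omega>"

lemma lmeasurable_\<Omega>: "\<Omega> \<in> lmeasurable"
  using open_\<Omega> bounded_\<Omega> by (intro bounded_set_imp_lmeasurable) auto

lemma sets_\<Omega> [simp]: "\<Omega> \<in> sets lebesgue"
  using lmeasurable_\<Omega> by (rule fmeasurableD)

sublocale N: finite_measure N
  using lmeasurable_\<Omega> by (simp add: finite_measure_lebesgue_on)

lemma set_integral_eq: "(LINT x:\<Omega>|lebesgue. F x) = (LINT x|N. F x)"
  for F :: "_ \<Rightarrow> 'b::{banach, second_countable_topology}"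
  by (simp add: set_lebesgue_integral_def integral_restrict_space)

lemma set_integrable_eq: "set_integrable lebesgue \<Omega> F \<longleftrightarrow> integrable N F"
  for F :: "_ \<Rightarrow> 'b::{banach, second_countable_topology}"
  by (simp add: set_integrable_def integrable_restrict_space)

lemma set_measurable_eq: "set_borel_measurable lebesgue \<Omega> F \<longleftrightarrow> F \<in> borel_measurable N"
  for F :: "_ \<Rightarrow> 'b::real_normed_vector"
  by (simp add: set_borel_measurable_def borel_measurable_restrict_space_iff)

lemma AE_eq: "(AE x in lebesgue. x \<in> \<Omega> \<longrightarrow> P x) \<longleftrightarrow> (AE x in N. P x)"
  by (simp add: AE_restrict_space_iff)

lemma continuous_measurable: "continuous_on \<Omega> h \<Longrightarrow> h \<in> borel_measurable N"
  for h :: "_ \<Rightarrow> 'b::euclidean_space"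
  by (intro continuous_imp_measurable_on_sets_lebesgue) auto

section \<open>Square-integrable functions\<close>

lemma L2_on_iff: "L2_on \<Omega> f \<longleftrightarrow> f \<in> borel_measurable N \<and> integrable N (\<lambda>x. (norm (f x))\<^sup>2)"
  by (simp add: L2_on_def set_measurable_eq set_integrable_eq)

lemma L2_measurable: "L2_on \<Omega> f \<Longrightarrow> f \<in> borel_measurable N"
  by (simp add: L2_on_iff)

lemmas integrable_add_N = Bochner_Integration.integrable_add[where M = N]

lemma L2_bounded:
  assumes f: "f \<in> borel_measurable N" and B: "AE x in N. norm (f x) \<le> B"
  shows "L2_on \<Omega> f"
  unfolding L2_on_iff
proof
  have "AE x in N. norm ((norm (f x))\<^sup>2) \<le> B\<^sup>2"
    using B by eventually_elim (simp add: power_mono)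
  then show "integrable N (\<lambda>x. (norm (f x))\<^sup>2)"
    using f by (intro N.integrable_const_bound[where B="B\<^sup>2"]) auto
qed (rule f)

lemma L2_inner:
  assumes "L2_on \<Omega> f" "L2_on \<Omega> g"
  shows "integrable N (\<lambda>x. f x \<bullet> g x)"
proof (rule Bochner_Integration.integrable_bound)
  show "integrable N (\<lambda>x. (norm (f x))\<^sup>2 + (norm (g x))\<^sup>2)"
    using assms by (auto simp: L2_on_iff)
  show "(\<lambda>x. f x \<bullet> g x) \<in> borel_measurable N"
    using assms by (auto simp: L2_on_iff)
  show "AE x in N. norm (f x \<bullet> g x) \<le> norm ((norm (f x))\<^sup>2 + (norm (g x))\<^sup>2)"
  proof (rule AE_I2)
    fix x
    have "\<bar>f x \<bullet> g x\<bar> \<le> norm (f x) * norm (g x)" by (rule Cauchy_Schwarz_ineq2)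
    also have "\<dots> \<le> (norm (f x))\<^sup>2 + (norm (g x))\<^sup>2"
    proof -
      have "2 * (norm (f x) * norm (g x)) \<le> (norm (f x))\<^sup>2 + (norm (g x))\<^sup>2"
        using sum_squares_bound[of "norm (f x)" "norm (g x)"] by (simp add: mult.assoc)
      moreover have "0 \<le> norm (f x) * norm (g x)" by simp
      ultimately show ?thesis by linarith
    qed
    finally show "norm (f x \<bullet> g x) \<le> norm ((norm (f x))\<^sup>2 + (norm (g x))\<^sup>2)" by simp
  qed
qed

lemma L2_mult: "L2_on \<Omega> f \<Longrightarrow> L2_on \<Omega> g \<Longrightarrow> integrable N (\<lambda>x. f x * g x)" for f :: "_ \<Rightarrow> real"
  using L2_inner[of f g] by simp

lemma L2_const: "L2_on \<Omega> (\<lambda>x. c)"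
  by (rule L2_bounded[where B="norm c"]) auto

lemma L2_norm: "L2_on \<Omega> f \<Longrightarrow> L2_on \<Omega> (\<lambda>x. norm (f x))"
  by (auto simp: L2_on_iff)

lemma L2_integrable_norm: "L2_on \<Omega> f \<Longrightarrow> integrable N (\<lambda>x. norm (f x))"
  using L2_mult[OF L2_norm L2_const[of 1]] by simp

lemma L2_integrable: "L2_on \<Omega> f \<Longrightarrow> integrable N f"
proof -
  assume f: "L2_on \<Omega> f"
  show ?thesis using L2_integrable_norm[OF f] integrable_norm_iff[OF L2_measurable[OF f]] by simp
qed

lemma L2_scale_bounded:
  assumes f: "L2_on \<Omega> f" and b: "b \<in> borel_measurable N" "\<And>x. x \<in> \<Omega> \<Longrightarrow> \<bar>b x\<bar> \<le> B"
  shows "L2_on \<Omega> (\<lambda>x. b x *\<^sub>R f x)"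
  unfolding L2_on_iff
proof
  show "(\<lambda>x. b x *\<^sub>R f x) \<in> borel_measurable N" using f b by (auto simp: L2_on_iff)
  then have m: "(\<lambda>x. (norm (b x *\<^sub>R f x))\<^sup>2) \<in> borel_measurable N" by measurable
  show "integrable N (\<lambda>x. (norm (b x *\<^sub>R f x))\<^sup>2)"
  proof (rule Bochner_Integration.integrable_bound[OF _ m])
    show "integrable N (\<lambda>x. B\<^sup>2 * (norm (f x))\<^sup>2)" using f by (auto simp: L2_on_iff)
    show "AE x in N. norm ((norm (b x *\<^sub>R f x))\<^sup>2) \<le> norm (B\<^sup>2 * (norm (f x))\<^sup>2)"
    proof (rule AE_I2)
      fix x assume "x \<in> space N"
      then have "(b x)\<^sup>2 \<le> B\<^sup>2" using b(2)[of x] abs_le_square_iff[of "b x" B] by simp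
      then show "norm ((norm (b x *\<^sub>R f x))\<^sup>2) \<le> norm (B\<^sup>2 * (norm (f x))\<^sup>2)"
        by (simp add: power_mult_distrib mult_right_mono)
    qed
  qed
qed

lemma L2_scale: "L2_on \<Omega> f \<Longrightarrow> L2_on \<Omega> (\<lambda>x. c *\<^sub>R f x)"
  by (rule L2_scale_bounded[where B="\<bar>c\<bar>"]) auto

lemma L2_add:
  assumes "L2_on \<Omega> f" "L2_on \<Omega> g"
  shows "L2_on \<Omega> (\<lambda>x. f x + g x)"
  unfolding L2_on_iff
proof
  show m: "(\<lambda>x. f x + g x) \<in> borel_measurable N" using assms by (auto simp: L2_on_iff)
  have "(\<lambda>x. (norm (f x + g x))\<^sup>2) = (\<lambda>x. (norm (f x))\<^sup>2 + 2 * (f x \<bullet> g x) + (norm (g x))\<^sup>2)"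
    by (auto simp: power2_norm_eq_inner inner_add_left inner_add_right inner_commute)
  then show "integrable N (\<lambda>x. (norm (f x + g x))\<^sup>2)"
    using assms L2_inner[OF assms] by (simp add: L2_on_iff)
qed

lemma L2_diff: "L2_on \<Omega> f \<Longrightarrow> L2_on \<Omega> g \<Longrightarrow> L2_on \<Omega> (\<lambda>x. f x - g x)"
  using L2_add[of f "\<lambda>x. (-1) *\<^sub>R g x"] L2_scale[of g "-1"] by simp

lemma L2_component: "L2_on \<Omega> f \<Longrightarrow> L2_on \<Omega> (\<lambda>x. f x $ i)" for f :: "_ \<Rightarrow> real^'m::finite"
proof -
  assume f: "L2_on \<Omega> f"
  show ?thesis unfolding L2_on_iff
  proof
    have "(\<lambda>x. f x \<bullet> axis i 1) \<in> borel_measurable N" using f by (auto simp: L2_on_iff)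
    then show m: "(\<lambda>x. f x $ i) \<in> borel_measurable N" by (simp add: inner_axis)
    show "integrable N (\<lambda>x. (norm (f x $ i))\<^sup>2)"
    proof (rule Bochner_Integration.integrable_bound)
      show "integrable N (\<lambda>x. (norm (f x))\<^sup>2)" using f by (auto simp: L2_on_iff)
      show "AE x in N. norm ((norm (f x $ i))\<^sup>2) \<le> norm ((norm (f x))\<^sup>2)"
        by (rule AE_I2) (simp add: abs_le_square_iff[symmetric] component_le_norm_cart)
    qed (use m in measurable)
  qed
qed

lemma L2_Cauchy_Schwarz:
  assumes f: "L2_on \<Omega> f" and g: "L2_on \<Omega> g"
  shows "\<bar>LINT x|N. f x \<bullet> g x\<bar> \<le> sqrt (LINT x|N. (norm (f x))\<^sup>2) * sqrt (LINT x|N. (norm (g x))\<^sup>2)"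
proof -
  define a b c where "a = (LINT x|N. (norm (f x))\<^sup>2)" and "b = (LINT x|N. f x \<bullet> g x)"
    and "c = (LINT x|N. (norm (g x))\<^sup>2)"
  have nonneg: "0 \<le> a" "0 \<le> c" by (auto simp: a_def c_def)
  have quad: "0 \<le> a + 2 * t * b + t\<^sup>2 * c" for t
  proof -
    have "0 \<le> (LINT x|N. (norm (f x + t *\<^sub>R g x))\<^sup>2)" by simp
    also have "(\<lambda>x. (norm (f x + t *\<^sub>R g x))\<^sup>2)
        = (\<lambda>x. (norm (f x))\<^sup>2 + 2 * t * (f x \<bullet> g x) + t\<^sup>2 * (norm (g x))\<^sup>2)"
      by (auto simp: power2_norm_eq_inner inner_add_left inner_add_right inner_commute power2_eq_square[of t])
    also have "(LINT x|N. \<dots> x) = a + 2 * t * b + t\<^sup>2 * c"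
      using f g L2_inner[OF f g] by (simp add: a_def b_def c_def L2_on_iff)
    finally show ?thesis .
  qed
  have "b\<^sup>2 \<le> a * c"
  proof (cases "c = 0")
    case True
    have "b = 0"
    proof (rule ccontr)
      assume "b \<noteq> 0"
      \<comment> \<open>With \<open>c = 0\<close> this value of the parameter makes the quadratic
        expression equal to -1.\<close>
      then show False using quad[of "- (a + 1) / (2 * b)"] True by (simp add: field_simps)
    qed
    then show ?thesis using True by simp
  next
    case False
    then have "0 < c" using nonneg by simp
    then show ?thesis using quad[of "- b / c"]
      by (simp add: field_simps power2_eq_square)
  qed
  then have "sqrt (b\<^sup>2) \<le> sqrt (a * c)" by (rule real_sqrt_le_mono)
  then show ?thesis by (simp add: real_sqrt_mult a_def b_def c_def)
qed

lemma integral_gradient_cong: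
  fixes q w :: "real^'n \<Rightarrow> real"
  assumes "AE x in N. Z x = Z' x" "L2_on \<Omega> Z" "L2_on \<Omega> Z'" "L2_on \<Omega> p" "L2_on \<Omega> q" "L2_on \<Omega> w"
  shows "(LINT x|N. Z x \<bullet> p x + q x * w x) = (LINT x|N. Z' x \<bullet> p x + q x * w x)"
proof (rule integral_cong_AE)
  show "(\<lambda>x. Z x \<bullet> p x + q x * w x) \<in> borel_measurable N" "(\<lambda>x. Z' x \<bullet> p x + q x * w x) \<in> borel_measurable N"
    by (rule borel_measurable_integrable, intro integrable_add_N L2_inner L2_mult assms)+
  show "AE x in N. Z x \<bullet> p x + q x * w x = Z' x \<bullet> p x + q x * w x"
    using assms(1) by eventually_elim simp
qed

lemma L2_tendsto_inner:
  assumes f: "\<And>n. L2_on \<Omega> (f n)" "L2_on \<Omega> f0" and g: "L2_on \<Omega> g"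
    and lim: "(\<lambda>n. LINT x|N. (norm (f n x - f0 x))\<^sup>2) \<longlonglongrightarrow> 0"
  shows "(\<lambda>n. LINT x|N. f n x \<bullet> g x) \<longlonglongrightarrow> (LINT x|N. f0 x \<bullet> g x)"
proof (rule Lim_null[THEN iffD2], rule Lim_null_comparison)
  let ?C = "sqrt (LINT x|N. (norm (g x))\<^sup>2)"
  show "\<forall>\<^sub>F n in sequentially. norm ((LINT x|N. f n x \<bullet> g x) - (LINT x|N. f0 x \<bullet> g x))
      \<le> sqrt (LINT x|N. (norm (f n x - f0 x))\<^sup>2) * ?C"
  proof (intro always_eventually allI)
    fix n
    have "(LINT x|N. f n x \<bullet> g x) - (LINT x|N. f0 x \<bullet> g x) = (LINT x|N. (f n x - f0 x) \<bullet> g x)"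
      using L2_inner[OF f(1) g] L2_inner[OF f(2) g] by (simp add: inner_diff_left)
    then show "norm ((LINT x|N. f n x \<bullet> g x) - (LINT x|N. f0 x \<bullet> g x))
      \<le> sqrt (LINT x|N. (norm (f n x - f0 x))\<^sup>2) * ?C"
      using L2_Cauchy_Schwarz[OF L2_diff[OF f(1) f(2)] g] by simp
  qed
  have "(\<lambda>n. sqrt (LINT x|N. (norm (f n x - f0 x))\<^sup>2) * ?C) \<longlonglongrightarrow> sqrt 0 * ?C"
    by (intro tendsto_intros lim)
  then show "(\<lambda>n. sqrt (LINT x|N. (norm (f n x - f0 x))\<^sup>2) * ?C) \<longlonglongrightarrow> 0" by simp
qed

lemma test_function_facts:
  assumes "test_function \<Omega> \<phi>"
  shows "smooth \<phi>" and "compact (closure {x. \<phi> x \<noteq> 0})" "closure {x. \<phi> x \<noteq> 0} \<subseteq> \<Omega>"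
    and "\<And>x. x \<notin> closure {x. \<phi> x \<noteq> 0} \<Longrightarrow> \<phi> x = 0"
  using assms closure_subset[of "{x. \<phi> x \<noteq> 0}"] by (auto simp: test_function_def smooth_iff)

lemma supported_bounded_measurable:
  fixes h :: "real^'n \<Rightarrow> real"
  assumes "compact S" "continuous_on UNIV h" "\<And>x. x \<notin> S \<Longrightarrow> h x = 0"
  shows "h \<in> borel_measurable N" "\<exists>B. \<forall>x. \<bar>h x\<bar> \<le> B" "L2_on \<Omega> h"
proof -
  show m: "h \<in> borel_measurable N" using assms(2) by (intro continuous_measurable) (auto intro: continuous_on_subset)
  obtain B where B: "\<And>x. \<bar>h x\<bar> \<le> B"
    using bounded_supported[OF assms(1) continuous_on_subset[OF assms(2) subset_UNIV] assms(3)] by metis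
  then show "\<exists>B. \<forall>x. \<bar>h x\<bar> \<le> B" by blast
  show "L2_on \<Omega> h" using B by (intro L2_bounded[OF m]) auto
qed

lemma L2_vec:
  fixes G :: "real^'n \<Rightarrow> real^'n"
  assumes "\<And>i. L2_on \<Omega> (\<lambda>x. G x $ i)"
  shows "L2_on \<Omega> G"
proof -
  have eq: "G = (\<lambda>x. \<Sum>i\<in>UNIV. (G x $ i) *\<^sub>R axis i 1)"
  proof
    fix x show "G x = (\<Sum>i\<in>UNIV. (G x $ i) *\<^sub>R axis i 1)"
      using basis_expansion[of "G x"] by (simp add: scalar_mult_eq_scaleR)
  qed
  have one: "L2_on \<Omega> (\<lambda>x. (G x $ i) *\<^sub>R axis i 1 :: real^'n)" for i
  proof -
    have "(norm ((G x $ i) *\<^sub>R axis i 1 :: real^'n))\<^sup>2 = (norm (G x $ i))\<^sup>2" for x by simp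
    then show ?thesis using assms[of i] by (auto simp: L2_on_iff)
  qed
  have fin: "L2_on \<Omega> (\<lambda>x. \<Sum>i\<in>I. (G x $ i) *\<^sub>R axis i 1 :: real^'n)" if "finite I" for I
    using that
  proof (induction I rule: finite_induct)
    case empty
    show ?case using L2_const[of "0 :: real^'n"] by simp
  next
    case (insert i I)
    show ?case using L2_add[OF one[of i] insert.IH] insert.hyps by simp
  qed
  show ?thesis by (subst eq) (rule fin, simp)
qed

lemma test_function_L2:
  assumes "test_function \<Omega> \<phi>"
  shows "L2_on \<Omega> \<phi>" "L2_on \<Omega> (partial i \<phi>)" "L2_on \<Omega> (grad \<phi>)"
proof -
  note t = test_function_facts[OF assms]
  show "L2_on \<Omega> \<phi>" by (rule supported_bounded_measurable(3)[OF t(2) smooth_continuous[OF t(1)] t(4)])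
  have p: "L2_on \<Omega> (partial i \<phi>)" for i
  proof (rule supported_bounded_measurable(3)[OF t(2)])
    show "continuous_on UNIV (partial i \<phi>)" using t(1) by (intro smooth_continuous smooth_partial)
    show "partial i \<phi> x = 0" if "x \<notin> closure {x. \<phi> x \<noteq> 0}" for x
      by (rule partial_zero_outside[OF closed_closure t(4) that])
  qed
  show "L2_on \<Omega> (partial i \<phi>)" by (rule p)
  show "L2_on \<Omega> (grad \<phi>)" by (rule L2_vec) (simp add: p)
qed

section \<open>The fundamental lemma of the calculus of variations\<close>

text \<open>The indicator of \<open>T\<close> is a pointwise limit of continuous cutoffs between 0
  and 1, and each cutoff is a uniform limit of test functions. Uniform convergence suffices against
  an integrable \<open>f\<close>; dominated convergence settles the outer limit.\<close>

lemma compact_integral_zero: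
  fixes f :: "real^'n \<Rightarrow> real"
  assumes f: "integrable N f" and zero: "\<And>\<phi>. test_function \<Omega> \<phi> \<Longrightarrow> (LINT x|N. \<phi> x * f x) = 0"
    and T: "compact T" "T \<subseteq> \<Omega>" "T \<noteq> {}"
  shows "(LINT x|N. indicator T x * f x) = 0"
proof -
  obtain r where r: "0 < r" "(\<Union>x\<in>T. cball x r) \<subseteq> \<Omega>"
    using compact_subset_open_imp_cball_epsilon_subset[OF T(1) open_\<Omega> T(2)] by blast
  define S where "S = {x. infdist x T \<le> r}"
  have "closed S" unfolding S_def by (intro closed_Collect_le continuous_intros)
  have S\<Omega>: "S \<subseteq> \<Omega>"
  proof
    fix x assume "x \<in> S"
    moreover obtain y where "y \<in> T" "infdist x T = dist x y"
      using infdist_attains_inf[OF compact_imp_closed[OF T(1)] T(3)] by blast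
    ultimately have "y \<in> T" "x \<in> cball y r" by (auto simp: S_def dist_commute)
    then show "x \<in> \<Omega>" using r(2) by blast
  qed
  then have "compact S"
    using \<open>closed S\<close> bounded_subset[OF bounded_\<Omega>] by (simp add: compact_eq_bounded_closed)
  \<comment> \<open>Equal to 1 on \<open>T\<close>, decreasing linearly with the distance from
    \<open>T\<close>, and 0 from distance r/(n+1) on. All these cutoffs are supported in the fixed
    compact set \<open>S\<close>.\<close>
  define \<psi> where "\<psi> n x = max 0 (1 - real (Suc n) / r * infdist x T)" for n x
  have cont: "continuous_on UNIV (\<psi> n)" for n
    unfolding \<psi>_def by (intro continuous_intros)
  have \<psi>1: "\<bar>\<psi> n x\<bar> \<le> 1" for n x
    using infdist_nonneg[of x T] r(1) by (auto simp: \<psi>_def)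
  have S0: "\<psi> n x = 0" if "x \<notin> S" for n x
  proof -
    have "1 * r \<le> real (Suc n) * infdist x T" using that r(1) by (intro mult_mono) (auto simp: S_def)
    then show ?thesis using r(1) by (simp add: \<psi>_def divide_simps)
  qed
  have mint: "integrable N (\<lambda>x. h x * f x)" if "continuous_on UNIV h" "\<And>x. \<bar>h x\<bar> \<le> B" for h B
  proof (rule Bochner_Integration.integrable_bound[of _ "\<lambda>x. B * f x"])
    show "(\<lambda>x. h x * f x) \<in> borel_measurable N"
      using f continuous_measurable[OF continuous_on_subset[OF that(1)]] by auto
    have "\<bar>h x\<bar> * \<bar>f x\<bar> \<le> \<bar>B\<bar> * \<bar>f x\<bar>" for x using that(2)[of x] by (intro mult_right_mono) auto
    then show "AE x in N. norm (h x * f x) \<le> norm (B * f x)" by (auto simp: abs_mult)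
  qed (use f in auto)
  have psi0: "(LINT x|N. \<psi> n x * f x) = 0" for n
  proof -
    have le: "\<bar>LINT x|N. \<psi> n x * f x\<bar> \<le> e * (LINT x|N. \<bar>f x\<bar>)" if e: "0 < e" for e
    proof -
      obtain \<phi> where \<phi>: "test_function \<Omega> \<phi>" "\<And>x. \<bar>\<phi> x - \<psi> n x\<bar> \<le> e"
        using test_function_approx[OF open_\<Omega> \<open>compact S\<close> S\<Omega> S0 cont e] by blast
      have i2: "integrable N (\<lambda>x. \<psi> n x * f x)" by (rule mint[OF cont \<psi>1])
      have c\<phi>: "continuous_on UNIV \<phi>" using test_function_facts(1)[OF \<phi>(1)] by (rule smooth_continuous)
      have "\<bar>\<phi> x\<bar> \<le> 1 + e" for x using \<psi>1[of n x] \<phi>(2)[of x] by linarith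
      then have i1: "integrable N (\<lambda>x. \<phi> x * f x)" by (rule mint[OF c\<phi>])
      have "\<bar>LINT x|N. \<psi> n x * f x\<bar> = \<bar>LINT x|N. \<psi> n x * f x - \<phi> x * f x\<bar>"
        using i1 i2 zero[OF \<phi>(1)] by simp
      also have "\<dots> \<le> (LINT x|N. \<bar>\<psi> n x * f x - \<phi> x * f x\<bar>)" by (rule integral_abs_bound)
      also have "\<dots> \<le> (LINT x|N. e * \<bar>f x\<bar>)"
      proof (rule integral_mono)
        fix x
        have "\<bar>\<psi> n x * f x - \<phi> x * f x\<bar> = \<bar>\<phi> x - \<psi> n x\<bar> * \<bar>f x\<bar>"
          by (simp add: abs_mult[symmetric] left_diff_distrib abs_minus_commute)
        also have "\<dots> \<le> e * \<bar>f x\<bar>" using \<phi>(2)[of x] by (intro mult_right_mono) auto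
        finally show "\<bar>\<psi> n x * f x - \<phi> x * f x\<bar> \<le> e * \<bar>f x\<bar>" .
      qed (use i1 i2 f in auto)
      finally show ?thesis by simp
    qed
    have "\<bar>LINT x|N. \<psi> n x * f x\<bar> \<le> 0"
      by (rule nonpos_if_le_all_multiples[OF le])
    then show ?thesis by simp
  qed
  have "(\<lambda>n. LINT x|N. \<psi> n x * f x) \<longlonglongrightarrow> (LINT x|N. indicator T x * f x)"
  proof (rule integral_dominated_convergence[where w = "\<lambda>x. \<bar>f x\<bar>"])
    have "T \<in> sets N" using T by (auto simp: sets_restrict_space_iff compact_imp_closed)
    then show "(\<lambda>x. indicator T x * f x) \<in> borel_measurable N" using f by measurable
    show "(\<lambda>x. \<psi> n x * f x) \<in> borel_measurable N" for n
      using mint[OF cont \<psi>1] by (rule borel_measurable_integrable)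
    show "AE x in N. (\<lambda>n. \<psi> n x * f x) \<longlonglongrightarrow> indicator T x * f x"
    proof (rule AE_I2, rule tendsto_mult_right)
      fix x
      show "(\<lambda>n. \<psi> n x) \<longlonglongrightarrow> indicator T x"
      proof (cases "x \<in> T")
        case True
        then show ?thesis using infdist_zero[of x T] by (simp add: \<psi>_def)
      next
        case False
        then have "0 < infdist x T"
          using infdist_nonneg[of x T] in_closed_iff_infdist_zero[OF compact_imp_closed[OF T(1)] T(3)]
          by (metis less_le)
        then obtain k where k: "r < real k * infdist x T" using reals_Archimedean3 by blast
        have "\<psi> n x = 0" if "k \<le> n" for n
        proof -
          have "real k * infdist x T \<le> real (Suc n) * infdist x T"
            using that by (intro mult_right_mono infdist_nonneg) auto
          then show ?thesis using k r(1) by (simp add: \<psi>_def divide_simps)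
        qed
        then have "\<forall>\<^sub>F n in sequentially. \<psi> n x = indicator T x"
          using False by (auto simp: eventually_sequentially intro!: exI[of _ k])
        then show ?thesis by (rule tendsto_eventually)
      qed
    qed
    show "AE x in N. norm (\<psi> n x * f x) \<le> \<bar>f x\<bar>" for n
      using \<psi>1 by (intro AE_I2) (simp add: abs_mult mult_left_le_one_le)
  qed (use f in auto)
  then show ?thesis unfolding psi0 by (simp add: LIMSEQ_const_iff)
qed

text \<open>By inner regularity the set where \<open>f\<close> is positive is filled, up to
  arbitrarily small measure, by compact sets. On such a set the integral of \<open>f\<close> is 0
  although \<open>f\<close> is positive there, so the set is null.\<close>

lemma AE_nonpos_if_test_integrals_zero:
  fixes f :: "real^'n \<Rightarrow> real"
  assumes f: "integrable N f" and zero: "\<And>\<phi>. test_function \<Omega> \<phi> \<Longrightarrow> (LINT x|N. \<phi> x * f x) = 0"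
  shows "AE x in N. f x \<le> 0"
proof -
  define P where "P = {x \<in> \<Omega>. 0 < f x}"
  have "{x \<in> space N. 0 < f x} \<in> sets N" using f by measurable
  then have P: "P \<in> sets lebesgue" by (simp add: P_def sets_restrict_space_iff)
  have small: "emeasure lebesgue P < ennreal e" if e: "0 < e" for e
  proof -
    obtain T where T: "closed T" "T \<subseteq> P" "P - T \<in> lmeasurable" "emeasure lebesgue (P - T) < ennreal e"
      using sets_lebesgue_inner_closed[OF P e] by blast
    have T\<Omega>: "T \<subseteq> \<Omega>" using T(2) by (auto simp: P_def)
    have "compact T" using T(1) bounded_subset[OF bounded_\<Omega> T\<Omega>] by (simp add: compact_eq_bounded_closed)
    have TN: "T \<in> sets N" using T(1) T\<Omega> by (auto simp: sets_restrict_space_iff)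
    have i: "integrable N (\<lambda>x. indicator T x * f x)"
      using integrable_mult_indicator[OF TN f] by simp
    have nn: "AE x in N. 0 \<le> indicator T x * f x"
      using T(2) by (intro AE_I2) (auto simp: indicator_def P_def)
    have "(LINT x|N. indicator T x * f x) = 0"
    proof (cases "T = {}")
      case False
      then show ?thesis by (intro compact_integral_zero f zero \<open>compact T\<close> T\<Omega>)
    qed simp
    then have "AE x in N. indicator T x * f x = 0"
      using integral_nonneg_eq_0_iff_AE[OF i nn] by simp
    then have "AE x in N. x \<notin> T"
      by (rule eventually_mono) (use T(2) in \<open>auto simp: indicator_def P_def split: if_splits\<close>)
    then have "AE x in lebesgue. x \<in> \<Omega> \<longrightarrow> x \<notin> T" by (simp add: AE_eq)
    then have "AE x in lebesgue. x \<notin> T"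
      by (rule eventually_mono) (use T\<Omega> in auto)
    moreover have "T \<in> sets lebesgue" using T(1) by auto
    ultimately have T0: "T \<in> null_sets lebesgue" by (simp add: AE_iff_null_sets)
    have "emeasure lebesgue P = emeasure lebesgue ((P - T) \<union> T)" using T(2) by (simp add: Un_absorb2)
    also have "\<dots> = emeasure lebesgue (P - T)"
      using T0 T(3) by (intro emeasure_Un_null_set) (auto simp: fmeasurableD)
    finally show ?thesis using T(4) by simp
  qed
  have "emeasure lebesgue P = 0"
  proof (rule ccontr)
    assume "emeasure lebesgue P \<noteq> 0"
    moreover have fin: "emeasure lebesgue P < \<infinity>" using small[of 1] by (auto intro: less_trans)
    ultimately have "0 < measure lebesgue P"
      by (simp add: measure_def enn2real_positive_iff zero_less_iff_neq_zero)
    \<comment> \<open>With the measure of \<open>P\<close> itself as the tolerance,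
      \<open>small\<close> says that this measure is less than itself.\<close>
    from small[OF this] show False using fin by (simp add: emeasure_eq_ennreal_measure)
  qed
  then have "AE x in lebesgue. x \<notin> P" using P by (simp add: AE_iff_null_sets[symmetric] null_sets_def)
  then have "AE x in lebesgue. x \<in> \<Omega> \<longrightarrow> f x \<le> 0"
    by (rule eventually_mono) (auto simp: P_def)
  then show ?thesis by (simp add: AE_eq)
qed

lemma AE_zero_if_test_integrals_zero:
  fixes f :: "real^'n \<Rightarrow> real"
  assumes f: "integrable N f" and zero: "\<And>\<phi>. test_function \<Omega> \<phi> \<Longrightarrow> (LINT x|N. \<phi> x * f x) = 0"
  shows "AE x in N. f x = 0"
proof -
  have "AE x in N. f x \<le> 0" by (rule AE_nonpos_if_test_integrals_zero[OF f zero])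
  moreover have "AE x in N. - f x \<le> 0"
    by (rule AE_nonpos_if_test_integrals_zero) (use f zero in auto)
  ultimately show ?thesis by eventually_elim auto
qed

section \<open>Weak gradients\<close>

lemma is_weak_gradient_iff:
  "is_weak_gradient \<Omega> w G \<longleftrightarrow> (\<forall>\<phi> i. test_function \<Omega> \<phi> \<longrightarrow>
     (LINT x|N. w x * partial i \<phi> x) = - (LINT x|N. (G x $ i) * \<phi> x))"
  by (simp add: is_weak_gradient_def set_integral_eq)

lemma weak_gradient_unique:
  assumes G: "is_weak_gradient \<Omega> w G" "L2_on \<Omega> G" and G': "is_weak_gradient \<Omega> w G'" "L2_on \<Omega> G'"
  shows "AE x in N. G x = G' x"
proof -
  have "AE x in N. G x $ i - G' x $ i = 0" for i
  proof (rule AE_zero_if_test_integrals_zero)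
    note L = L2_component[OF G(2), of i] L2_component[OF G'(2), of i]
    show "integrable N (\<lambda>x. G x $ i - G' x $ i)"
      using L by (intro L2_integrable L2_diff)
    fix \<phi> assume \<phi>: "test_function \<Omega> \<phi>"
    have "(LINT x|N. \<phi> x * (G x $ i - G' x $ i)) = (LINT x|N. (G x $ i) * \<phi> x) - (LINT x|N. (G' x $ i) * \<phi> x)"
      using L2_mult[OF L(1) test_function_L2(1)[OF \<phi>]] L2_mult[OF L(2) test_function_L2(1)[OF \<phi>]]
      by (simp add: algebra_simps)
    also have "\<dots> = 0"
    proof -
      have "(LINT x|N. w x * partial i \<phi> x) = - (LINT x|N. (G x $ i) * \<phi> x)"
        using G(1) \<phi> unfolding is_weak_gradient_iff by blast
      moreover have "(LINT x|N. w x * partial i \<phi> x) = - (LINT x|N. (G' x $ i) * \<phi> x)"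
        using G'(1) \<phi> unfolding is_weak_gradient_iff by blast
      ultimately show ?thesis by simp
    qed
    finally show "(LINT x|N. \<phi> x * (G x $ i - G' x $ i)) = 0" .
  qed
  then have "AE x in N. \<forall>i\<in>UNIV. G x $ i - G' x $ i = 0"
    by (intro AE_finite_allI) auto
  then show ?thesis by (rule eventually_mono) (auto simp: vec_eq_iff)
qed

lemma weak_gradient_lin:
  assumes w: "L2_on \<Omega> w" "L2_on \<Omega> G" "is_weak_gradient \<Omega> w G"
    and w': "L2_on \<Omega> w'" "L2_on \<Omega> G'" "is_weak_gradient \<Omega> w' G'"
  shows "is_weak_gradient \<Omega> (\<lambda>x. w x + t * w' x) (\<lambda>x. G x + t *\<^sub>R G' x)"
  unfolding is_weak_gradient_iff
proof (intro allI impI)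
  fix \<phi> i assume \<phi>: "test_function \<Omega> \<phi>"
  note T = test_function_L2[OF \<phi>]
  have "(LINT x|N. (w x + t * w' x) * partial i \<phi> x) = (LINT x|N. w x * partial i \<phi> x) + t * (LINT x|N. w' x * partial i \<phi> x)"
    using L2_mult[OF w(1) T(2)] L2_mult[OF w'(1) T(2)] by (simp add: distrib_right mult.assoc)
  also have "\<dots> = - ((LINT x|N. (G x $ i) * \<phi> x) + t * (LINT x|N. (G' x $ i) * \<phi> x))"
    using w(3) w'(3) \<phi> unfolding is_weak_gradient_iff by simp
  also have "(LINT x|N. (G x $ i) * \<phi> x) + t * (LINT x|N. (G' x $ i) * \<phi> x) = (LINT x|N. ((G x + t *\<^sub>R G' x) $ i) * \<phi> x)"
    using L2_mult[OF L2_component[OF w(2)] T(1)] L2_mult[OF L2_component[OF w'(2)] T(1)]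
    by (simp add: distrib_right mult.assoc)
  finally show "(LINT x|N. (w x + t * w' x) * partial i \<phi> x) = - (LINT x|N. ((G x + t *\<^sub>R G' x) $ i) * \<phi> x)" .
qed

text \<open>The product of \<open>u\<close> with a test function, extended by 0, is continuously
  differentiable on the whole plane or space, whatever \<open>u\<close> does outside \<Omega>. Its
  partial derivatives have integral 0, and the product rule gives the claim.\<close>

lemma C1_weak_gradient:
  assumes diff: "\<And>x. x \<in> \<Omega> \<Longrightarrow> u differentiable (at x)" and cont: "\<And>i. continuous_on \<Omega> (partial i u)"
  shows "is_weak_gradient \<Omega> u (grad u)"
  unfolding is_weak_gradient_iff
proof (intro allI impI)
  fix \<phi> i assume \<phi>: "test_function \<Omega> \<phi>"
  note t = test_function_facts[OF \<phi>]
  define S where "S = closure {x. \<phi> x \<noteq> 0}"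
  have S: "compact S" "S \<subseteq> \<Omega>" "\<And>x. x \<notin> S \<Longrightarrow> \<phi> x = 0" "closed S"
    unfolding S_def using t(2,3,4) closed_closure by blast+
  define f where "f x = u x * \<phi> x" for x
  have f0: "f x = 0" if "x \<notin> S" for x using S(3) that by (simp add: f_def)
  have p\<phi>: "partial i \<phi> x = 0" if "x \<notin> S" for x using partial_zero_outside[OF S(4,3) that] .
  have pf0: "partial i f x = 0" if "x \<notin> S" for x using partial_zero_outside[OF S(4) f0 that] .
  have df: "(f has_derivative (\<lambda>h. u x * (grad \<phi> x \<bullet> h) + (grad u x \<bullet> h) * \<phi> x)) (at x)" if "x \<in> \<Omega>" for x
    unfolding f_def using diff[OF that] smooth_differentiable[OF t(1)]
    by (intro has_derivative_mult has_derivative_grad) auto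
  have pf: "partial i f x = u x * partial i \<phi> x + partial i u x * \<phi> x" if "x \<in> \<Omega>" for x
    using partial_eq[OF df[OF that]] by (simp add: inner_axis)
  have fdiff: "f differentiable (at x)" for x
    by (rule differentiable_supported[OF S(4) _ f0]) (use df S(2) in \<open>auto simp: differentiable_def\<close>)
  have cu: "continuous_on \<Omega> u"
    by (auto intro!: continuous_at_imp_continuous_on differentiable_imp_continuous_within diff)
  have c\<phi>: "continuous_on \<Omega> \<phi>" "continuous_on \<Omega> (partial i \<phi>)"
    using t(1) by (auto intro: smooth_continuous smooth_partial)
  note glue = continuous_on_UNIV_supported[OF open_\<Omega> S(4,2)]
  have c1: "continuous_on UNIV (\<lambda>x. u x * partial i \<phi> x)"
    using cu c\<phi> p\<phi> by (intro glue continuous_intros) auto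
  have c2: "continuous_on UNIV (\<lambda>x. partial i u x * \<phi> x)"
    using cont c\<phi> S(3) by (intro glue continuous_intros) auto
  have pf': "partial i f = (\<lambda>x. u x * partial i \<phi> x + partial i u x * \<phi> x)"
  proof
    fix x show "partial i f x = u x * partial i \<phi> x + partial i u x * \<phi> x"
      using pf pf0 p\<phi> S by (cases "x \<in> S") auto
  qed
  have i1: "integrable lborel (\<lambda>x. u x * partial i \<phi> x)"
    using p\<phi> continuous_on_subset[OF c1] by (intro integrable_lborel_supported[OF S(1)]) auto
  have i2: "integrable lborel (\<lambda>x. partial i u x * \<phi> x)"
    using S(3) continuous_on_subset[OF c2] by (intro integrable_lborel_supported[OF S(1)]) auto
  have "(LINT x|lborel. partial i f x) = 0"
    using fdiff S f0 continuous_on_add[OF c1 c2] by (intro integral_partial_zero[OF _ _ S(1)]) (auto simp: pf')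
  then have "(LINT x|lborel. u x * partial i \<phi> x) = - (LINT x|lborel. partial i u x * \<phi> x)"
    unfolding pf' using i1 i2 by simp
  moreover have eq: "(LINT x|lborel. g x) = (LINT x|N. g x)" if "continuous_on UNIV g" "\<And>x. x \<notin> S \<Longrightarrow> g x = 0" for g :: "real^'n \<Rightarrow> real"
  proof -
    have "(LINT x|lborel. g x) = (LINT x|lebesgue. g x)"
      using borel_measurable_continuous_onI[OF that(1)] by (intro integral_completion[symmetric]) auto
    also have "\<dots> = (LINT x|lebesgue. indicator \<Omega> x *\<^sub>R g x)"
      using that(2) S(2) by (intro Bochner_Integration.integral_cong) (auto simp: indicator_def)
    finally show ?thesis by (simp add: integral_restrict_space)
  qed
  ultimately show "(LINT x|N. u x * partial i \<phi> x) = - (LINT x|N. (grad u x $ i) * \<phi> x)"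
    using eq[OF c1] eq[OF c2] p\<phi> S(3) by simp
qed

end

lemma partial_lin:
  fixes f g :: "real^'n::finite \<Rightarrow> real"
  assumes "f differentiable (at x)" "g differentiable (at x)"
  shows "partial i (\<lambda>x. f x + t * g x) x = partial i f x + t * partial i g x"
proof -
  have "((\<lambda>x. f x + t * g x) has_derivative (\<lambda>h. grad f x \<bullet> h + t * (grad g x \<bullet> h))) (at x)"
    using assms by (intro has_derivative_add has_derivative_mult_right has_derivative_grad)
  from partial_eq[OF this] show ?thesis by (simp add: inner_axis)
qed

lemma smooth_lin:
  assumes "smooth f" "smooth g"
  shows "smooth (\<lambda>x. f x + t * g x)"
proof -
  have d: "foldr partial is f differentiable (at x)" "foldr partial is g differentiable (at x)" for "is" x
    using assms by (auto simp: smooth_def)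
  have "foldr partial is (\<lambda>x. f x + t * g x) = (\<lambda>x. foldr partial is f x + t * foldr partial is g x)" for "is"
    by (induction "is") (auto simp: partial_lin d intro!: ext)
  then show ?thesis
    using d by (auto simp: smooth_def intro!: differentiable_add differentiable_mult)
qed

lemma grad_lin:
  assumes "f differentiable (at x)" "g differentiable (at x)"
  shows "grad (\<lambda>x. f x + t * g x) x = grad f x + t *\<^sub>R grad g x"
  by (simp add: vec_eq_iff partial_lin assms)

context bounded_domain begin

section \<open>The spaces \<open>H1\<close> and \<open>H10\<close>\<close>

lemma H1_wgrad:
  assumes "w \<in> H1 \<Omega>"
  shows "L2_on \<Omega> w" "L2_on \<Omega> (wgrad \<Omega> w)" "is_weak_gradient \<Omega> w (wgrad \<Omega> w)"
proof -
  from assms show "L2_on \<Omega> w" by (simp add: H1_def)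
  from assms have "\<exists>G. L2_on \<Omega> G \<and> is_weak_gradient \<Omega> w G" by (simp add: H1_def)
  from someI_ex[OF this] show "L2_on \<Omega> (wgrad \<Omega> w)" "is_weak_gradient \<Omega> w (wgrad \<Omega> w)"
    by (auto simp: wgrad_def)
qed

lemma wgrad_unique:
  assumes "L2_on \<Omega> w" "L2_on \<Omega> G" "is_weak_gradient \<Omega> w G"
  shows "w \<in> H1 \<Omega>" "AE x in N. wgrad \<Omega> w x = G x"
proof -
  show H: "w \<in> H1 \<Omega>" using assms by (auto simp: H1_def)
  show "AE x in N. wgrad \<Omega> w x = G x"
    by (rule weak_gradient_unique[OF H1_wgrad(3,2)[OF H] assms(3,2)])
qed

text \<open>\<open>wgrad\<close> is a choice among representatives, so it is linear only almost
  everywhere, by uniqueness of weak gradients.\<close>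

lemma wgrad_lin:
  assumes "w \<in> H1 \<Omega>" "w' \<in> H1 \<Omega>"
  shows "(\<lambda>x. w x + t * w' x) \<in> H1 \<Omega>"
    and "AE x in N. wgrad \<Omega> (\<lambda>x. w x + t * w' x) x = wgrad \<Omega> w x + t *\<^sub>R wgrad \<Omega> w' x"
proof -
  note h = H1_wgrad[OF assms(1)] and h' = H1_wgrad[OF assms(2)]
  have "L2_on \<Omega> (\<lambda>x. w x + t * w' x)" using L2_add[OF h(1) L2_scale[OF h'(1)]] by simp
  from wgrad_unique[OF this L2_add[OF h(2) L2_scale[OF h'(2)]] weak_gradient_lin[OF h h']]
  show "(\<lambda>x. w x + t * w' x) \<in> H1 \<Omega>"
    "AE x in N. wgrad \<Omega> (\<lambda>x. w x + t * w' x) x = wgrad \<Omega> w x + t *\<^sub>R wgrad \<Omega> w' x" .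
qed

lemma test_function_wgrad:
  assumes "test_function \<Omega> \<phi>"
  shows "\<phi> \<in> H1 \<Omega>" "AE x in N. wgrad \<Omega> \<phi> x = grad \<phi> x"
proof -
  note t = test_function_facts(1)[OF assms]
  have "is_weak_gradient \<Omega> \<phi> (grad \<phi>)"
    using t by (intro C1_weak_gradient smooth_differentiable smooth_continuous smooth_partial)
  from wgrad_unique[OF test_function_L2(1,3)[OF assms] this]
  show "\<phi> \<in> H1 \<Omega>" "AE x in N. wgrad \<Omega> \<phi> x = grad \<phi> x" .
qed

lemma test_function_lin:
  assumes "test_function \<Omega> \<phi>" "test_function \<Omega> \<psi>"
  shows "test_function \<Omega> (\<lambda>x. \<phi> x + t * \<psi> x)"
proof -
  note t = test_function_facts[OF assms(1)] and t' = test_function_facts[OF assms(2)]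
  let ?S = "closure {x. \<phi> x \<noteq> 0} \<union> closure {x. \<psi> x \<noteq> 0}"
  have "{x. \<phi> x + t * \<psi> x \<noteq> 0} \<subseteq> {x. \<phi> x \<noteq> 0} \<union> {x. \<psi> x \<noteq> 0}" by auto
  then have "closure {x. \<phi> x + t * \<psi> x \<noteq> 0} \<subseteq> ?S"
    unfolding closure_Un[symmetric] by (rule closure_mono)
  moreover have "compact ?S" "?S \<subseteq> \<Omega>" using t(2,3) t'(2,3) by auto
  ultimately have "compact (closure {x. \<phi> x + t * \<psi> x \<noteq> 0})" "closure {x. \<phi> x + t * \<psi> x \<noteq> 0} \<subseteq> \<Omega>"
    by (meson closed_closure compact_imp_bounded bounded_subset compact_eq_bounded_closed, blast)
  then show ?thesis
    using smooth_lin[OF t(1) t'(1)] by (simp add: test_function_def smooth_iff)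
qed

text \<open>Convergence of functions and of gradients, stated separately. This matches the single
  limit in \<open>H10\<close> because both integrands are integrable, so the integral splits, and
  nonnegative, so each part is squeezed by the sum.\<close>

definition H1_approx :: "(nat \<Rightarrow> real^'n \<Rightarrow> real) \<Rightarrow> (real^'n \<Rightarrow> real) \<Rightarrow> bool" where
  "H1_approx \<phi> w \<longleftrightarrow> (\<forall>n. test_function \<Omega> (\<phi> n)) \<and>
     (\<lambda>n. LINT x|N. (\<phi> n x - w x)\<^sup>2) \<longlonglongrightarrow> 0 \<and>
     (\<lambda>n. LINT x|N. (norm (grad (\<phi> n) x - wgrad \<Omega> w x))\<^sup>2) \<longlonglongrightarrow> 0"

lemma H10_iff: "w \<in> H10 \<Omega> \<longleftrightarrow> w \<in> H1 \<Omega> \<and> (\<exists>\<phi>. H1_approx \<phi> w)"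
proof -
  have "(\<lambda>n. LINT x:\<Omega>|lebesgue. (\<phi> n x - w x)\<^sup>2 + (norm (grad (\<phi> n) x - wgrad \<Omega> w x))\<^sup>2) \<longlonglongrightarrow> 0
     \<longleftrightarrow> (\<lambda>n. LINT x|N. (\<phi> n x - w x)\<^sup>2) \<longlonglongrightarrow> 0 \<and>
         (\<lambda>n. LINT x|N. (norm (grad (\<phi> n) x - wgrad \<Omega> w x))\<^sup>2) \<longlonglongrightarrow> 0"
    (is "?A \<longlonglongrightarrow> 0 \<longleftrightarrow> ?B \<longlonglongrightarrow> 0 \<and> ?C \<longlonglongrightarrow> 0")
    if w: "w \<in> H1 \<Omega>" and \<phi>: "\<And>n. test_function \<Omega> (\<phi> n)" for \<phi> :: "nat \<Rightarrow> real^'n \<Rightarrow> real"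
  proof -
    have i: "integrable N (\<lambda>x. (\<phi> n x - w x)\<^sup>2)" "integrable N (\<lambda>x. (norm (grad (\<phi> n) x - wgrad \<Omega> w x))\<^sup>2)" for n
      using L2_diff[OF test_function_L2(1)[OF \<phi>] H1_wgrad(1)[OF w], of n]
        L2_diff[OF test_function_L2(3)[OF \<phi>] H1_wgrad(2)[OF w], of n]
      by (auto simp: L2_on_iff)
    have A: "?A n = ?B n + ?C n" for n using i[of n] by (simp add: set_integral_eq)
    have nn: "0 \<le> ?B n" "0 \<le> ?C n" for n by auto
    show ?thesis
    proof
      assume lim: "?A \<longlonglongrightarrow> 0"
      have "?B \<longlonglongrightarrow> 0" by (rule tendsto_sandwich[OF _ _ tendsto_const lim]) (use nn A in auto)
      moreover have "?C \<longlonglongrightarrow> 0" by (rule tendsto_sandwich[OF _ _ tendsto_const lim]) (use nn A in auto)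
      ultimately show "?B \<longlonglongrightarrow> 0 \<and> ?C \<longlonglongrightarrow> 0" ..
    next
      assume "?B \<longlonglongrightarrow> 0 \<and> ?C \<longlonglongrightarrow> 0"
      then have "(\<lambda>n. ?B n + ?C n) \<longlonglongrightarrow> 0 + 0" by (intro tendsto_add) auto
      then show "?A \<longlonglongrightarrow> 0" unfolding A by simp
    qed
  qed
  then show ?thesis unfolding H10_def H1_approx_def by blast
qed

text \<open>Extends a weak equation with fixed square-integrable coefficients from test functions to
  all of \<open>H10\<close>.\<close>

lemma H1_approx_tendsto:
  assumes w: "w \<in> H1 \<Omega>" and \<phi>: "H1_approx \<phi> w" and A: "L2_on \<Omega> A" and B: "L2_on \<Omega> B"
  shows "(\<lambda>n. LINT x|N. grad (\<phi> n) x \<bullet> A x + B x * \<phi> n x) \<longlonglongrightarrow> (LINT x|N. wgrad \<Omega> w x \<bullet> A x + B x * w x)"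
proof -
  note h = H1_wgrad[OF w]
  have t: "test_function \<Omega> (\<phi> n)" for n using \<phi> by (simp add: H1_approx_def)
  have 1: "(\<lambda>n. LINT x|N. grad (\<phi> n) x \<bullet> A x) \<longlonglongrightarrow> (LINT x|N. wgrad \<Omega> w x \<bullet> A x)"
    using \<phi> by (intro L2_tendsto_inner[OF test_function_L2(3)[OF t] h(2) A]) (simp add: H1_approx_def)
  have 2: "(\<lambda>n. LINT x|N. \<phi> n x \<bullet> B x) \<longlonglongrightarrow> (LINT x|N. w x \<bullet> B x)"
    using \<phi> by (intro L2_tendsto_inner[OF test_function_L2(1)[OF t] h(1) B]) (simp add: H1_approx_def)
  have eq: "(LINT x|N. g x \<bullet> A x + B x * r x) = (LINT x|N. g x \<bullet> A x) + (LINT x|N. r x \<bullet> B x)"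
    if "L2_on \<Omega> g" "L2_on \<Omega> r" for g and r :: "real^'n \<Rightarrow> real"
    using L2_inner[OF that(1) A] L2_inner[OF that(2) B] by (simp add: mult.commute)
  show ?thesis
    using tendsto_add[OF 1 2] unfolding eq[OF test_function_L2(3,1)[OF t]] eq[OF h(2,1)] by simp
qed

text \<open>The parallelogram identity, with the square of the difference dropped.\<close>

lemma integral_square_sum_le:
  assumes "L2_on \<Omega> f" "L2_on \<Omega> g"
  shows "(LINT x|N. (norm (f x + t *\<^sub>R g x))\<^sup>2) \<le> 2 * (LINT x|N. (norm (f x))\<^sup>2) + 2 * t\<^sup>2 * (LINT x|N. (norm (g x))\<^sup>2)"
proof -
  have "(LINT x|N. (norm (f x + t *\<^sub>R g x))\<^sup>2) \<le> (LINT x|N. 2 * (norm (f x))\<^sup>2 + 2 * t\<^sup>2 * (norm (g x))\<^sup>2)"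
  proof (rule integral_mono)
    show "integrable N (\<lambda>x. (norm (f x + t *\<^sub>R g x))\<^sup>2)"
      using L2_add[OF assms(1) L2_scale[OF assms(2)]] by (auto simp: L2_on_iff)
    show "integrable N (\<lambda>x. 2 * (norm (f x))\<^sup>2 + 2 * t\<^sup>2 * (norm (g x))\<^sup>2)"
      using assms by (auto simp: L2_on_iff)
    fix x
    have "(norm (f x + t *\<^sub>R g x))\<^sup>2 + (norm (f x - t *\<^sub>R g x))\<^sup>2 = 2 * (norm (f x))\<^sup>2 + 2 * t\<^sup>2 * (norm (g x))\<^sup>2"
      by (simp add: power2_norm_eq_inner inner_add_left inner_add_right inner_diff_left inner_diff_right
          inner_commute power2_eq_square[of t] algebra_simps)
    moreover have "0 \<le> (norm (f x - t *\<^sub>R g x))\<^sup>2" by simp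
    ultimately show "(norm (f x + t *\<^sub>R g x))\<^sup>2 \<le> 2 * (norm (f x))\<^sup>2 + 2 * t\<^sup>2 * (norm (g x))\<^sup>2" by linarith
  qed
  also have "\<dots> = 2 * (LINT x|N. (norm (f x))\<^sup>2) + 2 * t\<^sup>2 * (LINT x|N. (norm (g x))\<^sup>2)"
    using assms by (simp add: L2_on_iff)
  finally show ?thesis .
qed

lemma H10_lin:
  assumes "w \<in> H10 \<Omega>" "w' \<in> H10 \<Omega>"
  shows "(\<lambda>x. w x + t * w' x) \<in> H10 \<Omega>"
proof -
  from assms obtain \<phi> \<phi>' where w: "w \<in> H1 \<Omega>" "H1_approx \<phi> w" and w': "w' \<in> H1 \<Omega>" "H1_approx \<phi>' w'"
    by (auto simp: H10_iff)
  note h = H1_wgrad[OF w(1)] and h' = H1_wgrad[OF w'(1)]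
  have t: "test_function \<Omega> (\<phi> n)" and t': "test_function \<Omega> (\<phi>' n)" for n
    using w w' by (auto simp: H1_approx_def)
  let ?\<psi> = "\<lambda>n x. \<phi> n x + t * \<phi>' n x" and ?w = "\<lambda>x. w x + t * w' x"
  have sq: "(\<lambda>n. LINT x|N. (norm (f n x + t *\<^sub>R f' n x))\<^sup>2) \<longlonglongrightarrow> 0"
    if L: "\<And>n. L2_on \<Omega> (f n)" "\<And>n. L2_on \<Omega> (f' n)"
      and lim: "(\<lambda>n. LINT x|N. (norm (f n x))\<^sup>2) \<longlonglongrightarrow> 0" "(\<lambda>n. LINT x|N. (norm (f' n x))\<^sup>2) \<longlonglongrightarrow> 0"
    for f f' :: "nat \<Rightarrow> real^'n \<Rightarrow> 'b::euclidean_space"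
  proof (rule tendsto_sandwich[OF _ _ tendsto_const])
    show "\<forall>\<^sub>F n in sequentially. (LINT x|N. (norm (f n x + t *\<^sub>R f' n x))\<^sup>2)
      \<le> 2 * (LINT x|N. (norm (f n x))\<^sup>2) + 2 * t\<^sup>2 * (LINT x|N. (norm (f' n x))\<^sup>2)"
      using integral_square_sum_le[OF L] by simp
    have "(\<lambda>n. 2 * (LINT x|N. (norm (f n x))\<^sup>2) + 2 * t\<^sup>2 * (LINT x|N. (norm (f' n x))\<^sup>2)) \<longlonglongrightarrow> 2 * 0 + 2 * t\<^sup>2 * 0"
      by (intro tendsto_intros lim)
    then show "(\<lambda>n. 2 * (LINT x|N. (norm (f n x))\<^sup>2) + 2 * t\<^sup>2 * (LINT x|N. (norm (f' n x))\<^sup>2)) \<longlonglongrightarrow> 0" by simp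
  qed simp
  define d d' where "d n x = \<phi> n x - w x" and "d' n x = \<phi>' n x - w' x" for n x
  define D D' where "D n x = grad (\<phi> n) x - wgrad \<Omega> w x" and "D' n x = grad (\<phi>' n) x - wgrad \<Omega> w' x" for n x
  have L: "L2_on \<Omega> (d n)" "L2_on \<Omega> (d' n)" "L2_on \<Omega> (D n)" "L2_on \<Omega> (D' n)" for n
    unfolding d_def d'_def D_def D'_def by (intro L2_diff test_function_L2 t t' h h')+
  have lim: "(\<lambda>n. LINT x|N. (norm (d n x))\<^sup>2) \<longlonglongrightarrow> 0" "(\<lambda>n. LINT x|N. (norm (d' n x))\<^sup>2) \<longlonglongrightarrow> 0"
    "(\<lambda>n. LINT x|N. (norm (D n x))\<^sup>2) \<longlonglongrightarrow> 0" "(\<lambda>n. LINT x|N. (norm (D' n x))\<^sup>2) \<longlonglongrightarrow> 0"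
    using w(2) w'(2) by (simp_all add: H1_approx_def d_def d'_def D_def D'_def)
  have "(\<lambda>n. LINT x|N. (norm (d n x + t *\<^sub>R d' n x))\<^sup>2) \<longlonglongrightarrow> 0"
    by (rule sq[OF L(1,2) lim(1,2)])
  then have "(\<lambda>n. LINT x|N. (?\<psi> n x - ?w x)\<^sup>2) \<longlonglongrightarrow> 0"
    by (simp add: d_def d'_def algebra_simps)
  moreover have "(\<lambda>n. LINT x|N. (norm (D n x + t *\<^sub>R D' n x))\<^sup>2) \<longlonglongrightarrow> 0"
    by (rule sq[OF L(3,4) lim(3,4)])
  moreover have "(LINT x|N. (norm (grad (?\<psi> n) x - wgrad \<Omega> ?w x))\<^sup>2) = (LINT x|N. (norm (D n x + t *\<^sub>R D' n x))\<^sup>2)" for n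
  proof (rule integral_cong_AE)
    have meas: "L2_on \<Omega> f \<Longrightarrow> (\<lambda>x. (norm (f x))\<^sup>2) \<in> borel_measurable N" for f :: "real^'n \<Rightarrow> real^'n"
      unfolding L2_on_iff by (blast dest: borel_measurable_integrable)
    show "(\<lambda>x. (norm (grad (?\<psi> n) x - wgrad \<Omega> ?w x))\<^sup>2) \<in> borel_measurable N"
      by (rule meas, rule L2_diff[OF test_function_L2(3)[OF test_function_lin[OF t t']]
          H1_wgrad(2)[OF wgrad_lin(1)[OF w(1) w'(1)]]])
    show "(\<lambda>x. (norm (D n x + t *\<^sub>R D' n x))\<^sup>2) \<in> borel_measurable N"
      by (rule meas, rule L2_add[OF L(3) L2_scale[OF L(4)]])
    show "AE x in N. (norm (grad (?\<psi> n) x - wgrad \<Omega> ?w x))\<^sup>2 = (norm (D n x + t *\<^sub>R D' n x))\<^sup>2"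
      using wgrad_lin(2)[OF w(1) w'(1), of t]
    proof eventually_elim
      case (elim x)
      have "grad (?\<psi> n) x = grad (\<phi> n) x + t *\<^sub>R grad (\<phi>' n) x"
        using test_function_facts(1)[OF t] test_function_facts(1)[OF t'] by (intro grad_lin smooth_differentiable) auto
      then show ?case unfolding elim by (simp add: D_def D'_def algebra_simps)
    qed
  qed
  ultimately have "H1_approx ?\<psi> ?w"
    using test_function_lin[OF t t'] by (simp add: H1_approx_def)
  then show ?thesis using wgrad_lin(1)[OF w(1) w'(1)] by (auto simp: H10_iff)
qed

lemma test_function_H10:
  assumes \<phi>: "test_function \<Omega> \<phi>"
  shows "\<phi> \<in> H10 \<Omega>"
proof -
  have "(LINT x|N. (norm (grad \<phi> x - wgrad \<Omega> \<phi> x))\<^sup>2) = 0"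
  proof -
    have "(LINT x|N. (norm (grad \<phi> x - wgrad \<Omega> \<phi> x))\<^sup>2) = (LINT x|N. 0)"
      using test_function_wgrad[OF \<phi>] L2_measurable[OF test_function_L2(3)[OF \<phi>]]
        L2_measurable[OF H1_wgrad(2)[OF test_function_wgrad(1)[OF \<phi>]]]
      by (intro integral_cong_AE) auto
    then show ?thesis by simp
  qed
  then have "H1_approx (\<lambda>n. \<phi>) \<phi>" using \<phi> by (simp add: H1_approx_def)
  then show ?thesis using test_function_wgrad(1)[OF \<phi>] by (auto simp: H10_iff)
qed

end

section \<open>The flux of an admissible function\<close>

text \<open>The inequality 2xy \<le> x^2 + y^2 for the two norms, divided by twice the norm of
  \<open>p\<close>. It is the first-order expansion of the norm with an explicit remainder; an upper
  bound is the side that minimality calls for.\<close>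

lemma norm_add_le_quadratic:
  fixes p q :: "'a::real_inner"
  assumes "p \<noteq> 0"
  shows "norm (p + t *\<^sub>R q) \<le> norm p + t * (p \<bullet> q) / norm p + t\<^sup>2 * (norm q)\<^sup>2 / (2 * norm p)"
proof -
  have sq: "(norm (p + t *\<^sub>R q))\<^sup>2 = (norm p)\<^sup>2 + 2 * t * (p \<bullet> q) + t\<^sup>2 * (norm q)\<^sup>2"
    by (simp add: power2_norm_eq_inner inner_add_left inner_add_right inner_commute power2_eq_square[of t])
  have "2 * norm p * norm (p + t *\<^sub>R q) \<le> (norm p)\<^sup>2 + (norm (p + t *\<^sub>R q))\<^sup>2"
    by (rule sum_squares_bound)
  also have "\<dots> = 2 * norm p * (norm p + t * (p \<bullet> q) / norm p + t\<^sup>2 * (norm q)\<^sup>2 / (2 * norm p))"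
    unfolding sq using assms by (simp add: field_simps power2_eq_square)
  finally show ?thesis using assms by simp
qed

lemma linear_coefficient_zero:
  fixes A B :: real
  assumes "\<And>t. 0 \<le> t * A + t\<^sup>2 * B"
  shows "A = 0"
proof (rule ccontr)
  assume "A \<noteq> 0"
  define B' where "B' = \<bar>B\<bar> + 1"
  have B': "0 < B'" "B \<le> B'" by (auto simp: B'_def)
  \<comment> \<open>This \<open>t\<close> minimizes t * A + t^2 * B', where \<open>B'\<close> is a
    positive majorant of \<open>B\<close>, up to a factor 1/2 from the choice of scale: any small
    multiple of -A makes the linear term win.\<close>
  have "0 \<le> (- A / (2 * B')) * A + (- A / (2 * B'))\<^sup>2 * B" by (rule assms)
  also have "\<dots> \<le> (- A / (2 * B')) * A + (- A / (2 * B'))\<^sup>2 * B'"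
    using B' by (intro add_left_mono mult_left_mono) auto
  also have "\<dots> = - (A\<^sup>2 / (4 * B'))" using B' by (simp add: power2_eq_square field_simps)
  finally show False using \<open>A \<noteq> 0\<close> B' by (simp add: divide_le_0_iff zero_le_divide_iff)
qed

text \<open>One minimization problem with its bounds, to be instantiated for \<open>u\<close> and
  for \<open>ut\<close> with the same \<open>a\<close>, \<open>H\<close> and constants.
  \<open>S\<close> bounds the gradient of the coefficient.\<close>

locale flux_data = bounded_domain \<Omega> for \<Omega> :: "(real^2) set" +
  fixes \<sigma>\<^sub>0 \<sigma>\<^sub>1 m M k\<^sub>2 S :: real
    and a :: "real^2 \<Rightarrow> real" and F :: "real^2 \<Rightarrow> real^2" and H u \<sigma> :: "real^2 \<Rightarrow> real"
  assumes pos: "0 < m" "0 < \<sigma>\<^sub>0"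
    and a_meas: "a \<in> borel_measurable N" and a_bd: "AE x in N. m \<le> a x \<and> a x \<le> M"
    and adm: "admissible \<sigma>\<^sub>0 \<sigma>\<^sub>1 m M \<Omega> a F H u \<sigma>"
    and F_cont: "continuous_on \<Omega> F" and F_bd: "\<And>x. x \<in> \<Omega> \<Longrightarrow> norm (F x) \<le> k\<^sub>2"
    and H_cont: "continuous_on \<Omega> H" and H_bd: "\<And>x. x \<in> \<Omega> \<Longrightarrow> \<bar>H x\<bar> \<le> k\<^sub>2"
    and \<sigma>_diff: "\<And>x. x \<in> \<Omega> \<Longrightarrow> \<sigma> differentiable (at x)"
    and \<sigma>_cont: "\<And>i. continuous_on \<Omega> (partial i \<sigma>)"
    and \<sigma>_bd: "\<And>x. x \<in> \<Omega> \<Longrightarrow> norm (grad \<sigma> x) \<le> S"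
begin

definition Dv :: "real^2 \<Rightarrow> real^2" where "Dv x = grad u x + F x"
definition J :: "real^2 \<Rightarrow> real^2" where "J x = \<sigma> x *\<^sub>R Dv x"

lemma u_diff: "x \<in> \<Omega> \<Longrightarrow> u differentiable (at x)"
proof -
  assume "x \<in> \<Omega>"
  have "\<forall>is. length is < 1 \<longrightarrow> foldr partial is u differentiable_on \<Omega>"
    using adm by (auto simp: admissible_def Ck_closure_def Ck_on_def)
  from this[rule_format, of "[]"] have "u differentiable_on \<Omega>" by simp
  then show ?thesis
    using \<open>x \<in> \<Omega>\<close> open_\<Omega> by (simp add: differentiable_on_eq_differentiable_at)
qed

lemma partial_u_cont: "continuous_on \<Omega> (partial i u)"
proof -
  have "\<forall>is. length is \<le> 1 \<longrightarrow> continuous_on \<Omega> (foldr partial is u)"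
    using adm by (auto simp: admissible_def Ck_closure_def Ck_on_def)
  from this[rule_format, of "[i]"] show ?thesis by simp
qed

lemma grad_u_cont: "continuous_on \<Omega> (grad u)"
  unfolding grad_def by (intro continuous_intros partial_u_cont)

lemma grad_\<sigma>_cont: "continuous_on \<Omega> (grad \<sigma>)"
  unfolding grad_def by (intro continuous_intros \<sigma>_cont)

lemma \<sigma>_continuous: "continuous_on \<Omega> \<sigma>"
  using adm by (simp add: admissible_def Let_def)

lemma \<sigma>_range: "x \<in> \<Omega> \<Longrightarrow> \<sigma>\<^sub>0 \<le> \<sigma> x \<and> \<sigma> x \<le> \<sigma>\<^sub>1 \<and> 0 < \<sigma> x"
  using adm pos by (force simp: admissible_def Let_def)

lemma Dv_cont: "continuous_on \<Omega> Dv"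
  unfolding Dv_def by (intro continuous_intros grad_u_cont F_cont)

lemma J_cont: "continuous_on \<Omega> J"
  unfolding J_def by (intro continuous_intros \<sigma>_continuous Dv_cont)

lemma J_bd: "x \<in> \<Omega> \<Longrightarrow> m \<le> norm (J x) \<and> norm (J x) \<le> M"
  using adm by (simp add: admissible_def Let_def J_def Dv_def)

lemma Dv_J: "x \<in> \<Omega> \<Longrightarrow> Dv x = (1 / \<sigma> x) *\<^sub>R J x"
  using \<sigma>_range[of x] by (simp add: J_def)

lemma Dv_bd: assumes "x \<in> \<Omega>" shows "norm (Dv x) \<le> M / \<sigma>\<^sub>0" "m / \<sigma>\<^sub>1 \<le> norm (Dv x)" "0 < norm (Dv x)"
proof -
  note s = \<sigma>_range[OF assms] and j = J_bd[OF assms]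
  have eq: "norm (Dv x) = norm (J x) / \<sigma> x" using Dv_J[OF assms] s by simp
  show "norm (Dv x) \<le> M / \<sigma>\<^sub>0" unfolding eq using s j pos by (intro frac_le) auto
  show "m / \<sigma>\<^sub>1 \<le> norm (Dv x)" unfolding eq using s j pos by (intro frac_le) auto
  show "0 < norm (Dv x)" unfolding eq using s j pos by (intro divide_pos_pos) auto
qed

lemma grad_u_bd: assumes "x \<in> \<Omega>" shows "norm (grad u x) \<le> M / \<sigma>\<^sub>0 + k\<^sub>2"
  using norm_triangle_ineq4[of "Dv x" "F x"] Dv_bd(1)[OF assms] F_bd[OF assms] by (simp add: Dv_def)

lemma L2_cont:
  fixes h :: "real^2 \<Rightarrow> 'b::euclidean_space"
  assumes "continuous_on \<Omega> h" "\<And>x. x \<in> \<Omega> \<Longrightarrow> norm (h x) \<le> B"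
  shows "L2_on \<Omega> h"
  using assms by (intro L2_bounded[where B=B] continuous_measurable AE_I2) auto

lemma L2_facts: "L2_on \<Omega> (grad u)" "L2_on \<Omega> F" "L2_on \<Omega> H" "L2_on \<Omega> Dv" "L2_on \<Omega> J"
  using L2_cont[OF grad_u_cont grad_u_bd] L2_cont[OF F_cont F_bd] L2_cont[OF H_cont] H_bd
    L2_cont[OF Dv_cont Dv_bd(1)] L2_cont[OF J_cont] J_bd by auto

lemma u_H10: "u \<in> H10 \<Omega>"
  using adm by (simp add: admissible_def is_arg_min_def)

lemma u_H1: "u \<in> H1 \<Omega>"
  using u_H10 by (simp add: H10_iff)

lemma wgrad_u: "AE x in N. wgrad \<Omega> u x = grad u x"
  by (rule wgrad_unique(2)[OF H1_wgrad(1)[OF u_H1] L2_facts(1) C1_weak_gradient[OF u_diff partial_u_cont]])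

lemma J_dual: "dual_solution \<Omega> a F H J"
  using adm by (simp add: admissible_def Let_def J_def[abs_def] Dv_def)

lemma J_le_a: "AE x in N. norm (J x) \<le> a x"
  using J_dual by (simp add: dual_solution_def is_arg_max_def dual_feasible_def AE_eq)

lemma J_weak: "w \<in> H10 \<Omega> \<Longrightarrow> (LINT x|N. wgrad \<Omega> w x \<bullet> J x + H x * w x) = 0"
  using J_dual by (simp add: dual_solution_def is_arg_max_def dual_feasible_def set_integral_eq)

section \<open>First variation and the length of the flux\<close>

definition b :: "real^2 \<Rightarrow> real^2" where "b x = (a x / norm (Dv x)) *\<^sub>R Dv x"

lemma b_L2: "L2_on \<Omega> b"
proof (rule L2_bounded)
  have "Dv \<in> borel_measurable N" by (rule continuous_measurable[OF Dv_cont])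
  then show "b \<in> borel_measurable N" unfolding b_def using a_meas by measurable
  show "AE x in N. norm (b x) \<le> M"
    using a_bd AE_space by eventually_elim (use pos Dv_bd(3) in \<open>auto simp: b_def\<close>)
qed

lemma b_le_a: "AE x in N. norm (b x) \<le> a x"
  using a_bd AE_space by eventually_elim (use pos Dv_bd(3) in \<open>auto simp: b_def\<close>)

lemma L2_a_scale: "L2_on \<Omega> g \<Longrightarrow> integrable N (\<lambda>x. a x * norm (g x))"
proof -
  assume g: "L2_on \<Omega> g"
  have "AE x in N. norm (a x) \<le> M" using a_bd by eventually_elim (use pos in auto)
  from L2_mult[OF L2_bounded[OF a_meas this] L2_norm[OF g]] show ?thesis .
qed

text \<open>The Euler-Lagrange equation of \<open>u\<close>. Since the norm of \<open>Dv\<close> is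
  at least m/\<sigma>1 > 0, the norm expands with a quadratic remainder that is uniform in
  \<open>x\<close>, so minimality along \<open>u + t * w\<close> reads 0 \<le> t A + t^2 B for all
  \<open>t\<close>, where \<open>A\<close> is the asserted integral.\<close>

lemma b_weak:
  assumes w: "w \<in> H10 \<Omega>"
  shows "(LINT x|N. wgrad \<Omega> w x \<bullet> b x + H x * w x) = 0"
proof (rule linear_coefficient_zero)
  fix t
  define G where "G = wgrad \<Omega> w"
  have wH1: "w \<in> H1 \<Omega>" using w by (simp add: H10_iff)
  note h = H1_wgrad[OF wH1, folded G_def]
  let ?w = "\<lambda>x. u x + t * w x"
  define c where "c = m / \<sigma>\<^sub>1"
  let ?R = "\<lambda>x. (a x * norm (Dv x) + H x * u x) + t * (G x \<bullet> b x + H x * w x) + t\<^sup>2 * (M / (2 * c) * (norm (G x))\<^sup>2)"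
  define B where "B = (LINT x|N. M / (2 * c) * (norm (G x))\<^sup>2)"
  \<comment> \<open>The energy is written with the chosen representative \<open>wgrad\<close>; any
    other representative of the weak gradient may take its place.\<close>
  have energy: "energy \<Omega> a F H z = (LINT x|N. a x * norm (Z x + F x) + H x * z x)"
    if "AE x in N. wgrad \<Omega> z x = Z x" "L2_on \<Omega> z" "L2_on \<Omega> Z" "z \<in> H1 \<Omega>" for z Z
    unfolding energy_def set_integral_eq
  proof (rule integral_cong_AE)
    show "(\<lambda>x. a x * norm (wgrad \<Omega> z x + F x) + H x * z x) \<in> borel_measurable N"
      by (rule borel_measurable_integrable)
        (intro integrable_add_N L2_a_scale L2_add L2_mult H1_wgrad[OF that(4)] L2_facts that)
    show "(\<lambda>x. a x * norm (Z x + F x) + H x * z x) \<in> borel_measurable N"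
      by (rule borel_measurable_integrable)
        (intro integrable_add_N L2_a_scale L2_add L2_mult L2_facts that)
    show "AE x in N. a x * norm (wgrad \<Omega> z x + F x) + H x * z x = a x * norm (Z x + F x) + H x * z x"
      using that(1) by eventually_elim simp
  qed
  have wt: "?w \<in> H10 \<Omega>" by (rule H10_lin[OF u_H10 w])
  then have wtH1: "?w \<in> H1 \<Omega>" by (simp add: H10_iff)
  have AEwt: "AE x in N. wgrad \<Omega> ?w x = grad u x + t *\<^sub>R G x"
    using wgrad_lin(2)[OF u_H1 wH1, of t] wgrad_u by eventually_elim (simp add: G_def)
  have uL: "L2_on \<Omega> u" by (rule H1_wgrad(1)[OF u_H1])
  have Lt: "L2_on \<Omega> (\<lambda>x. grad u x + t *\<^sub>R G x)" by (intro L2_add L2_scale L2_facts h)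
  have i0: "integrable N (\<lambda>x. a x * norm (Dv x) + H x * u x)"
    by (intro integrable_add_N L2_a_scale L2_mult L2_facts uL)
  have i1: "integrable N (\<lambda>x. G x \<bullet> b x + H x * w x)"
    by (intro integrable_add_N L2_inner L2_mult b_L2 L2_facts h)
  have i2: "integrable N (\<lambda>x. M / (2 * c) * (norm (G x))\<^sup>2)" using h(2) by (simp add: L2_on_iff)
  have "(LINT x|N. a x * norm (Dv x) + H x * u x) = energy \<Omega> a F H u"
    using energy[OF wgrad_u uL L2_facts(1) u_H1] by (simp add: Dv_def)
  also have "\<dots> \<le> energy \<Omega> a F H ?w"
    using adm wt by (auto simp: admissible_def is_arg_min_def not_less)
  also have "\<dots> = (LINT x|N. a x * norm ((grad u x + t *\<^sub>R G x) + F x) + H x * ?w x)"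
    by (rule energy[OF AEwt H1_wgrad(1)[OF wtH1] Lt wtH1])
  also have "\<dots> \<le> (LINT x|N. ?R x)"
  proof (rule integral_mono_AE)
    show "integrable N (\<lambda>x. a x * norm ((grad u x + t *\<^sub>R G x) + F x) + H x * ?w x)"
      by (intro integrable_add_N L2_a_scale L2_mult L2_add[OF Lt] L2_facts H1_wgrad(1)[OF wtH1])
    show "integrable N ?R"
      by (intro integrable_add_N integrable_mult_right i0 i1 i2)
    show "AE x in N. a x * norm ((grad u x + t *\<^sub>R G x) + F x) + H x * ?w x \<le> ?R x"
      using a_bd AE_space
    proof eventually_elim
      case (elim x)
      then have x: "x \<in> \<Omega>" by simp
      have D: "c \<le> norm (Dv x)" "0 < norm (Dv x)" "Dv x \<noteq> 0"
        using Dv_bd[OF x] by (auto simp: c_def)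
      have "0 < \<sigma>\<^sub>1" using \<sigma>_range[OF x] by linarith
      then have c0: "0 < c" using pos by (simp add: c_def)
      have eq: "(grad u x + t *\<^sub>R G x) + F x = Dv x + t *\<^sub>R G x" by (simp add: Dv_def)
      have "a x * norm (Dv x + t *\<^sub>R G x)
        \<le> a x * (norm (Dv x) + t * (Dv x \<bullet> G x) / norm (Dv x) + t\<^sup>2 * (norm (G x))\<^sup>2 / (2 * norm (Dv x)))"
        using norm_add_le_quadratic[OF D(3)] elim pos by (intro mult_left_mono) auto
      also have "\<dots> = a x * norm (Dv x) + t * (G x \<bullet> b x) + t\<^sup>2 * (a x / (2 * norm (Dv x)) * (norm (G x))\<^sup>2)"
        by (simp add: b_def algebra_simps inner_commute)
      also have "\<dots> \<le> a x * norm (Dv x) + t * (G x \<bullet> b x) + t\<^sup>2 * (M / (2 * c) * (norm (G x))\<^sup>2)"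
        using elim pos D c0 by (intro add_left_mono mult_left_mono mult_right_mono frac_le) auto
      finally show ?case unfolding eq by (simp add: algebra_simps)
    qed
  qed
  also have "\<dots> = (LINT x|N. a x * norm (Dv x) + H x * u x) + t * (LINT x|N. G x \<bullet> b x + H x * w x) + t\<^sup>2 * B"
  proof -
    have "(LINT x|N. (f0 x + t * f1 x) + t\<^sup>2 * f2 x) = (LINT x|N. f0 x) + t * (LINT x|N. f1 x) + t\<^sup>2 * (LINT x|N. f2 x)"
      if "integrable N f0" "integrable N f1" "integrable N f2" for f0 f1 f2 :: "real^2 \<Rightarrow> real"
      using that by simp
    from this[OF i0 i1 i2] show ?thesis by (simp only: B_def)
  qed
  finally show "0 \<le> t * (LINT x|N. wgrad \<Omega> w x \<bullet> b x + H x * w x) + t\<^sup>2 * (LINT x|N. M / (2 * (m / \<sigma>\<^sub>1)) * (norm (wgrad \<Omega> w x))\<^sup>2)"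
    by (simp only: G_def B_def c_def)
qed

text \<open>Pointwise, \<open>b\<close> and \<open>J\<close> are nonnegative multiples of
  \<open>Dv\<close>, of lengths \<open>a\<close> and at most \<open>a\<close>, so
  \<open>Dv x \<bullet> b x\<close> is at least \<open>Dv x \<bullet> J x\<close>. Optimality of
  \<open>J\<close> gives the opposite inequality between the integrals, hence equality almost
  everywhere, and \<open>Dv\<close> does not vanish.\<close>

lemma J_norm: "AE x in N. norm (J x) = a x"
proof -
  have bf: "dual_feasible \<Omega> a H b"
    using b_L2 b_le_a b_weak by (auto simp: dual_feasible_def AE_eq set_integral_eq)
  then have le: "(LINT x|N. F x \<bullet> b x) \<le> (LINT x|N. F x \<bullet> J x)"
    using J_dual by (auto simp: dual_solution_def is_arg_max_def set_integral_eq not_less)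
  \<comment> \<open>Testing with \<open>u\<close> shows that for a feasible field the integrals
    against \<open>F\<close> and against \<open>Dv\<close> differ by a quantity independent of the
    field, so optimality can be stated with \<open>Dv\<close>.\<close>
  have split: "(LINT x|N. Dv x \<bullet> p x) = (LINT x|N. F x \<bullet> p x) - (LINT x|N. H x * u x)"
    if p: "L2_on \<Omega> p" and weak: "(LINT x|N. wgrad \<Omega> u x \<bullet> p x + H x * u x) = 0" for p
  proof -
    note uL = H1_wgrad(1)[OF u_H1]
    have i: "integrable N (\<lambda>x. grad u x \<bullet> p x)" "integrable N (\<lambda>x. H x * u x)" "integrable N (\<lambda>x. F x \<bullet> p x)"
      by (intro L2_inner L2_mult L2_facts p uL)+
    have "(LINT x|N. wgrad \<Omega> u x \<bullet> p x + H x * u x) = (LINT x|N. grad u x \<bullet> p x + H x * u x)"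
      by (rule integral_gradient_cong[OF wgrad_u H1_wgrad(2)[OF u_H1] L2_facts(1) p L2_facts(3) uL])
    then have "(LINT x|N. grad u x \<bullet> p x) = - (LINT x|N. H x * u x)" using weak i by simp
    then show ?thesis using i by (simp add: Dv_def inner_add_left)
  qed
  have le': "(LINT x|N. Dv x \<bullet> b x) \<le> (LINT x|N. Dv x \<bullet> J x)"
    using split[OF b_L2 b_weak[OF u_H10]] split[OF L2_facts(5) J_weak[OF u_H10]] le by simp
  have i: "integrable N (\<lambda>x. Dv x \<bullet> b x)" "integrable N (\<lambda>x. Dv x \<bullet> J x)"
    by (intro L2_inner L2_facts b_L2)+
  have eq: "AE x in N. Dv x \<bullet> b x - Dv x \<bullet> J x = (a x - norm (J x)) * norm (Dv x)"
    using AE_space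
  proof eventually_elim
    case (elim x)
    then have x: "x \<in> \<Omega>" by simp
    have "Dv x \<bullet> b x = a x * norm (Dv x)" using Dv_bd(3)[OF x]
      by (simp add: b_def power2_norm_eq_inner[symmetric] power2_eq_square)
    moreover have "Dv x \<bullet> J x = norm (J x) * norm (Dv x)" using \<sigma>_range[OF x]
      by (simp add: J_def power2_norm_eq_inner[symmetric] power2_eq_square)
    ultimately show ?case by (simp add: algebra_simps)
  qed
  have nn: "AE x in N. 0 \<le> Dv x \<bullet> b x - Dv x \<bullet> J x"
    using eq J_le_a by eventually_elim simp
  have "(LINT x|N. Dv x \<bullet> b x - Dv x \<bullet> J x) \<le> 0" using le' i by simp
  moreover have "0 \<le> (LINT x|N. Dv x \<bullet> b x - Dv x \<bullet> J x)" using nn by (rule integral_nonneg_AE)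
  ultimately have "(LINT x|N. Dv x \<bullet> b x - Dv x \<bullet> J x) = 0" by simp
  then have "AE x in N. Dv x \<bullet> b x - Dv x \<bullet> J x = 0"
    using integral_nonneg_eq_0_iff_AE[OF Bochner_Integration.integrable_diff[OF i] nn] by simp
  then show ?thesis using eq AE_space
  proof eventually_elim
    case (elim x)
    then have "x \<in> \<Omega>" by simp
    from Dv_bd(3)[OF this] elim show ?case by auto
  qed
qed

text \<open>Testing with \<open>\<phi> / \<sigma>\<close> shows that \<open>Dv\<close> itself has bounded divergence, which replaces any
  regularity theory for \<open>u\<close>.\<close>

definition divDv :: "real^2 \<Rightarrow> real" where
  "divDv x = H x / \<sigma> x - (Dv x \<bullet> grad \<sigma> x) / \<sigma> x"

lemma divDv_cont: "continuous_on \<Omega> divDv"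
  unfolding divDv_def using \<sigma>_range
  by (intro continuous_intros H_cont \<sigma>_continuous Dv_cont grad_\<sigma>_cont) force+

lemma divDv_bd: "x \<in> \<Omega> \<Longrightarrow> \<bar>divDv x\<bar> \<le> (k\<^sub>2 + M / \<sigma>\<^sub>0 * S) / \<sigma>\<^sub>0"
proof -
  assume x: "x \<in> \<Omega>"
  note s = \<sigma>_range[OF x]
  have "\<bar>Dv x \<bullet> grad \<sigma> x\<bar> \<le> norm (Dv x) * norm (grad \<sigma> x)" by (rule Cauchy_Schwarz_ineq2)
  also have "\<dots> \<le> M / \<sigma>\<^sub>0 * S"
    using Dv_bd[OF x] \<sigma>_bd[OF x] order_trans[OF norm_ge_zero Dv_bd(1)[OF x]] by (intro mult_mono) auto
  finally have 1: "\<bar>H x - Dv x \<bullet> grad \<sigma> x\<bar> \<le> k\<^sub>2 + M / \<sigma>\<^sub>0 * S" using H_bd[OF x] by linarith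
  have "\<bar>divDv x\<bar> = \<bar>H x - Dv x \<bullet> grad \<sigma> x\<bar> / \<sigma> x"
    using s by (simp add: divDv_def diff_divide_distrib[symmetric])
  also have "\<dots> \<le> (k\<^sub>2 + M / \<sigma>\<^sub>0 * S) / \<sigma>\<^sub>0" using 1 s pos by (intro frac_le) auto
  finally show ?thesis .
qed

text \<open>The quotient of a test function by \<sigma> is continuously differentiable with compact
  support, but it need not be a test function. It is approximated by test functions uniformly
  together with its first derivatives, and the equation of \<open>J\<close> passes to the
  limit.\<close>

lemma Dv_weak_test:
  assumes \<phi>: "test_function \<Omega> \<phi>"
  shows "(LINT x|N. grad \<phi> x \<bullet> Dv x + divDv x * \<phi> x) = 0"
proof -
  note t = test_function_facts[OF \<phi>]
  define T where "T = closure {x. \<phi> x \<noteq> 0}"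
  have T: "compact T" "T \<subseteq> \<Omega>" "closed T" "\<And>x. x \<notin> T \<Longrightarrow> \<phi> x = 0"
    unfolding T_def using t(2,3,4) closed_closure by blast+
  define \<psi> where "\<psi> x = \<phi> x * (1 / \<sigma> x)" for x
  have \<psi>0: "\<psi> x = 0" if "x \<notin> T" for x using T(4) that by (simp add: \<psi>_def)
  have p\<phi>0: "partial i \<phi> x = 0" if "x \<notin> T" for i x using partial_zero_outside[OF T(3,4) that] .
  have p\<psi>0: "partial i \<psi> x = 0" if "x \<notin> T" for i x using partial_zero_outside[OF T(3) \<psi>0 that] .
  have d\<psi>: "(\<psi> has_derivative (\<lambda>h. \<phi> x * (- (grad \<sigma> x \<bullet> h) / (\<sigma> x)\<^sup>2) + (grad \<phi> x \<bullet> h) * (1 / \<sigma> x))) (at x)"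
    if x: "x \<in> \<Omega>" for x
  proof -
    have "((\<lambda>x. 1 / \<sigma> x) has_derivative (\<lambda>h. - (grad \<sigma> x \<bullet> h) / (\<sigma> x)\<^sup>2)) (at x)"
      using has_derivative_grad[OF \<sigma>_diff[OF x]] \<sigma>_range[OF x]
      by (auto intro!: derivative_eq_intros simp: power2_eq_square divide_simps)
    from has_derivative_mult[OF has_derivative_grad[OF smooth_differentiable[OF t(1)]] this]
    show ?thesis unfolding \<psi>_def .
  qed
  have p\<psi>: "partial i \<psi> x = \<phi> x * (- partial i \<sigma> x / (\<sigma> x)\<^sup>2) + partial i \<phi> x * (1 / \<sigma> x)" if "x \<in> \<Omega>" for i x
    using partial_eq[OF d\<psi>[OF that], of i] by (simp add: inner_axis)
  have \<psi>diff: "\<psi> differentiable (at x)" for x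
    by (rule differentiable_supported[OF T(3) _ \<psi>0]) (use d\<psi> T(2) in \<open>auto simp: differentiable_def\<close>)
  have \<psi>cont: "continuous_on UNIV \<psi>" by (rule differentiable_imp_continuous_UNIV[OF \<psi>diff])
  have p\<psi>cont: "continuous_on UNIV (partial i \<psi>)" for i
  proof -
    have "continuous_on \<Omega> (\<lambda>x. \<phi> x * (- partial i \<sigma> x / (\<sigma> x)\<^sup>2) + partial i \<phi> x * (1 / \<sigma> x))"
      using \<sigma>_range by (intro continuous_intros \<sigma>_cont \<sigma>_continuous smooth_continuous smooth_partial t(1)) force+
    then have "continuous_on \<Omega> (partial i \<psi>)" by (subst continuous_on_cong[OF refl p\<psi>]) auto
    then show ?thesis by (rule continuous_on_UNIV_supported[OF open_\<Omega> T(3,2) _ p\<psi>0])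
  qed
  have L\<psi>: "L2_on \<Omega> \<psi>" "L2_on \<Omega> (grad \<psi>)"
  proof -
    show "L2_on \<Omega> \<psi>" by (rule supported_bounded_measurable(3)[OF T(1) \<psi>cont \<psi>0])
    show "L2_on \<Omega> (grad \<psi>)"
      by (rule L2_vec) (simp add: supported_bounded_measurable(3)[OF T(1) p\<psi>cont p\<psi>0])
  qed
  have i\<psi>: "integrable N (\<lambda>x. grad \<psi> x \<bullet> J x + H x * \<psi> x)"
    by (intro integrable_add_N L2_inner L2_mult L2_facts L\<psi>)
  define Z where "Z = (LINT x|N. grad \<psi> x \<bullet> J x + H x * \<psi> x)"
  \<comment> \<open>Each of the two partial derivatives is off by at most \<open>e\<close>, so the
    gradient by at most \<open>2 * e\<close>, against a flux of length at most \<open>M\<close>; the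
    term with \<open>H\<close> adds at most \<open>k\<^sub>2 * e\<close>.\<close>
  define C where "C = (2 * M + k\<^sub>2) * measure N (space N)"
  have Ze: "\<bar>Z\<bar> \<le> e * C" if e: "0 < e" for e
  proof -
    have ex: "\<exists>\<eta>. test_function \<Omega> \<eta> \<and> (\<forall>x. \<bar>\<eta> x - \<psi> x\<bar> \<le> e) \<and>
      ((\<forall>x. \<psi> differentiable (at x)) \<and> (\<forall>i. continuous_on UNIV (partial i \<psi>)) \<longrightarrow>
        (\<forall>i x. \<bar>partial i \<eta> x - partial i \<psi> x\<bar> \<le> e))"
      by (rule test_function_approx[OF open_\<Omega> T(1,2) \<psi>0 \<psi>cont e])
    then obtain \<eta> where \<eta>: "test_function \<Omega> \<eta>" "\<And>x. \<bar>\<eta> x - \<psi> x\<bar> \<le> e"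
        "\<And>i x. \<bar>partial i \<eta> x - partial i \<psi> x\<bar> \<le> e"
      using \<psi>diff p\<psi>cont by blast
    note L\<eta> = test_function_L2[OF \<eta>(1)]
    have i\<eta>: "integrable N (\<lambda>x. grad \<eta> x \<bullet> J x + H x * \<eta> x)"
      by (intro integrable_add_N L2_inner L2_mult L2_facts L\<eta>)
    have "(LINT x|N. grad \<eta> x \<bullet> J x + H x * \<eta> x) = (LINT x|N. wgrad \<Omega> \<eta> x \<bullet> J x + H x * \<eta> x)"
      using test_function_wgrad[OF \<eta>(1)]
      by (intro integral_gradient_cong[symmetric] H1_wgrad(2) L2_facts L\<eta>)
    also have "\<dots> = 0" by (rule J_weak[OF test_function_H10[OF \<eta>(1)]])
    finally have zero: "(LINT x|N. grad \<eta> x \<bullet> J x + H x * \<eta> x) = 0" .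
    define d where "d x = (grad \<psi> x \<bullet> J x + H x * \<psi> x) - (grad \<eta> x \<bullet> J x + H x * \<eta> x)" for x
    have id: "integrable N d" unfolding d_def by (intro Bochner_Integration.integrable_diff i\<psi> i\<eta>)
    have "Z = (LINT x|N. d x)"
      unfolding d_def Z_def Bochner_Integration.integral_diff[OF i\<psi> i\<eta>] zero by simp
    then have "\<bar>Z\<bar> = \<bar>LINT x|N. d x\<bar>" by simp
    also have "\<dots> \<le> (LINT x|N. \<bar>d x\<bar>)"
      by (rule integral_abs_bound)
    also have "\<dots> \<le> (LINT x|N. e * (2 * M + k\<^sub>2))"
    proof (rule integral_mono)
      show "integrable N (\<lambda>x. \<bar>d x\<bar>)" by (intro integrable_abs id)
      fix x assume "x \<in> space N"
      then have x: "x \<in> \<Omega>" by simp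
      have "norm (grad \<psi> x - grad \<eta> x) \<le> (\<Sum>i\<in>UNIV. \<bar>(grad \<psi> x - grad \<eta> x) $ i\<bar>)" by (rule norm_le_l1_cart)
      also have "\<dots> \<le> (\<Sum>i\<in>(UNIV::2 set). e)"
        using \<eta>(3) by (intro sum_mono) (simp add: abs_minus_commute)
      finally have g: "norm (grad \<psi> x - grad \<eta> x) \<le> 2 * e" by simp
      have "\<bar>(grad \<psi> x - grad \<eta> x) \<bullet> J x\<bar> \<le> norm (grad \<psi> x - grad \<eta> x) * norm (J x)"
        by (rule Cauchy_Schwarz_ineq2)
      also have "\<dots> \<le> (2 * e) * M" using g J_bd[OF x] e by (intro mult_mono) auto
      finally have 1: "\<bar>(grad \<psi> x - grad \<eta> x) \<bullet> J x\<bar> \<le> (2 * e) * M" .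
      have 2: "\<bar>H x * (\<psi> x - \<eta> x)\<bar> \<le> k\<^sub>2 * e"
        unfolding abs_mult using H_bd[OF x] \<eta>(2)[of x] by (intro mult_mono) (auto simp: abs_minus_commute)
      have "d x = (grad \<psi> x - grad \<eta> x) \<bullet> J x + H x * (\<psi> x - \<eta> x)"
        by (simp add: d_def inner_diff_left right_diff_distrib)
      then show "\<bar>d x\<bar> \<le> e * (2 * M + k\<^sub>2)"
        using 1 2 by (simp add: algebra_simps)
    qed simp
    also have "\<dots> = e * C" by (simp add: C_def)
    finally show ?thesis .
  qed
  have "\<bar>Z\<bar> \<le> 0" using Ze by (rule nonpos_if_le_all_multiples)
  then have "Z = 0" by simp
  moreover have "Z = (LINT x|N. grad \<phi> x \<bullet> Dv x + divDv x * \<phi> x)"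
    unfolding Z_def
  proof (rule Bochner_Integration.integral_cong[OF refl])
    fix x assume "x \<in> space N"
    then have x: "x \<in> \<Omega>" by simp
    have g: "grad \<psi> x = (1 / \<sigma> x) *\<^sub>R grad \<phi> x - (\<phi> x / (\<sigma> x)\<^sup>2) *\<^sub>R grad \<sigma> x"
      by (simp add: vec_eq_iff p\<psi>[OF x])
    show "grad \<psi> x \<bullet> J x + H x * \<psi> x = grad \<phi> x \<bullet> Dv x + divDv x * \<phi> x"
      unfolding g inner_diff_left inner_scaleR_left \<psi>_def J_def divDv_def inner_scaleR_right inner_commute[of "Dv x"]
      using \<sigma>_range[OF x] by (simp add: power2_eq_square field_simps)
  qed
  ultimately show ?thesis by simp
qed

lemma L2_divDv: "L2_on \<Omega> divDv"
  using divDv_bd by (intro L2_cont[OF divDv_cont]) auto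

lemma Dv_weak:
  assumes w: "w \<in> H10 \<Omega>"
  shows "(LINT x|N. wgrad \<Omega> w x \<bullet> Dv x + divDv x * w x) = 0"
proof -
  obtain \<phi> where \<phi>: "H1_approx \<phi> w" and h: "w \<in> H1 \<Omega>" using w by (auto simp: H10_iff)
  have "(\<lambda>n. LINT x|N. grad (\<phi> n) x \<bullet> Dv x + divDv x * \<phi> n x)
      \<longlonglongrightarrow> (LINT x|N. wgrad \<Omega> w x \<bullet> Dv x + divDv x * w x)"
    by (rule H1_approx_tendsto[OF h \<phi> L2_facts(4) L2_divDv])
  moreover have "(LINT x|N. grad (\<phi> n) x \<bullet> Dv x + divDv x * \<phi> n x) = 0" for n
    using \<phi> by (intro Dv_weak_test) (simp add: H1_approx_def)
  ultimately have "(\<lambda>n::nat. 0) \<longlonglongrightarrow> (LINT x|N. wgrad \<Omega> w x \<bullet> Dv x + divDv x * w x)" by simp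
  then show ?thesis by (rule LIMSEQ_unique[OF _ tendsto_const])
qed

end

section \<open>Stability\<close>

text \<open>\<open>A\<close> is the area of the domain, \<open>V\<close> bounds the gradients of
  \<open>v\<close> and \<open>vt\<close>, and \<open>E\<close> is such that \<epsilon> \<le> E
  \<epsilon>^(1/2). \<open>C\<^sub>2\<close> bounds the integrated tangential term relative to
  \<epsilon>^(1/2), and \<open>C\<^sub>1\<close> is the constant of the level set estimate. The
  outer root comes from Cauchy-Schwarz.\<close>

definition stability_const :: "real \<Rightarrow> real \<Rightarrow> real \<Rightarrow> real \<Rightarrow> real \<Rightarrow> real \<Rightarrow> real \<Rightarrow> real" where
  "stability_const A \<sigma>\<^sub>0 \<sigma>\<^sub>1 M k\<^sub>2 S C\<^sub>1 =
    (let V = M / \<sigma>\<^sub>0; E = sqrt (2 * k\<^sub>2 * A); C\<^sub>2 = V / \<sigma>\<^sub>0 * sqrt (A * (2 * M * \<sigma>\<^sub>1)) + V * E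
     in sqrt (A * (2 * ((k\<^sub>2 + V * S) / \<sigma>\<^sub>0) * (C\<^sub>1 * C\<^sub>2) + 2 * (V + k\<^sub>2) * E)))"

text \<open>For vectors of equal length, \<open>j \<bullet> (j - j')\<close> and
  \<open>j' \<bullet> (j' - j)\<close> both equal half the square of the distance. The weights 1/s
  and 1/s' are at least 1/s1, even when they differ.\<close>

lemma equal_norm_monotone:
  fixes j j' :: "'a::real_inner"
  assumes "norm j = norm j'" and s: "0 < s" "s \<le> s1" "0 < s'" "s' \<le> s1"
  shows "(norm (j - j'))\<^sup>2 / s1 \<le> ((1 / s) *\<^sub>R j - (1 / s') *\<^sub>R j') \<bullet> (j - j')"
proof -
  have jj: "j \<bullet> j = j' \<bullet> j'" using assms(1) by (metis power2_norm_eq_inner)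
  have sq: "(norm (j - j'))\<^sup>2 = 2 * (j \<bullet> j - j \<bullet> j')"
    using jj by (simp add: power2_norm_eq_inner inner_diff_left inner_diff_right inner_commute)
  have "((1 / s) *\<^sub>R j - (1 / s') *\<^sub>R j') \<bullet> (j - j') = (1 / s + 1 / s') * (j \<bullet> j - j \<bullet> j')"
    using jj by (simp add: inner_diff_left inner_diff_right inner_commute[of j' j] algebra_simps)
  also have "\<dots> \<ge> (1 / s1 + 1 / s1) * (j \<bullet> j - j \<bullet> j')"
  proof (intro mult_right_mono add_mono)
    show "0 \<le> j \<bullet> j - j \<bullet> j'" using sq zero_le_power2[of "norm (j - j')"] by simp
  qed (use s in \<open>auto intro!: divide_left_mono\<close>)
  finally show ?thesis by (simp add: sq)
qed

lemma gradient_stability: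
  assumes A: "flux_data \<Omega> \<sigma>\<^sub>0 \<sigma>\<^sub>1 m M k\<^sub>2 S a F H u \<sigma>"
    and B: "flux_data \<Omega> \<sigma>\<^sub>0 \<sigma>\<^sub>1 m M k\<^sub>2 S a Ft H ut \<sigma>t"
    and ne: "\<Omega> \<noteq> {}" and C1: "0 \<le> C\<^sub>1"
    and level: "(LINT x|lebesgue_on \<Omega>. \<bar>u x - ut x\<bar>)
      \<le> C\<^sub>1 * (LINT x|lebesgue_on \<Omega>. \<bar>(grad u x - grad ut x) \<bullet> perp (grad u x + F x)\<bar>)"
  shows "(LINT x|lebesgue_on \<Omega>. norm (grad u x - grad ut x))
    \<le> stability_const (measure lebesgue \<Omega>) \<sigma>\<^sub>0 \<sigma>\<^sub>1 M k\<^sub>2 S C\<^sub>1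
      * (LINT x|lebesgue_on \<Omega>. norm (F x - Ft x)) powr (1/4)"
proof -
  interpret bounded_domain \<Omega> using A by (simp add: flux_data_def)
  interpret A: flux_data \<Omega> \<sigma>\<^sub>0 \<sigma>\<^sub>1 m M k\<^sub>2 S a F H u \<sigma> by (rule A)
  interpret B: flux_data \<Omega> \<sigma>\<^sub>0 \<sigma>\<^sub>1 m M k\<^sub>2 S a Ft H ut \<sigma>t by (rule B)
  define \<epsilon> where "\<epsilon> = (LINT x|N. norm (F x - Ft x))"
  define s where "s = sqrt \<epsilon>"
  define ar where "ar = measure lebesgue \<Omega>"
  define V where "V = M / \<sigma>\<^sub>0"
  define E where "E = sqrt (2 * k\<^sub>2 * ar)"
  define C2 where "C2 = V / \<sigma>\<^sub>0 * sqrt (ar * (2 * M * \<sigma>\<^sub>1)) + V * E"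
  define B0 where "B0 = (k\<^sub>2 + V * S) / \<sigma>\<^sub>0"
  define G0 where "G0 = 2 * (V + k\<^sub>2)"
  obtain x0 where x0: "x0 \<in> \<Omega>" using ne by blast
  have M0: "0 \<le> M" using A.J_bd[OF x0] norm_ge_zero order_trans by blast
  have \<sigma>0: "0 < \<sigma>\<^sub>0" by (rule A.pos)
  have \<sigma>1: "0 < \<sigma>\<^sub>1" using A.\<sigma>_range[OF x0] by linarith
  have k0: "0 \<le> k\<^sub>2" using A.F_bd[OF x0] norm_ge_zero order_trans by blast
  have S0: "0 \<le> S" using A.\<sigma>_bd[OF x0] norm_ge_zero order_trans by blast
  have V0: "0 \<le> V" using M0 \<sigma>0 by (simp add: V_def)
  have B00: "0 \<le> B0" using k0 V0 S0 \<sigma>0 by (simp add: B0_def)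
  have ar: "0 \<le> ar" by (simp add: ar_def)
  have spN: "measure N (space N) = ar"
    using lmeasurable_\<Omega> by (simp add: ar_def measure_restrict_space)
  define G where "G x = grad u x - grad ut x" for x
  define P where "P x = F x - Ft x" for x
  define Q where "Q x = A.J x - B.J x" for x
  define w where "w x = u x - ut x" for x
  have L: "L2_on \<Omega> G" "L2_on \<Omega> P" "L2_on \<Omega> Q"
    unfolding G_def P_def Q_def by (intro L2_diff A.L2_facts B.L2_facts)+
  have wH: "w \<in> H10 \<Omega>"
    using H10_lin[OF A.u_H10 B.u_H10, of "-1"] by (simp add: w_def[abs_def])
  then have wH1: "w \<in> H1 \<Omega>" by (simp add: H10_iff)
  have Lw: "L2_on \<Omega> w" by (rule H1_wgrad(1)[OF wH1])
  have AEw: "AE x in N. wgrad \<Omega> w x = G x"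
    using wgrad_lin(2)[OF A.u_H1 B.u_H1, of "-1"] A.wgrad_u B.wgrad_u
    by eventually_elim (simp add: w_def[abs_def] G_def)
  have to_G: "(LINT x|N. G x \<bullet> p x + q x * w x) = 0"
    if weak: "(LINT x|N. wgrad \<Omega> w x \<bullet> p x + q x * w x) = 0" and p: "L2_on \<Omega> p" and q: "L2_on \<Omega> q" for p q
  proof -
    have "(LINT x|N. wgrad \<Omega> w x \<bullet> p x + q x * w x) = (LINT x|N. G x \<bullet> p x + q x * w x)"
      by (rule integral_gradient_cong[OF AEw H1_wgrad(2)[OF wH1] L(1) p q Lw])
    then show ?thesis using weak by simp
  qed
  have diff_zero: "(LINT x|N. G x \<bullet> (p x - p' x) + (q x - q' x) * w x) = 0"
    if "(LINT x|N. wgrad \<Omega> w x \<bullet> p x + q x * w x) = 0" "L2_on \<Omega> p" "L2_on \<Omega> q"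
      "(LINT x|N. wgrad \<Omega> w x \<bullet> p' x + q' x * w x) = 0" "L2_on \<Omega> p'" "L2_on \<Omega> q'" for p p' q q'
  proof -
    have i: "integrable N (\<lambda>x. G x \<bullet> p x + q x * w x)" "integrable N (\<lambda>x. G x \<bullet> p' x + q' x * w x)"
      by (intro integrable_add_N L2_inner L2_mult L Lw that)+
    have "(LINT x|N. G x \<bullet> (p x - p' x) + (q x - q' x) * w x)
        = (LINT x|N. (G x \<bullet> p x + q x * w x) - (G x \<bullet> p' x + q' x * w x))"
      by (intro Bochner_Integration.integral_cong) (auto simp: inner_diff_right left_diff_distrib)
    also have "\<dots> = 0"
      using i to_G[OF that(1,2,3)] to_G[OF that(4,5,6)] by simp
    finally show ?thesis .
  qed
  have \<epsilon>0: "0 \<le> \<epsilon>" by (simp add: \<epsilon>_def)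
  have s0: "0 \<le> s" by (simp add: s_def \<epsilon>0)
  have iP: "integrable N (\<lambda>x. norm (P x))" by (rule L2_integrable_norm[OF L(2)])
  have \<epsilon>P: "\<epsilon> = (LINT x|N. norm (P x))" by (simp add: \<epsilon>_def P_def)
  \<comment> \<open>Both fields are bounded by \<open>k\<^sub>2\<close>, so \<epsilon> is at most
    \<open>2 * k\<^sub>2 * ar\<close>, that is, \<open>s \<le> E\<close>; multiplying by
    \<open>s\<close> gives the claim.\<close>
  have \<epsilon>_le: "\<epsilon> \<le> E * s"
  proof -
    have "\<epsilon> \<le> (LINT x|N. 2 * k\<^sub>2)"
      unfolding \<epsilon>P
    proof (rule integral_mono[OF iP])
      fix x assume "x \<in> space N"
      then have x: "x \<in> \<Omega>" by simp
      show "norm (P x) \<le> 2 * k\<^sub>2"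
        using norm_triangle_ineq4[of "F x" "Ft x"] A.F_bd[OF x] B.F_bd[OF x] by (simp add: P_def)
    qed simp
    then have "\<epsilon> \<le> 2 * k\<^sub>2 * ar" using spN by (simp add: mult.commute)
    then have "s \<le> E" unfolding s_def E_def by simp
    then have "s * s \<le> E * s" using s0 by (rule mult_right_mono)
    then show ?thesis using \<epsilon>0 by (simp add: s_def)
  qed

  have Q2: "(LINT x|N. (norm (Q x))\<^sup>2) \<le> 2 * M * \<sigma>\<^sub>1 * \<epsilon>"
  proof -
    have iQ: "integrable N (\<lambda>x. (norm (Q x))\<^sup>2)" using L(3) by (simp add: L2_on_iff)
    have iGQ: "integrable N (\<lambda>x. G x \<bullet> Q x)" "integrable N (\<lambda>x. P x \<bullet> Q x)"
      by (intro L2_inner L)+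
    \<comment> \<open>The two fluxes have the same divergence \<open>H\<close>, so their difference
      is orthogonal to the gradient of \<open>w\<close>.\<close>
    have "(LINT x|N. G x \<bullet> Q x) = 0"
      using diff_zero[OF A.J_weak[OF wH] A.L2_facts(5,3) B.J_weak[OF wH] B.L2_facts(5) A.L2_facts(3)]
      by (simp add: Q_def)
    have "(LINT x|N. (norm (Q x))\<^sup>2 / \<sigma>\<^sub>1) \<le> (LINT x|N. G x \<bullet> Q x + P x \<bullet> Q x)"
    proof (rule integral_mono_AE)
      show "integrable N (\<lambda>x. (norm (Q x))\<^sup>2 / \<sigma>\<^sub>1)" using iQ by simp
      show "integrable N (\<lambda>x. G x \<bullet> Q x + P x \<bullet> Q x)" using iGQ by simp
      show "AE x in N. (norm (Q x))\<^sup>2 / \<sigma>\<^sub>1 \<le> G x \<bullet> Q x + P x \<bullet> Q x"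
        using A.J_norm B.J_norm AE_space
      proof eventually_elim
        case (elim x)
        then have x: "x \<in> \<Omega>" by simp
        have "G x + P x = A.Dv x - B.Dv x" by (simp add: G_def P_def A.Dv_def B.Dv_def)
        then have "G x \<bullet> Q x + P x \<bullet> Q x = (A.Dv x - B.Dv x) \<bullet> Q x" by (metis inner_add_left)
        also have "\<dots> = ((1 / \<sigma> x) *\<^sub>R A.J x - (1 / \<sigma>t x) *\<^sub>R B.J x) \<bullet> (A.J x - B.J x)"
          by (simp add: A.Dv_J[OF x] B.Dv_J[OF x] Q_def)
        also have "\<dots> \<ge> (norm (A.J x - B.J x))\<^sup>2 / \<sigma>\<^sub>1"
          using elim A.\<sigma>_range[OF x] B.\<sigma>_range[OF x] by (intro equal_norm_monotone) auto
        finally show ?case by (simp add: Q_def)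
      qed
    qed
    also have "\<dots> = (LINT x|N. P x \<bullet> Q x)" using iGQ \<open>(LINT x|N. G x \<bullet> Q x) = 0\<close> by simp
    also have "\<dots> \<le> (LINT x|N. 2 * M * norm (P x))"
    proof (rule integral_mono[OF iGQ(2)])
      show "integrable N (\<lambda>x. 2 * M * norm (P x))" using iP by simp
      fix x assume "x \<in> space N"
      then have x: "x \<in> \<Omega>" by simp
      have "P x \<bullet> Q x \<le> norm (P x) * norm (Q x)" by (rule norm_cauchy_schwarz)
      also have "\<dots> \<le> norm (P x) * (2 * M)"
        using norm_triangle_ineq4[of "A.J x" "B.J x"] A.J_bd[OF x] B.J_bd[OF x]
        by (intro mult_left_mono) (auto simp: Q_def)
      finally show "P x \<bullet> Q x \<le> 2 * M * norm (P x)" by (simp add: mult.commute)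
    qed
    also have "\<dots> = 2 * M * \<epsilon>" by (simp add: \<epsilon>P)
    finally show ?thesis using \<sigma>1 by (simp add: divide_simps mult_ac)
  qed
  have L1_le: "(LINT x|N. norm (f x)) \<le> sqrt (ar * R)" if f: "L2_on \<Omega> f" and R: "(LINT x|N. (norm (f x))\<^sup>2) \<le> R"
    for f :: "real^2 \<Rightarrow> real^2" and R
  proof -
    have "(LINT x|N. norm (f x)) \<le> \<bar>LINT x|N. 1 \<bullet> norm (f x)\<bar>" by simp
    also have "\<dots> \<le> sqrt (LINT x|N. (norm (1::real))\<^sup>2) * sqrt (LINT x|N. (norm (norm (f x)))\<^sup>2)"
      by (rule L2_Cauchy_Schwarz[OF L2_const L2_norm[OF f]])
    also have "\<dots> = sqrt (ar * (LINT x|N. (norm (f x))\<^sup>2))"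
      using spN by (simp add: real_sqrt_mult)
    also have "\<dots> \<le> sqrt (ar * R)" using R ar by (intro real_sqrt_le_mono mult_left_mono)
    finally show ?thesis .
  qed
  have Q1: "(LINT x|N. norm (Q x)) \<le> sqrt (ar * (2 * M * \<sigma>\<^sub>1)) * s"
    using L1_le[OF L(3) Q2] by (simp add: s_def real_sqrt_mult)
  have w1: "(LINT x|N. \<bar>w x\<bar>) \<le> C\<^sub>1 * (C2 * s)"
  proof -
    have iQ: "integrable N (\<lambda>x. norm (Q x))" by (rule L2_integrable_norm[OF L(3)])
    have "(LINT x|N. \<bar>G x \<bullet> perp (A.Dv x)\<bar>) \<le> (LINT x|N. V / \<sigma>\<^sub>0 * norm (Q x) + V * norm (P x))"
    proof (rule integral_mono)
      have "continuous_on \<Omega> G" unfolding G_def by (intro continuous_intros A.grad_u_cont B.grad_u_cont)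
      then have c: "continuous_on \<Omega> (\<lambda>x. \<bar>G x \<bullet> perp (A.Dv x)\<bar>)" by (intro continuous_intros A.Dv_cont)
      have le: "\<bar>G x \<bullet> perp (A.Dv x)\<bar> \<le> V / \<sigma>\<^sub>0 * norm (Q x) + V * norm (P x)" if x: "x \<in> \<Omega>" for x
      proof -
        have "G x = A.Dv x - B.Dv x - P x" by (simp add: G_def P_def A.Dv_def B.Dv_def)
        \<comment> \<open>The first term is parallel to \<open>A.Dv x\<close> and disappears against
          \<open>perp (A.Dv x)\<close>. Thus the tangential derivative of \<open>w\<close> sees
          \<open>Q\<close> and \<open>P\<close> only, although the two coefficients are not known to
          be close.\<close>
        moreover have "B.Dv x = (\<sigma> x / \<sigma>t x) *\<^sub>R A.Dv x - (1 / \<sigma>t x) *\<^sub>R Q x"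
          using B.\<sigma>_range[OF x] by (simp add: Q_def B.J_def A.J_def scaleR_diff_right)
        ultimately have e0: "G x \<bullet> perp (A.Dv x) = (1 / \<sigma>t x) * (Q x \<bullet> perp (A.Dv x)) - P x \<bullet> perp (A.Dv x)"
          by (simp add: inner_diff_left)
        have cs: "\<bar>y \<bullet> perp (A.Dv x)\<bar> \<le> V * norm y" for y
        proof -
          have "\<bar>y \<bullet> perp (A.Dv x)\<bar> \<le> norm y * norm (perp (A.Dv x))" by (rule Cauchy_Schwarz_ineq2)
          also have "\<dots> \<le> norm y * V"
            unfolding norm_perp V_def by (rule mult_left_mono[OF A.Dv_bd(1)[OF x] norm_ge_zero])
          finally show ?thesis by (simp add: mult.commute)
        qed
        have "\<bar>(1 / \<sigma>t x) * (Q x \<bullet> perp (A.Dv x))\<bar> \<le> (1 / \<sigma>\<^sub>0) * (V * norm (Q x))"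
          unfolding abs_mult using B.\<sigma>_range[OF x] \<sigma>0 cs[of "Q x"]
          by (intro mult_mono) (auto intro!: divide_left_mono)
        moreover have "(1 / \<sigma>\<^sub>0) * (V * norm (Q x)) = V / \<sigma>\<^sub>0 * norm (Q x)" by simp
        ultimately show ?thesis
          unfolding e0 using cs[of "P x"] abs_triangle_ineq4[of "(1 / \<sigma>t x) * (Q x \<bullet> perp (A.Dv x))" "P x \<bullet> perp (A.Dv x)"]
          by linarith
      qed
      show "integrable N (\<lambda>x. V / \<sigma>\<^sub>0 * norm (Q x) + V * norm (P x))" using iQ iP by simp
      then show "integrable N (\<lambda>x. \<bar>G x \<bullet> perp (A.Dv x)\<bar>)"
        by (rule Bochner_Integration.integrable_bound)
          (use continuous_measurable[OF c] le in \<open>auto intro!: AE_I2 order_trans[OF le]\<close>)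
      fix x assume "x \<in> space N"
      then show "\<bar>G x \<bullet> perp (A.Dv x)\<bar> \<le> V / \<sigma>\<^sub>0 * norm (Q x) + V * norm (P x)" using le by simp
    qed
    also have "\<dots> = V / \<sigma>\<^sub>0 * (LINT x|N. norm (Q x)) + V * \<epsilon>" using iQ iP by (simp add: \<epsilon>P)
    also have "\<dots> \<le> V / \<sigma>\<^sub>0 * (sqrt (ar * (2 * M * \<sigma>\<^sub>1)) * s) + V * (E * s)"
      using Q1 \<epsilon>_le V0 \<sigma>0 by (intro add_mono mult_left_mono) auto
    also have "\<dots> = C2 * s" by (simp add: C2_def algebra_simps)
    finally have "C\<^sub>1 * (LINT x|N. \<bar>G x \<bullet> perp (A.Dv x)\<bar>) \<le> C\<^sub>1 * (C2 * s)"
      using C1 by (rule mult_left_mono)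
    moreover have "(LINT x|N. \<bar>w x\<bar>) \<le> C\<^sub>1 * (LINT x|N. \<bar>G x \<bullet> perp (A.Dv x)\<bar>)"
      using level by (simp add: w_def G_def A.Dv_def)
    ultimately show ?thesis by linarith
  qed
  \<comment> \<open>The gradients of \<open>v\<close> and \<open>vt\<close> differ by
    \<open>G + P\<close>, so subtracting the two divergence equations tested with \<open>w\<close>
    gives the square of \<open>G\<close>, up to a term in \<open>P\<close> and a term in
    \<open>w\<close> with the bounded factor \<open>q\<close>.\<close>
  have G2: "(LINT x|N. (norm (G x))\<^sup>2) \<le> (2 * B0 * (C\<^sub>1 * C2) + G0 * E) * s"
  proof -
    define q where "q x = A.divDv x - B.divDv x" for x
    have iw: "integrable N (\<lambda>x. \<bar>w x\<bar>)" using L2_integrable_norm[OF Lw] by simp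
    have iG: "integrable N (\<lambda>x. (norm (G x))\<^sup>2)" using L(1) by (simp add: L2_on_iff)
    have Lq: "L2_on \<Omega> q" unfolding q_def by (intro L2_diff A.L2_divDv B.L2_divDv)
    have i: "integrable N (\<lambda>x. G x \<bullet> (A.Dv x - B.Dv x) + q x * w x)"
      by (intro integrable_add_N L2_inner L2_mult L2_diff L Lw Lq A.L2_facts B.L2_facts)
    have z: "(LINT x|N. G x \<bullet> (A.Dv x - B.Dv x) + q x * w x) = 0"
      unfolding q_def
      by (rule diff_zero[OF A.Dv_weak[OF wH] A.L2_facts(4) A.L2_divDv B.Dv_weak[OF wH] B.L2_facts(4) B.L2_divDv])
    have "(LINT x|N. (norm (G x))\<^sup>2)
      \<le> (LINT x|N. (G x \<bullet> (A.Dv x - B.Dv x) + q x * w x) + (2 * B0 * \<bar>w x\<bar> + G0 * norm (P x)))"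
    proof (rule integral_mono[OF iG])
      show "integrable N (\<lambda>x. (G x \<bullet> (A.Dv x - B.Dv x) + q x * w x) + (2 * B0 * \<bar>w x\<bar> + G0 * norm (P x)))"
        using i iw iP by simp
      fix x assume "x \<in> space N"
      then have x: "x \<in> \<Omega>" by simp
      have "A.Dv x - B.Dv x = G x + P x" by (simp add: G_def P_def A.Dv_def B.Dv_def)
      then have eq: "(norm (G x))\<^sup>2 = G x \<bullet> (A.Dv x - B.Dv x) - G x \<bullet> P x"
        by (simp add: inner_add_right power2_norm_eq_inner)
      have "\<bar>G x \<bullet> P x\<bar> \<le> norm (G x) * norm (P x)" by (rule Cauchy_Schwarz_ineq2)
      also have "\<dots> \<le> G0 * norm (P x)"
        using norm_triangle_ineq4[of "grad u x" "grad ut x"] A.grad_u_bd[OF x] B.grad_u_bd[OF x]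
        by (intro mult_right_mono) (auto simp: G_def G0_def V_def)
      finally have 1: "\<bar>G x \<bullet> P x\<bar> \<le> G0 * norm (P x)" .
      have "\<bar>q x\<bar> \<le> 2 * B0"
        using A.divDv_bd[OF x] B.divDv_bd[OF x] unfolding q_def B0_def V_def by linarith
      then have 2: "\<bar>q x * w x\<bar> \<le> 2 * B0 * \<bar>w x\<bar>" unfolding abs_mult by (rule mult_right_mono) simp
      show "(norm (G x))\<^sup>2 \<le> (G x \<bullet> (A.Dv x - B.Dv x) + q x * w x) + (2 * B0 * \<bar>w x\<bar> + G0 * norm (P x))"
        using eq 1 2 by linarith
    qed
    also have "\<dots> = 2 * B0 * (LINT x|N. \<bar>w x\<bar>) + G0 * \<epsilon>"
      using i iw iP z by (simp add: \<epsilon>P)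
    also have "\<dots> \<le> 2 * B0 * (C\<^sub>1 * (C2 * s)) + G0 * (E * s)"
      using w1 \<epsilon>_le B00 V0 k0 by (intro add_mono mult_left_mono) (auto simp: G0_def)
    finally show ?thesis by (simp add: algebra_simps)
  qed
  have "(LINT x|N. norm (G x)) \<le> sqrt (ar * ((2 * B0 * (C\<^sub>1 * C2) + G0 * E) * s))"
    by (rule L1_le[OF L(1) G2])
  also have "\<dots> = sqrt (ar * (2 * B0 * (C\<^sub>1 * C2) + G0 * E)) * sqrt s"
    by (simp add: real_sqrt_mult)
  \<comment> \<open>The case of \<epsilon> = 0 is separate; there \<open>powr\<close> returns
    0.\<close>
  also have "sqrt s = \<epsilon> powr (1/4)"
  proof (cases "\<epsilon> = 0")
    case False
    then have "0 < \<epsilon>" using \<epsilon>0 by simp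
    then have "sqrt s = (\<epsilon> powr (1/2)) powr (1/2)" by (simp add: s_def powr_half_sqrt)
    then show ?thesis by (simp add: powr_powr)
  qed (simp add: s_def)
  also have "sqrt (ar * (2 * B0 * (C\<^sub>1 * C2) + G0 * E)) = stability_const ar \<sigma>\<^sub>0 \<sigma>\<^sub>1 M k\<^sub>2 S C\<^sub>1"
    by (simp add: stability_const_def Let_def V_def E_def C2_def B0_def G0_def)
  finally show ?thesis by (simp add: G_def \<epsilon>_def ar_def)
qed

section \<open>From the differentiability classes to the bounds of the locale\<close>

lemma Ck_on_differentiable: "Ck_on (Suc k) \<Omega> f \<Longrightarrow> open \<Omega> \<Longrightarrow> x \<in> \<Omega> \<Longrightarrow> f differentiable (at x)"
proof -
  assume f: "Ck_on (Suc k) \<Omega> f" and "open \<Omega>" "x \<in> \<Omega>"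
  from f have "\<forall>is. length is < Suc k \<longrightarrow> foldr partial is f differentiable_on \<Omega>" by (auto simp: Ck_on_def)
  from this[rule_format, of "[]"] have "f differentiable_on \<Omega>" by simp
  then show ?thesis using \<open>open \<Omega>\<close> \<open>x \<in> \<Omega>\<close> by (simp add: differentiable_on_eq_differentiable_at)
qed

lemma Ck_on_partial_continuous: "Ck_on (Suc k) \<Omega> f \<Longrightarrow> continuous_on \<Omega> (partial i f)"
proof -
  assume f: "Ck_on (Suc k) \<Omega> f"
  from f have "\<forall>is. length is \<le> Suc k \<longrightarrow> continuous_on \<Omega> (foldr partial is f)" by (auto simp: Ck_on_def)
  from this[rule_format, of "[i]"] show ?thesis by simp
qed

lemma Ck_closure_extension:
  assumes "Ck_closure k \<Omega> f" "length is \<le> k"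
  obtains g where "continuous_on (closure \<Omega>) g" "\<And>x. x \<in> \<Omega> \<Longrightarrow> g x = foldr partial is f x"
  using assms unfolding Ck_closure_def by metis

text \<open>A real supremum bounds its members only if the set is bounded above. Boundedness holds
  because there are finitely many lists of length at most \<open>k\<close> and each derivative
  extends continuously to the compact closure.\<close>

lemma Ck_norm_ge:
  fixes \<Omega> :: "(real^'n::finite) set"
  assumes "bounded \<Omega>" "Ck_closure k \<Omega> f" "length is \<le> k" "x \<in> \<Omega>"
  shows "norm (foldr partial is f x) \<le> Ck_norm k \<Omega> f"
proof -
  define L where "L = {is :: 'n list. length is \<le> k}"
  have finL: "finite L"
    using finite_lists_length_le[of "UNIV :: 'n set" k] by (simp add: L_def)
  have "\<exists>B. \<forall>x\<in>\<Omega>. norm (foldr partial js f x) \<le> B" if js: "js \<in> L" for js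
  proof -
    obtain g where g: "continuous_on (closure \<Omega>) g" "\<And>x. x \<in> \<Omega> \<Longrightarrow> g x = foldr partial js f x"
      using Ck_closure_extension[OF assms(2), of js] js unfolding L_def by blast
    have "compact (g ` closure \<Omega>)"
      using g(1) assms(1) by (intro compact_continuous_image) (auto simp: compact_closure)
    then obtain B where "\<And>x. x \<in> closure \<Omega> \<Longrightarrow> norm (g x) \<le> B"
      using compact_imp_bounded[of "g ` closure \<Omega>"] by (auto simp: bounded_iff)
    then show ?thesis using g(2) closure_subset[of \<Omega>] by (intro exI[of _ B] ballI) (metis subsetD)
  qed
  then obtain B where B: "\<And>js x. js \<in> L \<Longrightarrow> x \<in> \<Omega> \<Longrightarrow> norm (foldr partial js f x) \<le> B js"
    by metis
  have "bdd_above ((\<lambda>(is, x). norm (foldr partial is f x)) ` (L \<times> \<Omega>))"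
  proof (rule bdd_aboveI)
    fix y assume "y \<in> (\<lambda>(is, x). norm (foldr partial is f x)) ` (L \<times> \<Omega>)"
    then obtain js z where jz: "js \<in> L" "z \<in> \<Omega>" "y = norm (foldr partial js f z)" by auto
    have "y \<le> B js" using B jz by simp
    also have "\<dots> \<le> Max (B ` L)" using finL jz by (intro Max_ge) auto
    finally show "y \<le> Max (B ` L)" .
  qed
  moreover have "(is, x) \<in> L \<times> \<Omega>" using assms by (simp add: L_def)
  ultimately show ?thesis
    unfolding Ck_norm_def L_def[symmetric]
    using cSUP_upper[of "(is, x)" "L \<times> \<Omega>" "\<lambda>(is, x). norm (foldr partial is f x)"] by simp
qed

lemma uniformly_continuous_extension:
  assumes "bounded \<Omega>" "continuous_on (closure \<Omega>) g" "\<And>x. x \<in> \<Omega> \<Longrightarrow> g x = h x"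
  shows "uniformly_continuous_on \<Omega> (h :: real^'n::finite \<Rightarrow> 'b::real_normed_vector)"
proof -
  have "uniformly_continuous_on (closure \<Omega>) g"
    using assms by (intro compact_uniformly_continuous) (auto simp: compact_closure)
  then have "uniformly_continuous_on \<Omega> g"
    using closure_subset[of \<Omega>] unfolding uniformly_continuous_on_def by (meson subsetD)
  then show ?thesis using assms(3) by (simp add: uniformly_continuous_on_def)
qed

lemma grad_uniformly_continuous:
  fixes \<Omega> :: "(real^'n::finite) set"
  assumes "bounded \<Omega>" "Ck_closure 1 \<Omega> f"
  shows "uniformly_continuous_on \<Omega> (grad f)"
proof -
  have "\<exists>g. continuous_on (closure \<Omega>) g \<and> (\<forall>x\<in>\<Omega>. g x = partial i f x)" for i
    using Ck_closure_extension[OF assms(2), of "[i]"] by (metis One_nat_def foldr_Cons foldr_Nil comp_def id_apply length_Cons list.size(3) order_refl)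
  then obtain g where g: "\<And>i. continuous_on (closure \<Omega>) (g i)" "\<And>i x. x \<in> \<Omega> \<Longrightarrow> g i x = partial i f x"
    by metis
  show ?thesis
  proof (rule uniformly_continuous_extension[OF assms(1)])
    show "continuous_on (closure \<Omega>) (\<lambda>x. \<chi> i. g i x)" by (intro continuous_intros g)
    show "(\<chi> i. g i x) = grad f x" if "x \<in> \<Omega>" for x using g(2)[OF that] by (simp add: grad_def)
  qed
qed

text \<open>The norm is at most the sum of the two components; this is the origin of the factor in
  \<open>2 * \<sigma>\<^sub>2\<close>.\<close>

lemma norm_grad_le:
  fixes f :: "real^2 \<Rightarrow> real"
  assumes "\<And>i. \<bar>partial i f x\<bar> \<le> B"
  shows "norm (grad f x) \<le> 2 * B"
proof -
  have "norm (grad f x) \<le> (\<Sum>i\<in>UNIV. \<bar>grad f x $ i\<bar>)" by (rule norm_le_l1_cart)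
  also have "\<dots> \<le> (\<Sum>i\<in>(UNIV::2 set). B)" using assms by (intro sum_mono) simp
  finally show ?thesis by simp
qed

lemma flux_dataI:
  assumes dom: "open \<Omega>" "bounded \<Omega>" and pos: "0 < m" "0 < \<sigma>\<^sub>0"
    and a: "set_borel_measurable lebesgue \<Omega> a" "AE x in lebesgue. x \<in> \<Omega> \<longrightarrow> m \<le> a x \<and> a x \<le> M"
    and adm: "admissible \<sigma>\<^sub>0 \<sigma>\<^sub>1 m M \<Omega> a F H u \<sigma>"
    and C: "Ck_closure 2 \<Omega> F" "Ck_closure 1 \<Omega> H" "Ck_closure 2 \<Omega> \<sigma>"
    and norms: "Ck_norm 2 \<Omega> F \<le> k\<^sub>2" "Ck_norm 1 \<Omega> H \<le> k\<^sub>2" "Ck_norm 2 \<Omega> \<sigma> \<le> \<sigma>\<^sub>2"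
  shows "flux_data \<Omega> \<sigma>\<^sub>0 \<sigma>\<^sub>1 m M k\<^sub>2 (2 * \<sigma>\<^sub>2) a F H u \<sigma>"
proof -
  interpret bounded_domain \<Omega> using dom by unfold_locales
  have \<sigma>C: "Ck_on (Suc 1) \<Omega> \<sigma>" using C(3) by (simp add: Ck_closure_def numeral_2_eq_2)
  show ?thesis
  proof
    show "a \<in> borel_measurable N" using a(1) by (simp add: set_measurable_eq)
    show "AE x in N. m \<le> a x \<and> a x \<le> M" using a(2) by (simp add: AE_eq)
    show "continuous_on \<Omega> F" "continuous_on \<Omega> H"
      using C closure_subset[of \<Omega>] by (auto simp: Ck_closure_def intro: continuous_on_subset)
    show "norm (F x) \<le> k\<^sub>2" if "x \<in> \<Omega>" for x
      using Ck_norm_ge[OF dom(2) C(1), of "[]" x] norms(1) that by simp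
    show "\<bar>H x\<bar> \<le> k\<^sub>2" if "x \<in> \<Omega>" for x
      using Ck_norm_ge[OF dom(2) C(2), of "[]" x] norms(2) that by simp
    show "\<sigma> differentiable (at x)" if "x \<in> \<Omega>" for x using Ck_on_differentiable[OF \<sigma>C dom(1) that] .
    show "continuous_on \<Omega> (partial i \<sigma>)" for i using Ck_on_partial_continuous[OF \<sigma>C] .
    show "norm (grad \<sigma> x) \<le> 2 * \<sigma>\<^sub>2" if "x \<in> \<Omega>" for x
    proof (rule norm_grad_le)
      show "\<bar>partial i \<sigma> x\<bar> \<le> \<sigma>\<^sub>2" for i
        using Ck_norm_ge[OF dom(2) C(3), of "[i]" x] norms(3) that by simp
    qed
  qed (use pos adm in auto)
qed

lemma well_structured_paths:
  assumes "\<Omega> \<in> sets lebesgue" "well_structured \<Omega> v Kt"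
  shows "AE x in lebesgue_on \<Omega>. level_reaches_frontier \<Omega> v x"
proof -
  have "AE x in lebesgue. x \<in> \<Omega> \<longrightarrow> (\<exists>s\<^sub>0>0. \<exists>\<gamma> \<gamma>'. level_path \<Omega> v x s\<^sub>0 \<gamma> \<gamma>')"
    using assms(2) unfolding well_structured_def by (elim exE, elim eventually_mono) blast
  then have "AE x in lebesgue_on \<Omega>. \<exists>s\<^sub>0>0. \<exists>\<gamma> \<gamma>'. level_path \<Omega> v x s\<^sub>0 \<gamma> \<gamma>'"
    using assms(1) by (simp add: AE_restrict_space_iff)
  then show ?thesis
  proof (rule eventually_mono)
    fix x assume "\<exists>s\<^sub>0>0. \<exists>\<gamma> \<gamma>'. level_path \<Omega> v x s\<^sub>0 \<gamma> \<gamma>'"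
    then obtain s\<^sub>0 \<gamma> \<gamma>' where s: "0 < s\<^sub>0" and p: "level_path \<Omega> v x s\<^sub>0 \<gamma> \<gamma>'" by blast
    have "continuous_on {0..s\<^sub>0} \<gamma>"
      using p by (auto simp: level_path_def continuous_on_eq_continuous_within
          intro!: has_vector_derivative_continuous)
    with s p show "level_reaches_frontier \<Omega> v x"
      unfolding level_path_def level_reaches_frontier_def by (intro exI[of _ s\<^sub>0] exI[of _ \<gamma>]) auto
  qed
qed

theorem theorem3p7:
  fixes \<Omega> :: "(real^2) set" and m M k\<^sub>2 K Kt \<sigma>\<^sub>0 \<sigma>\<^sub>1 \<sigma>\<^sub>2 :: real
  assumes "open \<Omega>" "connected \<Omega>" "bounded \<Omega>" "lipschitz_boundary \<Omega>"
    and "0 < m" "0 < \<sigma>\<^sub>0" "0 < \<sigma>\<^sub>1" "0 < k\<^sub>2" "0 < \<sigma>\<^sub>2" "0 \<le> K"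
  shows "\<exists>C::real. \<forall>(a :: real^2 \<Rightarrow> real) (f :: real^2 \<Rightarrow> real) (ft :: real^2 \<Rightarrow> real)
      (F :: real^2 \<Rightarrow> real^2) (Ft :: real^2 \<Rightarrow> real^2) (H :: real^2 \<Rightarrow> real)
      (u :: real^2 \<Rightarrow> real) (ut :: real^2 \<Rightarrow> real) (\<sigma> :: real^2 \<Rightarrow> real) (\<sigma>t :: real^2 \<Rightarrow> real).
    set_borel_measurable lebesgue \<Omega> a \<and>
    (AE x in lebesgue. x \<in> \<Omega> \<longrightarrow> m \<le> a x \<and> a x \<le> M) \<and>
    Ck_on 1 \<Omega> f \<and> continuous_on (closure \<Omega>) f \<and> (\<forall>x\<in>\<Omega>. F x = grad f x) \<and>
    Ck_on 1 \<Omega> ft \<and> continuous_on (closure \<Omega>) ft \<and> (\<forall>x\<in>\<Omega>. Ft x = grad ft x) \<and>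
    admissible \<sigma>\<^sub>0 \<sigma>\<^sub>1 m M \<Omega> a F H u \<sigma> \<and>
    admissible \<sigma>\<^sub>0 \<sigma>\<^sub>1 m M \<Omega> a Ft H ut \<sigma>t \<and>
    (\<forall>x\<in>frontier \<Omega>. u x = 0 \<and> ut x = 0) \<and>
    Ck_closure 2 \<Omega> F \<and> Ck_closure 2 \<Omega> Ft \<and> Ck_closure 1 \<Omega> H \<and>
    Ck_closure 2 \<Omega> \<sigma> \<and> Ck_closure 2 \<Omega> \<sigma>t \<and>
    Ck_norm 2 \<Omega> F \<le> k\<^sub>2 \<and> Ck_norm 2 \<Omega> Ft \<le> k\<^sub>2 \<and> Ck_norm 1 \<Omega> H \<le> k\<^sub>2 \<and>
    Ck_norm 2 \<Omega> \<sigma> \<le> \<sigma>\<^sub>2 \<and> Ck_norm 2 \<Omega> \<sigma>t \<le> \<sigma>\<^sub>2 \<and>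
    (SUP t::real. hausdorff1 {x \<in> \<Omega>. u x + f x = t}) = ennreal K \<and>
    well_structured \<Omega> (\<lambda>x. u x + f x) Kt
    \<longrightarrow> (LINT x:\<Omega>|lebesgue. norm (grad u x - grad ut x))
          \<le> C * (LINT x:\<Omega>|lebesgue. norm (F x - Ft x)) powr (1/4)"
proof (intro exI[of _ "stability_const (measure lebesgue \<Omega>) \<sigma>\<^sub>0 \<sigma>\<^sub>1 M k\<^sub>2 (2 * \<sigma>\<^sub>2)
    (2048 * K * (M / \<sigma>\<^sub>0) / (m / \<sigma>\<^sub>1)\<^sup>2)"] allI impI, elim conjE)
  fix a f ft :: "real^2 \<Rightarrow> real" and F Ft :: "real^2 \<Rightarrow> real^2" and H u ut \<sigma> \<sigma>t :: "real^2 \<Rightarrow> real"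
  assume a: "set_borel_measurable lebesgue \<Omega> a" "AE x in lebesgue. x \<in> \<Omega> \<longrightarrow> m \<le> a x \<and> a x \<le> M"
    and f: "Ck_on 1 \<Omega> f" "\<forall>x\<in>\<Omega>. F x = grad f x"
    and adm: "admissible \<sigma>\<^sub>0 \<sigma>\<^sub>1 m M \<Omega> a F H u \<sigma>" and admt: "admissible \<sigma>\<^sub>0 \<sigma>\<^sub>1 m M \<Omega> a Ft H ut \<sigma>t"
    and bc: "\<forall>x\<in>frontier \<Omega>. u x = 0 \<and> ut x = 0"
    and C: "Ck_closure 2 \<Omega> F" "Ck_closure 2 \<Omega> Ft" "Ck_closure 1 \<Omega> H" "Ck_closure 2 \<Omega> \<sigma>" "Ck_closure 2 \<Omega> \<sigma>t"
    and norms: "Ck_norm 2 \<Omega> F \<le> k\<^sub>2" "Ck_norm 2 \<Omega> Ft \<le> k\<^sub>2" "Ck_norm 1 \<Omega> H \<le> k\<^sub>2"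
      "Ck_norm 2 \<Omega> \<sigma> \<le> \<sigma>\<^sub>2" "Ck_norm 2 \<Omega> \<sigma>t \<le> \<sigma>\<^sub>2"
    and K: "(SUP t::real. hausdorff1 {x \<in> \<Omega>. u x + f x = t}) = ennreal K"
    and ws: "well_structured \<Omega> (\<lambda>x. u x + f x) Kt"
  interpret bounded_domain \<Omega> using assms by unfold_locales
  \<comment> \<open>The constant of \<open>level_L1_estimate\<close> with the bounds of
    \<open>Dv_bd\<close> inserted: \<open>M / \<sigma>\<^sub>0\<close> for \<open>V\<close> and
    \<open>m / \<sigma>\<^sub>1\<close> for \<open>c\<close>.\<close>
  let ?C1 = "2048 * K * (M / \<sigma>\<^sub>0) / (m / \<sigma>\<^sub>1)\<^sup>2"
  show "(LINT x:\<Omega>|lebesgue. norm (grad u x - grad ut x))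
    \<le> stability_const (measure lebesgue \<Omega>) \<sigma>\<^sub>0 \<sigma>\<^sub>1 M k\<^sub>2 (2 * \<sigma>\<^sub>2) ?C1
      * (LINT x:\<Omega>|lebesgue. norm (F x - Ft x)) powr (1/4)"
  proof (cases "\<Omega> = {}")
    \<comment> \<open>On the empty domain both integrals vanish. Otherwise a point of \<Omega>
      supplies the sign of \<open>M\<close>, which is read off from the bounds on the flux.\<close>
    case True
    then show ?thesis by (simp add: set_lebesgue_integral_def)
  next
    case ne: False
    then obtain x0 where x0: "x0 \<in> \<Omega>" by blast
    have A: "flux_data \<Omega> \<sigma>\<^sub>0 \<sigma>\<^sub>1 m M k\<^sub>2 (2 * \<sigma>\<^sub>2) a F H u \<sigma>"
      using assms a adm C norms by (intro flux_dataI) auto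
    have B: "flux_data \<Omega> \<sigma>\<^sub>0 \<sigma>\<^sub>1 m M k\<^sub>2 (2 * \<sigma>\<^sub>2) a Ft H ut \<sigma>t"
      using assms a admt C norms by (intro flux_dataI) auto
    interpret A: flux_data \<Omega> \<sigma>\<^sub>0 \<sigma>\<^sub>1 m M k\<^sub>2 "2 * \<sigma>\<^sub>2" a F H u \<sigma> by (rule A)
    interpret B: flux_data \<Omega> \<sigma>\<^sub>0 \<sigma>\<^sub>1 m M k\<^sub>2 "2 * \<sigma>\<^sub>2" a Ft H ut \<sigma>t by (rule B)
    have M0: "0 \<le> M" using A.J_bd[OF x0] norm_ge_zero order_trans by blast
    have uC: "Ck_closure 1 \<Omega> u" and utC: "Ck_closure 1 \<Omega> ut"
      using adm admt by (auto simp: admissible_def)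
    have ucu: "uniformly_continuous_on \<Omega> (grad u)" and ucut: "uniformly_continuous_on \<Omega> (grad ut)"
      using uC utC assms by (auto intro: grad_uniformly_continuous)
    have ucF: "uniformly_continuous_on \<Omega> F"
      using C(1) assms by (intro uniformly_continuous_extension[of \<Omega> F]) (auto simp: Ck_closure_def)
    have "(LINT x|N. \<bar>u x - ut x\<bar>)
      \<le> 2048 * K * (M / \<sigma>\<^sub>0) / (m / \<sigma>\<^sub>1)\<^sup>2 * (LINT x|N. \<bar>(grad u x - grad ut x) \<bullet> perp (grad u x + F x)\<bar>)"
    proof (rule level_L1_estimate[where v = "\<lambda>x. u x + f x" and Lw = "2 * (M / \<sigma>\<^sub>0 + k\<^sub>2)"])
      fix x assume x: "x \<in> \<Omega>"
      have fd: "(f has_derivative (\<lambda>h. F x \<bullet> h)) (at x)"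
        using Ck_on_differentiable[of 0 \<Omega> f x] f x assms by (auto intro: has_derivative_grad)
      show "((\<lambda>x. u x + f x) has_derivative (\<lambda>h. (grad u x + F x) \<bullet> h)) (at x)"
        unfolding inner_add_left by (intro has_derivative_add has_derivative_grad A.u_diff x fd)
      show "((\<lambda>x. u x - ut x) has_derivative (\<lambda>h. (grad u x - grad ut x) \<bullet> h)) (at x)"
        unfolding inner_diff_left by (intro has_derivative_diff has_derivative_grad A.u_diff B.u_diff x)
      show "m / \<sigma>\<^sub>1 \<le> norm (grad u x + F x)" "norm (grad u x + F x) \<le> M / \<sigma>\<^sub>0"
        using A.Dv_bd[OF x] by (auto simp: A.Dv_def)
      show "norm (grad u x - grad ut x) \<le> 2 * (M / \<sigma>\<^sub>0 + k\<^sub>2)"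
        using norm_triangle_ineq4[of "grad u x" "grad ut x"] A.grad_u_bd[OF x] B.grad_u_bd[OF x] by simp
    next
      show "uniformly_continuous_on \<Omega> (\<lambda>x. grad u x + F x)"
        by (intro uniformly_continuous_on_add ucu ucF)
      show "uniformly_continuous_on \<Omega> (\<lambda>x. grad u x - grad ut x)"
        by (intro uniformly_continuous_on_diff ucu ucut)
      show "continuous_on (closure \<Omega>) (\<lambda>x. u x - ut x)"
        using uC utC by (intro continuous_intros) (auto simp: Ck_closure_def)
      show "hausdorff1 {x \<in> \<Omega>. u x + f x = t} \<le> ennreal K" for t
        unfolding K[symmetric] by (rule SUP_upper) simp
      show "AE x in N. level_reaches_frontier \<Omega> (\<lambda>x. u x + f x) x"
        using well_structured_paths[OF sets_\<Omega> ws] .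
    qed (use assms bc in auto)
    from gradient_stability[OF A B ne _ this] show ?thesis
      using assms M0 by (simp add: set_integral_eq)
  qed
qed

end
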